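(* Suppose Assumptions 1–4 below hold, with $\mu>0$. Run Algorithm 2Direction with $$\bar L=660508\cdot\max\Big\{\frac L\alpha,\frac{Lp}{\alpha\tau},\frac{\sqrt{LL_{\max}}\,p\sqrt{\omega\tau}}{\alpha\beta\sqrt n},\frac{\sqrt{LL_{\max}}\sqrt p\sqrt{\omega\tau}}{\alpha\sqrt\beta\sqrt n},\frac{L_{\max}\omega p^2}{\beta^2n},\frac{L_{\max}\omega}{n}\Big\},$$ $\beta=\frac1{\omega+1}$, $\theta_{\min}=\frac14\min\{1,\frac\alpha p,\frac\tau p,\frac\beta p\}$, $h_i^0=\nabla f_i(z^0)$ for all $i$, $w^0=u^0$, $k^0=\nabla f(z^0)$, $v^0=\nabla f(z^0)$, and $\Gamma_0\ge1$. Then for every $T\ge0$, $$\mathbb E[f(z^T)-f(x^* )]+\frac\mu2\mathbb E\|u^T-x^*\|^2\le2\exp\Big(-\frac TQ\Big)\Big((f(z^0)-f(x^* ))+\Big(\frac{\bar L}{\Gamma_0}+\mu\Big)\|u^0-x^*\|^2\Big),$$ where $$Q=2\sqrt{660508}\cdot\max\Big\{\sqrt{\tfrac{L}{\alpha p\mu}},\sqrt{\tfrac{L}{\alpha\tau\mu}},\sqrt{\tfrac{\sqrt{LL_{\max}}(\omega+1)\sqrt{\omega\tau}}{\alpha\sqrt n\,\mu}},\sqrt{\tfrac{\sqrt{LL_{\max}}\sqrt{\omega+1}\sqrt{\omega\tau}}{\alpha\sqrt p\sqrt n\,\mu}},\sqrt{\tfrac{L_{\max}\omega(\omega+1)^2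p}{n\mu}},\sqrt{\tfrac{L_{\max}\omega}{np\mu}},\tfrac1\alpha,\tfrac1\tau,\omega+1,\tfrac1p\Big\}.$$
   Context: Setting: $f=\frac1n\sum_{i=1}^nf_i$, $f_i:\mathbb R^d\to\mathbb R$. Assumption 1: each $f_i$ is $L_i$-smooth, $L_{\max}=\max_iL_i$, and $\widehat L>0$ satisfies $\frac1n\sum_i\|\nabla f_i(x)-\nabla f_i(y)\|^2\le\widehat L^2\|x-y\|^2$ for all $x,y$. Assumption 2: $f$ is $L$-smooth. Assumption 3: each $f_i$ is convex and $f$ is $\mu$-strongly convex ($\mu\ge0$) with minimizer $x^*$. Assumption 4: the randomness of all compressors is drawn independently (of each other, of the coins $c^t$, and of the past). Compressor classes: $\mathbb U(\omega)$ ($\omega\ge0$) = stochastic maps $\mathcal C$ with $\mathbb E\mathcal C(x)=x$, $\mathbb E\|\mathcal C(x)-x\|^2\le\omega\|x\|^2$; $\mathbb B(\alpha)$ ($\alpha\in(0,1]$) = possibly stochastic maps with $\mathbb E\|\mathcal C(x)-x\|^2\le(1-\alpha)\|x\|^2$. Algorithm 2Direction: compressors $\mathcal C_i^{D,y},\mathcal C_i^{D,z}\in\mathbb U(\omega)$ (workers), $\mathcal C^P\in\mathbb B(\alpha)$ (server); parameters $\bar L>0$, $\mu$ (the strong convexity constant), $p\in(0,1]$, $\Gamma_0\ge1$, $\tau\in(0,1]$, $x^0,h_1^0,\dots,h_n^0,k^0,v^0\in\mathbb R^d$. Set $w^0=z^0=u^0=x^0$, $h^0=\frac1n\sum_ih_i^0$.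 For $t=0,1,\dots$: let $\bar\theta_{t+1}$ be the largest root of $p\bar L\Gamma_t\theta^2+p(\bar L+\Gamma_t\mu)\theta-(\bar L+\Gamma_t\mu)=0$, $\theta_{t+1}=\min\{\bar\theta_{t+1},\theta_{\min}\}$, $\gamma_{t+1}=p\theta_{t+1}\Gamma_t/(1-p\theta_{t+1})$, $\Gamma_{t+1}=\Gamma_t+\gamma_{t+1}$; $y^{t+1}=\theta_{t+1}w^t+(1-\theta_{t+1})z^t$; $m_i^{t,y}=\mathcal C_i^{D,y}(\nabla f_i(y^{t+1})-h_i^t)$; $g^{t+1}=h^t+\frac1n\sum_im_i^{t,y}$; $u^{t+1}=\arg\min_x\{\langle g^{t+1},x\rangle+\frac{\bar L+\Gamma_t\mu}{2\gamma_{t+1}}\|x-u^t\|^2+\frac\mu2\|x-y^{t+1}\|^2\}$; $q^{t+1}=\arg\min_x\{\langle k^t,x\rangle+\frac{\bar L+\Gamma_t\mu}{2\gamma_{t+1}}\|x-w^t\|^2+\frac\mu2\|x-y^{t+1}\|^2\}$; $w^{t+1}=q^{t+1}+\mathcal C^P(u^{t+1}-q^{t+1})$; $x^{t+1}=\theta_{t+1}u^{t+1}+(1-\theta_{t+1})z^t$; draw $c^t\sim\mathrm{Bernoulli}(p)$, and set $(k^{t+1},z^{t+1})=(v^t,x^{t+1})$ if $c^t=1$, $(k^{t+1},z^{t+1})=(k^t,z^t)$ if $c^t=0$; $m_i^{t,z}=\mathcal C_i^{D,z}(\nabla f_i(z^{t+1})-h_i^t)$; $h_i^{t+1}=h_i^t+\beta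 m_i^{t,z}$; $v^{t+1}=(1-\tau)v^t+\tau(h^t+\frac1n\sum_im_i^{t,z})$; $h^{t+1}=h^t+\frac\beta n\sum_im_i^{t,z}$. $\mathbb E$ is full expectation. *)

theory Defs
  imports "HOL-Analysis.Analysis" "HOL-Probability.Probability"
begin

text \<open>A stochastic map C is represented by a measurable function of a random seed r
  (distributed according to a probability measure R) and of the input x.\<close>

definition unbiased_comp :: "'r measure \<Rightarrow> ('r \<Rightarrow> 'a::euclidean_space \<Rightarrow> 'a) \<Rightarrow> real \<Rightarrow> bool" where
  "unbiased_comp R C \<omega> \<longleftrightarrow> prob_space R \<and> (\<lambda>(r, x). C r x) \<in> borel_measurable (R \<Otimes>\<^sub>M borel) \<and>
     (\<forall>x. integrable R (\<lambda>r. C r x) \<and> (\<integral>r. C r x \<partial>R) = x \<and>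
          (\<integral>\<^sup>+ r. ennreal ((norm (C r x - x))\<^sup>2) \<partial>R) \<le> ennreal (\<omega> * (norm x)\<^sup>2))"

definition contractive_comp :: "'r measure \<Rightarrow> ('r \<Rightarrow> 'a::euclidean_space \<Rightarrow> 'a) \<Rightarrow> real \<Rightarrow> bool" where
  "contractive_comp R C \<alpha> \<longleftrightarrow> prob_space R \<and> (\<lambda>(r, x). C r x) \<in> borel_measurable (R \<Otimes>\<^sub>M borel) \<and>
     (\<forall>x. (\<integral>\<^sup>+ r. ennreal ((norm (C r x - x))\<^sup>2) \<partial>R) \<le> ennreal ((1 - \<alpha>) * (norm x)\<^sup>2))"

definition strongly_convex :: "('a::real_normed_vector \<Rightarrow> real) \<Rightarrow> real \<Rightarrow> bool" where
  "strongly_convex F \<mu> \<longleftrightarrow> convex_on UNIV (\<lambda>x. F x - \<mu> / 2 * (norm x)\<^sup>2)"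

definition theta_bar :: "real \<Rightarrow> real \<Rightarrow> real \<Rightarrow> real \<Rightarrow> real" where
  "theta_bar Lb \<mu> p G = (GREATEST \<theta>. p * Lb * G * \<theta>\<^sup>2 + p * (Lb + G * \<mu>) * \<theta> - (Lb + G * \<mu>) = 0)"

definition theta_next :: "real \<Rightarrow> real \<Rightarrow> real \<Rightarrow> real \<Rightarrow> real \<Rightarrow> real" where
  "theta_next Lb \<mu> p thmin G = min (theta_bar Lb \<mu> p G) thmin"

definition gamma_next :: "real \<Rightarrow> real \<Rightarrow> real \<Rightarrow> real \<Rightarrow> real \<Rightarrow> real" where
  "gamma_next Lb \<mu> p thmin G = p * theta_next Lb \<mu> p thmin G * G / (1 - p * theta_next Lb \<mu> p thmin G)"

fun Gam :: "real \<Rightarrow> real \<Rightarrow> real \<Rightarrow> real \<Rightarrow> real \<Rightarrow> nat \<Rightarrow> real" where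
  "Gam Lb \<mu> p thmin G0 0 = G0"
| "Gam Lb \<mu> p thmin G0 (Suc t) = Gam Lb \<mu> p thmin G0 t + gamma_next Lb \<mu> p thmin (Gam Lb \<mu> p thmin G0 t)"

record 'a alg_state =
  st_w :: 'a
  st_z :: 'a
  st_u :: 'a
  st_k :: 'a
  st_v :: 'a
  st_hi :: "nat \<Rightarrow> 'a"
  st_h :: 'a

text \<open>One iteration t -> t+1.  Arguments: n, gradients g i = grad f_i, worker compressors
  CDy i, CDz i, server compressor CP, Lbar, mu, p, theta_min, beta, tau, Gamma_t,
  seeds ry i, rz i, rp drawn at step t, coin c^t, and the state at time t.\<close>

definition alg_step ::
  "nat \<Rightarrow> (nat \<Rightarrow> 'a::euclidean_space \<Rightarrow> 'a) \<Rightarrow> (nat \<Rightarrow> 'r \<Rightarrow> 'a \<Rightarrow> 'a) \<Rightarrow> (nat \<Rightarrow> 'r \<Rightarrow> 'a \<Rightarrow> 'a)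
   \<Rightarrow> ('r \<Rightarrow> 'a \<Rightarrow> 'a) \<Rightarrow> real \<Rightarrow> real \<Rightarrow> real \<Rightarrow> real \<Rightarrow> real \<Rightarrow> real \<Rightarrow> real
   \<Rightarrow> (nat \<Rightarrow> 'r) \<Rightarrow> (nat \<Rightarrow> 'r) \<Rightarrow> 'r \<Rightarrow> bool \<Rightarrow> 'a alg_state \<Rightarrow> 'a alg_state" where
  "alg_step n g CDy CDz CP Lb \<mu> p thmin \<beta> \<tau> G ry rz rp c s =
    (let \<theta> = theta_next Lb \<mu> p thmin G;
         \<gamma> = gamma_next Lb \<mu> p thmin G;
         y = \<theta> *\<^sub>R st_w s + (1 - \<theta>) *\<^sub>R st_z s;
         my = (\<lambda>i. CDy i (ry i) (g i y - st_hi s i));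
         gg = st_h s + (1 / real n) *\<^sub>R (\<Sum>i<n. my i);
         u' = arg_min (\<lambda>x. inner gg x + (Lb + G * \<mu>) / (2 * \<gamma>) * (norm (x - st_u s))\<^sup>2
                            + \<mu> / 2 * (norm (x - y))\<^sup>2) (\<lambda>_. True);
         q' = arg_min (\<lambda>x. inner (st_k s) x + (Lb + G * \<mu>) / (2 * \<gamma>) * (norm (x - st_w s))\<^sup>2
                            + \<mu> / 2 * (norm (x - y))\<^sup>2) (\<lambda>_. True);
         w' = q' + CP rp (u' - q');
         x' = \<theta> *\<^sub>R u' + (1 - \<theta>) *\<^sub>R st_z s;
         k' = (if c then st_v s else st_k s);
         z' = (if c then x' else st_z s);
         mz = (\<lambda>i. CDz i (rz i) (g i z' - st_hi s i));
         hi' = (\<lambda>i. st_hi s i + \<beta> *\<^sub>R mz i);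
         v' = (1 - \<tau>) *\<^sub>R st_v s + \<tau> *\<^sub>R (st_h s + (1 / real n) *\<^sub>R (\<Sum>i<n. mz i));
         h' = st_h s + (\<beta> / real n) *\<^sub>R (\<Sum>i<n. mz i)
     in \<lparr>st_w = w', st_z = z', st_u = u', st_k = k', st_v = v', st_hi = hi', st_h = h'\<rparr>)"

text \<open>The iterates as functions of the sample point of the underlying probability space.
  The seeds of the compressors at step t are ry t i, rz t i, rp t; the coin is c t.\<close>

fun alg_iter ::
  "nat \<Rightarrow> (nat \<Rightarrow> 'a::euclidean_space \<Rightarrow> 'a) \<Rightarrow> (nat \<Rightarrow> 'r \<Rightarrow> 'a \<Rightarrow> 'a) \<Rightarrow> (nat \<Rightarrow> 'r \<Rightarrow> 'a \<Rightarrow> 'a)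
   \<Rightarrow> ('r \<Rightarrow> 'a \<Rightarrow> 'a) \<Rightarrow> real \<Rightarrow> real \<Rightarrow> real \<Rightarrow> real \<Rightarrow> real \<Rightarrow> real \<Rightarrow> real
   \<Rightarrow> 'a alg_state \<Rightarrow> (nat \<Rightarrow> nat \<Rightarrow> 'm \<Rightarrow> 'r) \<Rightarrow> (nat \<Rightarrow> nat \<Rightarrow> 'm \<Rightarrow> 'r) \<Rightarrow> (nat \<Rightarrow> 'm \<Rightarrow> 'r)
   \<Rightarrow> (nat \<Rightarrow> 'm \<Rightarrow> bool) \<Rightarrow> nat \<Rightarrow> 'm \<Rightarrow> 'a alg_state" where
  "alg_iter n g CDy CDz CP Lb \<mu> p thmin \<beta> \<tau> G0 s0 ry rz rp c 0 \<omega> = s0"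
| "alg_iter n g CDy CDz CP Lb \<mu> p thmin \<beta> \<tau> G0 s0 ry rz rp c (Suc t) \<omega> =
     alg_step n g CDy CDz CP Lb \<mu> p thmin \<beta> \<tau> (Gam Lb \<mu> p thmin G0 t)
       (\<lambda>i. ry t i \<omega>) (\<lambda>i. rz t i \<omega>) (rp t \<omega>) (c t \<omega>)
       (alg_iter n g CDy CDz CP Lb \<mu> p thmin \<beta> \<tau> G0 s0 ry rz rp c t \<omega>)"

datatype rand_idx = RY nat nat | RZ nat nat | RPs nat | RC nat

definition gen_events :: "'m measure \<Rightarrow> ('m \<Rightarrow> 'b) \<Rightarrow> 'b measure \<Rightarrow> 'm set set" where
  "gen_events M X N = {X -` A \<inter> space M | A. A \<in> sets N}"

definition rand_indices :: "nat \<Rightarrow> rand_idx set" where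
  "rand_indices n = {RY t i | t i. i < n} \<union> {RZ t i | t i. i < n} \<union> range RPs \<union> range RC"

end

(*
  The Lyapunov function is Gamma_t E[f(z^t) - f(xstar)] + (Lbar + Gamma_t mu)/2 E|u^t - xstar|^2 + p Gamma_t Err_t,
  where Err_t is a weighted sum of the mean squares of h_i^t - grad f_i(z^t), u^t - w^t, k^t - grad f(z^t) and
  v^t - grad f(z^t).  The accelerated one-step estimate leaves a negative Bregman term D_f(z^t, y^{t+1}) and a
  negative term in |u^{t+1} - u^t|^2.  By cocoercivity D_f dominates both |grad f(z) - grad f(y)|^2 / (2 L) and
  the average of |grad f_i(z) - grad f_i(y)|^2 / (2 Lmax).  As x^{t+1} - y^{t+1} = theta (u^{t+1} - w^t), these two
  terms pay for everything that the four errors accumulate in one step, the size of Lbar making all cross costs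
  small.  All errors vanish initially, so the Lyapunov function never increases, and
  Gamma_0 / Gamma_T = prod (1 - p theta_t) <= exp (-T/Q) because p theta_t >= 1/Q.
*)

theory Submission
  imports Defs
begin

section \<open>Smooth convex functions and proximal steps\<close>

text \<open>The errors are coupled in one direction only: \<open>w\<close> is driven by
  \<open>k\<close>, \<open>k\<close> by \<open>v\<close>, \<open>v\<close> by the \<open>hi\<close>,
  and the noise in the gradient estimate again by the \<open>hi\<close>. In this triangular order
  the weights can be chosen in closed form, one after the other, and the entries of the maximum in
  Lbar are what makes the remaining costs small. The error u - w carries the weight \<theta>_t^2
  because the smoothness defect L |x - y|^2 / 2 carries that factor; this works since \<theta>_t
  never increases.

  Conditional expectations are never formed. Sets of seed names play the role of the filtration: a
  seed whose name is not in the set has, jointly with anything measurable in the seeds of the set, a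
  product law, so Fubini integrates the fresh seed first with the past frozen. Finite second moments
  of all iterates are carried through the same induction, because splitting an expectation or
  removing a cross term requires integrability.

  The rate needs a lower bound on \<theta>_t that is uniform in t although \<Gamma>_t grows; it
  comes from testing one fixed argument in the quadratic that defines the step size.\<close>

lemma gderiv_along_line:
  fixes f :: "'a::real_inner \<Rightarrow> real"
  assumes "GDERIV f (y + t *\<^sub>R d) :> g"
  shows "((\<lambda>t. f (y + t *\<^sub>R d)) has_real_derivative inner g d) (at t)"
proof -
  have "((\<lambda>t. y + t *\<^sub>R d) has_derivative (\<lambda>h. h *\<^sub>R d)) (at t)"
    by (auto intro!: derivative_eq_intros)
  moreover have "(f has_derivative (\<lambda>h. inner h g)) (at (y + t *\<^sub>R d))"
    using assms by (simp add: gderiv_def)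
  ultimately have "((\<lambda>t. f (y + t *\<^sub>R d)) has_derivative (\<lambda>h. inner (h *\<^sub>R d) g)) (at t)"
    by (rule has_derivative_compose)
  moreover have "(\<lambda>h. inner (h *\<^sub>R d) g) = (*) (inner g d)"
    by (auto simp: inner_commute)
  ultimately show ?thesis by (simp add: has_field_derivative_def)
qed

text \<open>Restricting \<open>f\<close> to the line through \<open>y\<close> and \<open>x\<close>
  reduces the claim to the tangent inequality for convex functions of one variable.\<close>

lemma convex_on_above_gradient:
  fixes f :: "'a::real_inner \<Rightarrow> real"
  assumes cvx: "convex_on UNIV f" and der: "GDERIV f y :> g"
  shows "f y + inner g (x - y) \<le> f x"
proof -
  define \<phi> where "\<phi> t = f (y + t *\<^sub>R (x - y))" for t :: real
  have "convex_on UNIV \<phi>"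
  proof (rule convex_onI)
    fix t a b :: real assume "0 < t" "t < 1"
    have eq: "y + ((1 - t) *\<^sub>R a + t *\<^sub>R b) *\<^sub>R (x - y)
        = (1 - t) *\<^sub>R (y + a *\<^sub>R (x - y)) + t *\<^sub>R (y + b *\<^sub>R (x - y))"
      by (simp add: algebra_simps)
    show "\<phi> ((1 - t) *\<^sub>R a + t *\<^sub>R b) \<le> (1 - t) * \<phi> a + t * \<phi> b"
      unfolding \<phi>_def eq using \<open>0 < t\<close> \<open>t < 1\<close> by (intro convex_onD[OF cvx]) auto
  qed simp
  moreover have "(\<phi> has_real_derivative inner g (x - y)) (at 0 within UNIV)"
    unfolding \<phi>_def using gderiv_along_line[of f y 0 "x - y" g] der by simp
  ultimately have "\<phi> 1 - \<phi> 0 \<ge> inner g (x - y) * (1 - 0)"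
    by (intro convex_on_imp_above_tangent[where A = UNIV]) auto
  then show ?thesis by (simp add: \<phi>_def)
qed

text \<open>No integral along the segment is taken: \<open>\<phi>\<close> is the difference of the
  two sides along it, up to a constant, and Cauchy-Schwarz with the Lipschitz bound makes its
  derivative nonpositive on [0, 1].\<close>

lemma lipschitz_gradient_upper:
  fixes f :: "'a::real_inner \<Rightarrow> real"
  assumes der: "\<And>x. GDERIV f x :> g x" and lip: "\<And>x y. norm (g x - g y) \<le> L * norm (x - y)"
  shows "f x \<le> f y + inner (g y) (x - y) + L / 2 * (norm (x - y))\<^sup>2"
proof -
  define d where "d = x - y"
  define \<phi> where "\<phi> t = f (y + t *\<^sub>R d) - t * inner (g y) d - L / 2 * t\<^sup>2 * (norm d)\<^sup>2" for t
  have "\<phi> 1 \<le> \<phi> 0"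
  proof (rule DERIV_nonpos_imp_nonincreasing[where f = \<phi> and a = 0 and b = 1])
    fix t :: real assume t: "0 \<le> t" "t \<le> 1"
    have "(\<phi> has_real_derivative inner (g (y + t *\<^sub>R d)) d - inner (g y) d - L * t * (norm d)\<^sup>2) (at t)"
      unfolding \<phi>_def by (auto intro!: derivative_eq_intros gderiv_along_line der)
    moreover have "inner (g (y + t *\<^sub>R d)) d - inner (g y) d \<le> L * t * (norm d)\<^sup>2"
    proof -
      have "inner (g (y + t *\<^sub>R d) - g y) d \<le> norm (g (y + t *\<^sub>R d) - g y) * norm d"
        by (rule norm_cauchy_schwarz)
      also have "\<dots> \<le> (L * norm (t *\<^sub>R d)) * norm d"
        using lip[of "y + t *\<^sub>R d" y] by (intro mult_right_mono) auto
      finally show ?thesis using t by (simp add: inner_diff_left power2_eq_square)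
    qed
    ultimately show "\<exists>D. (\<phi> has_real_derivative D) (at t) \<and> D \<le> 0" by force
  qed simp
  then show ?thesis by (simp add: \<phi>_def d_def)
qed

text \<open>Compare two bounds for \<open>f\<close> at the point reached from \<open>x\<close> by a
  step of size 1/L along the gradient difference: the tangent at \<open>y\<close> from below, the
  quadratic bound at \<open>x\<close> from above. The tangent inequality is assumed in place of
  convexity, since for \<open>F\<close> it is obtained from the nonnegative Bregman
  divergence.\<close>

lemma lipschitz_gradient_cocoercive:
  fixes f :: "'a::real_inner \<Rightarrow> real"
  assumes above: "\<And>x y. f y + inner (g y) (x - y) \<le> f x" and der: "\<And>x. GDERIV f x :> g x"
    and lip: "\<And>x y. norm (g x - g y) \<le> L * norm (x - y)"
  shows "(norm (g x - g y))\<^sup>2 \<le> 2 * L * (f x - f y - inner (g y) (x - y))"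
proof (cases "L \<le> 0")
  case True
  then have "norm (g x - g y) \<le> 0"
    using lip[of x y] by (meson mult_nonpos_nonneg norm_ge_zero order_trans)
  then have gxy: "g x = g y" by simp
  \<comment> \<open>The Lipschitz bound now reads 0 \<le> L |x - y| with L \<le> 0. In both cases
    the right-hand side of the claim is 0.\<close>
  have "L = 0 \<or> x = y"
    using lip[of x y] True gxy by (auto simp: zero_le_mult_iff)
  then show ?thesis using gxy by auto
next
  case False
  define e where "e = g x - g y"
  define v where "v = x - (1 / L) *\<^sub>R e"
  have "f y + inner (g y) (v - y) \<le> f v"
    by (rule above)
  moreover have "f v \<le> f x + inner (g x) (v - x) + L / 2 * (norm (v - x))\<^sup>2"
    by (rule lipschitz_gradient_upper[OF der lip])
  moreover have "v - x = - ((1 / L) *\<^sub>R e)" "v - y = (x - y) - (1 / L) *\<^sub>R e"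
    by (auto simp: v_def)
  moreover have "L / 2 * (norm ((1 / L) *\<^sub>R e))\<^sup>2 = (norm e)\<^sup>2 / (2 * L)"
    using False by (simp add: power_mult_distrib power2_eq_square field_simps)
  moreover have "inner (g x) ((1 / L) *\<^sub>R e) - inner (g y) ((1 / L) *\<^sub>R e) = (norm e)\<^sup>2 / L"
    by (simp add: e_def power2_norm_eq_inner inner_diff_left diff_divide_distrib)
  ultimately have "(norm e)\<^sup>2 / L - (norm e)\<^sup>2 / (2 * L) \<le> f x - f y - inner (g y) (x - y)"
    by (simp add: inner_diff_right)
  then show ?thesis using False by (simp add: e_def field_simps)
qed

section \<open>Young's inequality and the proximal step\<close>

lemma norm_add_sq_le:
  fixes a b :: "'a::real_inner"
  assumes "s > 0"
  shows "(norm (a + b))\<^sup>2 \<le> (1 + s) * (norm a)\<^sup>2 + (1 + 1 / s) * (norm b)\<^sup>2"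
proof -
  have "0 \<le> (norm (s *\<^sub>R a - b))\<^sup>2 / s" using assms by simp
  also have "\<dots> = s * (norm a)\<^sup>2 - 2 * inner a b + (norm b)\<^sup>2 / s"
    unfolding power2_norm_eq_inner using assms
    by (simp add: inner_diff_left inner_diff_right inner_commute field_simps power2_eq_square)
  finally show ?thesis
    unfolding power2_norm_eq_inner
    by (simp add: inner_add_left inner_add_right inner_commute algebra_simps)
qed

lemma norm_add_sq_le_double:
  fixes a b :: "'a::real_inner"
  shows "(norm (a + b))\<^sup>2 \<le> 2 * (norm a)\<^sup>2 + 2 * (norm b)\<^sup>2"
  using norm_add_sq_le[of 1 a b] by simp

text \<open>Completing the square at the stationary point \<open>m\<close> of the quadratic. It is
  used twice: to identify the \<open>arg_min\<close> of the algorithm, and as the three-point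
  identity at \<open>xstar\<close> in the objective estimate.\<close>

lemma sum_of_squares_shift:
  fixes u v x :: "'a::real_inner"
  assumes "A + \<mu> \<noteq> 0" and m: "m = (1 / (A + \<mu>)) *\<^sub>R (A *\<^sub>R u + \<mu> *\<^sub>R y - g)"
  shows "inner g x + A / 2 * (norm (x - u))\<^sup>2 + \<mu> / 2 * (norm (x - y))\<^sup>2
    = inner g m + A / 2 * (norm (m - u))\<^sup>2 + \<mu> / 2 * (norm (m - y))\<^sup>2 + (A + \<mu>) / 2 * (norm (x - m))\<^sup>2"
proof -
  have "(A + \<mu>) *\<^sub>R m = A *\<^sub>R u + \<mu> *\<^sub>R y - g" using assms by simp
  then have g: "g = A *\<^sub>R u + \<mu> *\<^sub>R y - (A + \<mu>) *\<^sub>R m" by (simp add: algebra_simps)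
  show ?thesis unfolding g power2_norm_eq_inner
    by (simp add: inner_diff_left inner_diff_right inner_add_left inner_add_right inner_commute field_simps)
qed

text \<open>\<open>arg_min\<close> is a choice operator, so a minimiser is exhibited first; the
  completed square then forces the chosen one to have distance 0 from it.\<close>

lemma arg_min_prox:
  fixes u y g :: "'a::real_inner"
  assumes "A + \<mu> > 0"
  shows "arg_min (\<lambda>x. inner g x + A / 2 * (norm (x - u))\<^sup>2 + \<mu> / 2 * (norm (x - y))\<^sup>2) (\<lambda>_. True)
    = (1 / (A + \<mu>)) *\<^sub>R (A *\<^sub>R u + \<mu> *\<^sub>R y - g)" (is "arg_min ?h _ = ?m")
proof -
  have eq: "?h x = ?h ?m + (A + \<mu>) / 2 * (norm (x - ?m))\<^sup>2" for x
    by (rule sum_of_squares_shift) (use assms in auto)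
  have "?h ?m \<le> ?h x" for x using eq[of x] assms by simp
  then have "is_arg_min ?h (\<lambda>_. True) ?m" by (simp add: is_arg_min_linorder)
  then have "is_arg_min ?h (\<lambda>_. True) (arg_min ?h (\<lambda>_. True))"
    unfolding arg_min_def by (rule someI)
  then have "?h (arg_min ?h (\<lambda>_. True)) \<le> ?h ?m"
    unfolding is_arg_min_linorder by blast
  then have "(A + \<mu>) / 2 * (norm (arg_min ?h (\<lambda>_. True) - ?m))\<^sup>2 \<le> 0"
    using eq[of "arg_min ?h (\<lambda>_. True)"] by linarith
  then show ?thesis using assms by (simp add: mult_le_0_iff)
qed

section \<open>The root that defines the step size\<close>

context
  fixes Lb \<mu> p G :: real
  assumes pos: "Lb > 0" "\<mu> > 0" "p > 0" "G > 0"
begin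

text \<open>\<open>GREATEST\<close> over the reals says nothing until a largest root is exhibited.
  It is the positive root \<open>r\<close> of the quadratic formula: the quadratic increases
  strictly on the positive axis, so no root lies above \<open>r\<close>.\<close>

lemma theta_bar_root:
  "p * Lb * G * (theta_bar Lb \<mu> p G)\<^sup>2 + p * (Lb + G * \<mu>) * theta_bar Lb \<mu> p G - (Lb + G * \<mu>) = 0"
  and theta_bar_pos: "theta_bar Lb \<mu> p G > 0"
proof -
  define P where "P x = p * Lb * G * x\<^sup>2 + p * (Lb + G * \<mu>) * x - (Lb + G * \<mu>)" for x
  define a b c where "a = p * Lb * G" and "b = p * (Lb + G * \<mu>)" and "c = Lb + G * \<mu>"
  have abc: "a > 0" "b > 0" "c > 0" using pos by (auto simp: a_def b_def c_def intro!: add_pos_pos mult_pos_pos)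
  define r where "r = (- b + sqrt (b\<^sup>2 + 4 * a * c)) / (2 * a)"
  have "sqrt (b\<^sup>2 + 4 * a * c) > sqrt (b\<^sup>2)" using abc by (intro real_sqrt_less_mono) simp
  then have r: "r > 0" using abc by (simp add: r_def)
  have P: "P x = a * x\<^sup>2 + b * x - c" for x by (simp add: P_def a_def b_def c_def)
  have "2 * a * r = sqrt (b\<^sup>2 + 4 * a * c) - b" using abc by (simp add: r_def)
  then have "(2 * a * r + b)\<^sup>2 = b\<^sup>2 + 4 * a * c" using abc by simp
  then have "4 * a * P r = 0" by (simp add: P power2_eq_square algebra_simps)
  then have Pr: "P r = 0" using abc by simp
  have "(GREATEST x. P x = 0) = r"
  proof (rule Greatest_equality)
    show "P r = 0" by fact
    fix x assume x: "P x = 0"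
    show "x \<le> r"
    proof (rule ccontr)
      assume "\<not> x \<le> r"
      then have "a * r\<^sup>2 < a * x\<^sup>2" "b * r < b * x" using abc r
        by (auto intro!: mult_strict_left_mono power_strict_mono simp del: mult_less_cancel_left_pos)
      then show False using x Pr by (simp add: P)
    qed
  qed
  then have "theta_bar Lb \<mu> p G = r" by (simp add: theta_bar_def P_def)
  then show "p * Lb * G * (theta_bar Lb \<mu> p G)\<^sup>2 + p * (Lb + G * \<mu>) * theta_bar Lb \<mu> p G - (Lb + G * \<mu>) = 0"
    and "theta_bar Lb \<mu> p G > 0"
    using Pr r by (auto simp: P_def)
qed

text \<open>The quadratic increases on nonnegative arguments, so its sign tells on which side of the
  root an argument lies. Later comparisons with the root use this test and never the closed
  form.\<close>

lemma le_theta_bar_iff: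
  assumes "x \<ge> 0"
  shows "x \<le> theta_bar Lb \<mu> p G
    \<longleftrightarrow> p * Lb * G * x\<^sup>2 + p * (Lb + G * \<mu>) * x \<le> Lb + G * \<mu>"
proof -
  have "p * Lb * G > 0" "p * (Lb + G * \<mu>) > 0"
    using pos by (auto intro!: add_pos_pos mult_pos_pos)
  note * = this theta_bar_root theta_bar_pos assms
  show ?thesis
  proof
    assume "x \<le> theta_bar Lb \<mu> p G"
    then have "p * Lb * G * x\<^sup>2 \<le> p * Lb * G * (theta_bar Lb \<mu> p G)\<^sup>2"
      "p * (Lb + G * \<mu>) * x \<le> p * (Lb + G * \<mu>) * theta_bar Lb \<mu> p G"
      using * by (auto intro!: mult_left_mono power_mono simp del: mult_le_cancel_left_pos)
    then show "p * Lb * G * x\<^sup>2 + p * (Lb + G * \<mu>) * x \<le> Lb + G * \<mu>" using *(3) by linarith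
  next
    assume le: "p * Lb * G * x\<^sup>2 + p * (Lb + G * \<mu>) * x \<le> Lb + G * \<mu>"
    show "x \<le> theta_bar Lb \<mu> p G"
    proof (rule ccontr)
      assume "\<not> x \<le> theta_bar Lb \<mu> p G"
      then have "p * Lb * G * x\<^sup>2 > p * Lb * G * (theta_bar Lb \<mu> p G)\<^sup>2"
        "p * (Lb + G * \<mu>) * x > p * (Lb + G * \<mu>) * theta_bar Lb \<mu> p G"
        using * by (auto intro!: mult_strict_left_mono power_strict_mono simp del: mult_less_cancel_left_pos)
      then show False using *(3) le by linarith
    qed
  qed
qed

end

text \<open>At the root \<open>x\<close> for \<open>G'\<close> the equation reads e G' = Lb (1 - p
  x) with e = p Lb x^2 + p \<mu> x - \<mu>, and its right-hand side is nonnegative. Hence e G \<le>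
  Lb (1 - p x) for the smaller \<open>G\<close>, whatever the sign of e.\<close>

lemma theta_bar_antimono:
  assumes pos: "Lb > 0" "\<mu> > 0" "p > 0" "0 < G" "G \<le> G'"
  shows "theta_bar Lb \<mu> p G' \<le> theta_bar Lb \<mu> p G"
proof -
  have G': "0 < G'" using pos by linarith
  define x where "x = theta_bar Lb \<mu> p G'"
  have x: "x > 0" and root: "p * Lb * G' * x\<^sup>2 + p * (Lb + G' * \<mu>) * x - (Lb + G' * \<mu>) = 0"
    unfolding x_def using theta_bar_root theta_bar_pos pos G' by auto
  have "(p * Lb * x\<^sup>2 + p * \<mu> * x - \<mu>) * G' = Lb * (1 - p * x)"
    using root by (simp add: algebra_simps)
  moreover have "0 \<le> Lb * (1 - p * x)"
  proof (rule ccontr)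
    assume *: "\<not> 0 \<le> Lb * (1 - p * x)"
    then have "p * x > 1" using pos by (simp add: zero_le_mult_iff)
    then have "(p * x - 1) * (Lb + G' * \<mu>) > 0" using pos G' by (intro mult_pos_pos add_pos_pos) auto
    moreover have "p * Lb * G' * x\<^sup>2 > 0" using pos G' x by simp
    ultimately show False using root by (simp add: algebra_simps)
  qed
  ultimately have "(p * Lb * x\<^sup>2 + p * \<mu> * x - \<mu>) * G \<le> Lb * (1 - p * x)"
    using pos G' by (smt (verit) mult_left_mono mult_nonneg_nonneg mult_nonpos_nonneg mult_pos_pos)
  then have "x \<le> theta_bar Lb \<mu> p G"
    using x pos by (subst le_theta_bar_iff) (auto simp: algebra_simps)
  then show ?thesis by (simp add: x_def)
qed

section \<open>Weights of the error terms\<close>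

text \<open>The linear bookkeeping of the error recursion, separated because linear arithmetic does not
  recognise the nonlinear summands as atoms.\<close>

lemma linear_budget:
  fixes D X :: real
  assumes "h' \<le> h - hb + hg" "n' \<le> n - nb + ng + nh + nG" "k' \<le> k - kb + kn + kg" "w' \<le> w - wb + wk + wv"
    "kn = nb" "wk \<le> kb + d1" "v + wv + nh \<le> hb + d2"
    "cG \<le> 4 / 1000 * D + 2 / 1000 * X" "cF \<le> 4 / 1000 * D + 2 / 1000 * X"
    "hg + nG = cG" "kg + ng = cF" "X \<le> y + wb" "d1 \<le> 1 / 100 * D" "d2 \<le> 1 / 100 * D" "0 \<le> X" "0 \<le> D"
    "3 / 4 * D \<le> d" "x = X / 2"
  shows "v + x + (h' + w' + k' + n') \<le> d + y + (h + w + k + n)"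
  using assms by linarith

text \<open>This is the deterministic half of the argument: real numbers stand for the mean squares,
  so that the choice of the weights is checked without any probability.\<close>

locale two_direction_params =
  fixes \<alpha> \<beta> p \<tau> \<omega> L Lmax Lb n :: real
  assumes pos: "0 < \<alpha>" "\<alpha> \<le> 1" "0 < \<beta>" "\<beta> \<le> 1" "0 < p" "p \<le> 1" "0 < \<tau>" "\<tau> \<le> 1" "0 \<le> \<omega>" "0 < L" "0 \<le> Lmax" "0 < Lb" "1 \<le> n"
    and Lb: "660508 * (L / \<alpha>) \<le> Lb" "660508 * (L * p / (\<alpha> * \<tau>)) \<le> Lb"
      "660508 * (sqrt (L * Lmax) * p * sqrt (\<omega> * \<tau>) / (\<alpha> * \<beta> * sqrt n)) \<le> Lb"
      "660508 * (sqrt (L * Lmax) * sqrt p * sqrt (\<omega> * \<tau>) / (\<alpha> * sqrt \<beta> * sqrt n)) \<le> Lb"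
      "660508 * (Lmax * \<omega> * p\<^sup>2 / (\<beta>\<^sup>2 * n)) \<le> Lb" "660508 * (Lmax * \<omega> / n) \<le> Lb"
begin

text \<open>The weights are fixed in the order W, K, N, H. Since \<open>p \<theta>\<close> is at most a quarter of \<open>\<alpha>\<close>, \<open>p\<close>,
  \<open>\<tau>\<close> and \<open>\<beta>\<close>, each error contracts faster than \<open>\<Gamma>\<close> grows; its weight makes the surplus cover the
  cost of that error in the recursions of the errors treated before.\<close>

definition "wt_W = 8 * L / \<alpha>"
definition "wt_K = 48 * L / (\<alpha>\<^sup>2 * Lb\<^sup>2 * p)"
definition "wt_N = 384 * L / (\<alpha>\<^sup>2 * Lb\<^sup>2 * \<tau>)"
definition "wt_H = 16 * \<omega> / (n * \<beta> * Lb) + 3072 * L * \<tau> * \<omega> / (n * \<beta> * \<alpha>\<^sup>2 * Lb\<^sup>2)"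
definition "cost_G = wt_H * (p + 2 * p\<^sup>2 / \<beta>) + 2 * p * wt_N * \<tau>\<^sup>2 * \<omega> / n"
definition "cost_GF = 2 * p * wt_K + wt_N * (p + 2 * p\<^sup>2 / \<tau>)"

lemma wt_nonneg: "0 \<le> wt_W" "0 \<le> wt_K" "0 \<le> wt_N" "0 \<le> wt_H" "0 \<le> cost_G" "0 \<le> cost_GF"
  using pos by (auto simp: wt_W_def wt_K_def wt_N_def wt_H_def cost_G_def cost_GF_def
      intro!: add_nonneg_nonneg mult_nonneg_nonneg divide_nonneg_nonneg)

lemma sq_le_of_le_Lb:
  assumes "660508 * x \<le> Lb" "0 \<le> x"
  shows "x\<^sup>2 / Lb\<^sup>2 \<le> 1 / 436270818064"
proof -
  have "(660508 * x)\<^sup>2 \<le> Lb\<^sup>2" using assms by (intro power_mono) auto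
  then show ?thesis using pos by (simp add: field_simps power_mult_distrib)
qed

text \<open>\<open>e1\<close> to \<open>e4\<close> are the squares of the first four entries of the
  maximum over \<open>Lb\<close>, which removes their roots; \<open>e5\<close> and \<open>e6\<close>
  are the last two entries over \<open>Lb\<close>. The number 436270818064 is the square of 660508.
  The costs below are combinations of these six terms.\<close>

lemma small_terms:
  defines "e1 \<equiv> L\<^sup>2 / (\<alpha>\<^sup>2 * Lb\<^sup>2)" and "e2 \<equiv> L\<^sup>2 * p\<^sup>2 / (\<alpha>\<^sup>2 * \<tau>\<^sup>2 * Lb\<^sup>2)"
    and "e3 \<equiv> L * Lmax * \<omega> * \<tau> * p\<^sup>2 / (\<alpha>\<^sup>2 * \<beta>\<^sup>2 * n * Lb\<^sup>2)"
    and "e4 \<equiv> L * Lmax * \<omega> * \<tau> * p / (\<alpha>\<^sup>2 * \<beta> * n * Lb\<^sup>2)"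
    and "e5 \<equiv> Lmax * \<omega> * p\<^sup>2 / (\<beta>\<^sup>2 * n * Lb)" and "e6 \<equiv> Lmax * \<omega> / (n * Lb)"
  shows "e1 \<le> 1 / 436270818064" "e2 \<le> 1 / 436270818064" "e3 \<le> 1 / 436270818064" "e4 \<le> 1 / 436270818064"
    "e5 \<le> 1 / 660508" "e6 \<le> 1 / 660508"
proof -
  have "0 \<le> L / \<alpha>" "0 \<le> L * p / (\<alpha> * \<tau>)"
     "0 \<le> sqrt (L * Lmax) * p * sqrt (\<omega> * \<tau>) / (\<alpha> * \<beta> * sqrt n)"
     "0 \<le> sqrt (L * Lmax) * sqrt p * sqrt (\<omega> * \<tau>) / (\<alpha> * sqrt \<beta> * sqrt n)"
    using pos by auto
  note * = this[THEN sq_le_of_le_Lb[rotated]]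
  have sq: "(sqrt (L * Lmax))\<^sup>2 = L * Lmax" "(sqrt (\<omega> * \<tau>))\<^sup>2 = \<omega> * \<tau>" "(sqrt n)\<^sup>2 = n" "(sqrt p)\<^sup>2 = p" "(sqrt \<beta>)\<^sup>2 = \<beta>"
    using pos by auto
  show "e1 \<le> 1 / 436270818064" using *(1) Lb(1) by (simp add: e1_def power_divide power_mult_distrib)
  show "e2 \<le> 1 / 436270818064" using *(2) Lb(2) by (simp add: e2_def power_divide power_mult_distrib)
  show "e3 \<le> 1 / 436270818064"
    using *(3)[OF Lb(3)] unfolding e3_def power_divide power_mult_distrib sq by (simp add: ac_simps)
  show "e4 \<le> 1 / 436270818064"
    using *(4)[OF Lb(4)] unfolding e4_def power_divide power_mult_distrib sq by (simp add: ac_simps)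
  show "e5 \<le> 1 / 660508" using Lb(5) pos by (simp add: e5_def field_simps)
  show "e6 \<le> 1 / 660508" using Lb(6) pos by (simp add: e6_def field_simps)
qed

text \<open>\<open>e6\<close> and \<open>e5\<close> have order 0 and 2 in p / \<beta>, and
  \<open>e1\<close> and \<open>e2\<close> have order 0 and 2 in p / \<tau>. Terms of order 1 also
  occur in the costs and are interpolated between the two.\<close>

lemma ratio_le: "0 < b \<Longrightarrow> p / b \<le> 1 + p\<^sup>2 / b\<^sup>2" for b :: real
proof -
  assume "0 < b"
  then have "0 \<le> p / b" using pos by simp
  then show ?thesis using sum_squares_bound[of "p / b" 1] unfolding power_divide by simp
qed

text \<open>\<open>cost_G\<close> is the price, summed over the error recursions, of one unit of
  mean square change of the individual gradients between z and x; the factor \<open>Lmax\<close>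
  comes from bounding that change by the Bregman term and by |x - y|^2. Multiplied out, only terms
  controlled by \<open>e3\<close> to \<open>e6\<close> remain.\<close>

lemma cost_G_small: "Lmax * cost_G \<le> 1 / 1000"
proof -
  let ?a = "Lmax * \<omega> / (n * Lb)" and ?r = "p / \<beta> + 2 * (p\<^sup>2 / \<beta>\<^sup>2)"
  let ?b = "L * Lmax * \<omega> * \<tau> / (\<alpha>\<^sup>2 * n * Lb\<^sup>2)"
  have "Lmax * cost_G = 16 * (?a * ?r) + 3072 * (?b * ?r) + 768 * (?b * p)"
    using pos by (simp add: cost_G_def wt_H_def wt_N_def field_simps power2_eq_square)
  moreover have "?a * ?r \<le> 4 / 660508"
  proof -
    have "?r \<le> 1 + 3 * (p\<^sup>2 / \<beta>\<^sup>2)" using ratio_le[OF pos(3)] by linarith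
    then have "?a * ?r \<le> ?a * (1 + 3 * (p\<^sup>2 / \<beta>\<^sup>2))" using pos by (intro mult_left_mono) auto
    also have "\<dots> = ?a + 3 * (Lmax * \<omega> * p\<^sup>2 / (\<beta>\<^sup>2 * n * Lb))"
      by (simp add: distrib_left ac_simps)
    finally show ?thesis using small_terms(5,6) by linarith
  qed
  moreover have "?b * ?r \<le> 3 / 436270818064"
  proof -
    have "?b * (p / \<beta>) = L * Lmax * \<omega> * \<tau> * p / (\<alpha>\<^sup>2 * \<beta> * n * Lb\<^sup>2)"
      "?b * (2 * (p\<^sup>2 / \<beta>\<^sup>2)) = 2 * (L * Lmax * \<omega> * \<tau> * p\<^sup>2 / (\<alpha>\<^sup>2 * \<beta>\<^sup>2 * n * Lb\<^sup>2))"
      by (simp_all add: ac_simps)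
    then have "?b * ?r = L * Lmax * \<omega> * \<tau> * p / (\<alpha>\<^sup>2 * \<beta> * n * Lb\<^sup>2)
        + 2 * (L * Lmax * \<omega> * \<tau> * p\<^sup>2 / (\<alpha>\<^sup>2 * \<beta>\<^sup>2 * n * Lb\<^sup>2))"
      by (simp only: distrib_left)
    then show ?thesis using small_terms(3,4) by linarith
  qed
  moreover have "?b * p \<le> 1 / 436270818064"
  proof -
    have "p \<le> p / \<beta>" using pos by (simp add: field_simps)
    then have "?b * p \<le> ?b * (p / \<beta>)" using pos by (intro mult_left_mono) auto
    also have "\<dots> = L * Lmax * \<omega> * \<tau> * p / (\<alpha>\<^sup>2 * \<beta> * n * Lb\<^sup>2)"
      by (simp add: ac_simps)
    finally show ?thesis using small_terms(4) by linarith
  qed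
  ultimately show ?thesis by linarith
qed

lemma cost_GF_small: "L * cost_GF \<le> 1 / 1000"
proof -
  let ?e = "L\<^sup>2 / (\<alpha>\<^sup>2 * Lb\<^sup>2)" and ?f = "L\<^sup>2 * p\<^sup>2 / (\<alpha>\<^sup>2 * \<tau>\<^sup>2 * Lb\<^sup>2)"
  have "L * cost_GF = 96 * ?e + 384 * (?e * (p / \<tau>)) + 768 * ?f"
    using pos by (simp add: cost_GF_def wt_K_def wt_N_def field_simps power2_eq_square)
  moreover have "?e * (p / \<tau>) \<le> ?e + ?f"
  proof -
    have "?e * (p / \<tau>) \<le> ?e * (1 + p\<^sup>2 / \<tau>\<^sup>2)"
      using ratio_le[of \<tau>] pos by (intro mult_left_mono) auto
    also have "\<dots> = ?e + ?f" unfolding distrib_left by (simp add: ac_simps)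
    finally show ?thesis .
  qed
  moreover note small_terms(1,2)
  \<comment> \<open>Variables replace the nonlinear quotients, which makes the final estimate
    linear.\<close>
  moreover have "z \<le> 1 / 1000" if "z = 96 * e + 384 * x + 768 * f" "x \<le> e + f"
    "e \<le> 1 / 436270818064" "f \<le> 1 / 436270818064" for z e x f :: real
    using that by linarith
  ultimately show ?thesis by blast
qed

lemma L_le_Lb: "4 * L \<le> Lb" "2 * wt_W \<le> Lb"
proof -
  have *: "L \<le> L / \<alpha>" "0 \<le> L / \<alpha>" using pos by (auto simp: field_simps)
  have "4 * L \<le> 4 * (L / \<alpha>)" using * by simp
  also have "\<dots> \<le> 660508 * (L / \<alpha>)" using * by (intro mult_right_mono) auto
  finally show "4 * L \<le> Lb" using Lb(1) by linarith
  have "2 * wt_W = 16 * (L / \<alpha>)" by (simp add: wt_W_def)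
  also have "\<dots> \<le> 660508 * (L / \<alpha>)" using * by (intro mult_right_mono) auto
  finally show "2 * wt_W \<le> Lb" using Lb(1) by linarith
qed

text \<open>Primes mark values after the step. \<open>D\<close> is the Bregman term,
  \<open>V\<close> the noise at y, \<open>X\<close> and \<open>Y\<close> are the mean squares of
  u^{t+1} - w^t and u^{t+1} - u^t, \<open>Ky\<close> is the error of k against the gradient at y,
  and \<open>G\<close>, \<open>GF\<close> are the gradient changes from z to x. Once the factor 1 -
  p \<theta> is split off, the errors W, K, N and H keep the shares \<alpha>/4, 3p/4, \<tau>/4 and
  \<beta>/4. These help to pay, in this order, for X, for Ky, for N in the recursion of K, and for H
  in V and in the recursion of N. The rest consists of small multiples of D and X.\<close>

lemma error_terms_recursion:
  fixes \<theta> :: real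
  assumes nn: "0 \<le> D" "0 \<le> V" "0 \<le> H" "0 \<le> W" "0 \<le> K" "0 \<le> N" "0 \<le> X" "0 \<le> Y" "0 \<le> Ky" "0 \<le> G" "0 \<le> GF"
    and \<theta>: "0 < \<theta>" "\<theta> \<le> 1 / 4" "p * \<theta> \<le> \<alpha> / 4" "p * \<theta> \<le> \<beta> / 4" "p * \<theta> \<le> \<tau> / 4"
    and \<theta>': "0 \<le> \<theta>'" "\<theta>' \<le> \<theta>"
    and b: "\<theta>\<^sup>2 * b \<le> 1 / Lb\<^sup>2"
    and V: "V \<le> 2 * \<omega> / n * (2 * Lmax * D + H)"
    and X: "X \<le> 2 * Y + 2 * W"
    and G: "G \<le> 4 * Lmax * D + 2 * L * Lmax * \<theta>\<^sup>2 * X"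
    and GF: "GF \<le> 4 * L * D + 2 * L\<^sup>2 * \<theta>\<^sup>2 * X"
    and Ky: "Ky \<le> 2 * K + 4 * L * D"
    and H': "H' \<le> (1 - \<beta> / 2) * H + (p + 2 * p\<^sup>2 / \<beta>) * G"
    and W': "0 \<le> W'" "W' \<le> (1 - \<alpha> / 2) * W + 2 / \<alpha> * b * Ky + b * V"
    and K': "K' \<le> (1 - p) * K + 2 * p * N + 2 * p * GF"
    and N': "N' \<le> (1 - \<tau> / 2) * N + (p + 2 * p\<^sup>2 / \<tau>) * GF + \<tau>\<^sup>2 * \<omega> / n * (2 * H + 2 * p * G)"
  shows "V / Lb + L * \<theta>\<^sup>2 / 2 * X + (wt_H * H' + wt_W * \<theta>'\<^sup>2 * W' + wt_K * K' + wt_N * N')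
    \<le> (1 - \<theta>) * D + Lb * \<theta>\<^sup>2 / 2 * Y
      + (1 - p * \<theta>) * (wt_H * H + wt_W * \<theta>\<^sup>2 * W + wt_K * K + wt_N * N)"
proof -
  have H1: "wt_H * H' \<le> wt_H * ((1 - p * \<theta>) * H) - wt_H * (\<beta> / 4) * H + wt_H * (p + 2 * p\<^sup>2 / \<beta>) * G"
  proof -
    have "(1 - \<beta> / 2) * H \<le> (1 - p * \<theta> - \<beta> / 4) * H" using \<theta>(4) nn by (intro mult_right_mono) auto
    then have "H' \<le> (1 - p * \<theta> - \<beta> / 4) * H + (p + 2 * p\<^sup>2 / \<beta>) * G" using H' by linarith
    from mult_left_mono[OF this wt_nonneg(4)] show ?thesis by (simp add: algebra_simps)
  qed
  have N1: "wt_N * N' \<le> wt_N * ((1 - p * \<theta>) * N) - wt_N * (\<tau> / 4) * N + wt_N * (p + 2 * p\<^sup>2 / \<tau>) * GF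
      + wt_N * \<tau>\<^sup>2 * \<omega> / n * 2 * H + 2 * p * wt_N * \<tau>\<^sup>2 * \<omega> / n * G"
  proof -
    have "(1 - \<tau> / 2) * N \<le> (1 - p * \<theta> - \<tau> / 4) * N" using \<theta>(5) nn by (intro mult_right_mono) auto
    then have "N' \<le> (1 - p * \<theta> - \<tau> / 4) * N + (p + 2 * p\<^sup>2 / \<tau>) * GF + \<tau>\<^sup>2 * \<omega> / n * (2 * H + 2 * p * G)"
      using N' by linarith
    from mult_left_mono[OF this wt_nonneg(3)] show ?thesis by (simp add: algebra_simps)
  qed
  have K1: "wt_K * K' \<le> wt_K * ((1 - p * \<theta>) * K) - wt_K * (3 / 4 * p) * K + 2 * p * wt_K * N + 2 * p * wt_K * GF"
  proof -
    have "p * \<theta> \<le> p / 4" using \<theta>(2) pos by simp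
    then have "(1 - p) * K \<le> (1 - p * \<theta> - 3 / 4 * p) * K" using nn by (intro mult_right_mono) auto
    then have "K' \<le> (1 - p * \<theta> - 3 / 4 * p) * K + 2 * p * N + 2 * p * GF" using K' by linarith
    from mult_left_mono[OF this wt_nonneg(2)] show ?thesis by (simp add: algebra_simps)
  qed
  have W1: "wt_W * \<theta>'\<^sup>2 * W' \<le> wt_W * \<theta>\<^sup>2 * ((1 - p * \<theta>) * W) - wt_W * (\<alpha> / 4) * \<theta>\<^sup>2 * W
      + wt_W * (2 / \<alpha>) / Lb\<^sup>2 * Ky + wt_W / Lb\<^sup>2 * V"
  proof -
    \<comment> \<open>The monotonicity of the step sizes enters here: the new error carries the new,
      no larger, weight.\<close>
    have "\<theta>'\<^sup>2 * W' \<le> \<theta>\<^sup>2 * W'" using \<theta>' W'(1) by (intro mult_right_mono power_mono) auto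
    also have "\<dots> \<le> \<theta>\<^sup>2 * ((1 - \<alpha> / 2) * W + 2 / \<alpha> * b * Ky + b * V)"
      using W'(2) by (intro mult_left_mono) auto
    also have "\<dots> = (1 - \<alpha> / 2) * (\<theta>\<^sup>2 * W) + (\<theta>\<^sup>2 * b) * (2 / \<alpha> * Ky + V)"
      by (simp add: algebra_simps)
    also have "\<dots> \<le> (1 - p * \<theta> - \<alpha> / 4) * (\<theta>\<^sup>2 * W) + (1 / Lb\<^sup>2) * (2 / \<alpha> * Ky + V)"
      using \<theta>(3) nn pos b by (intro add_mono mult_right_mono) auto
    finally have "wt_W * (\<theta>'\<^sup>2 * W') \<le> wt_W * ((1 - p * \<theta> - \<alpha> / 4) * (\<theta>\<^sup>2 * W) + (1 / Lb\<^sup>2) * (2 / \<alpha> * Ky + V))"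
      by (rule mult_left_mono[OF _ wt_nonneg(1)])
    also have "\<dots> = wt_W * \<theta>\<^sup>2 * ((1 - p * \<theta>) * W) - wt_W * (\<alpha> / 4) * \<theta>\<^sup>2 * W
      + wt_W * (2 / \<alpha>) / Lb\<^sup>2 * Ky + wt_W / Lb\<^sup>2 * V"
      using pos by (simp add: field_simps)
    finally show ?thesis by (simp add: mult.assoc)
  qed
  \<comment> \<open>\<open>wt_N\<close> equals \<open>8 * p * wt_K / \<tau>\<close>, chosen to make
    this an equality.\<close>
  have cancel_N: "2 * p * wt_K * N = wt_N * (\<tau> / 4) * N"
    using pos by (simp add: wt_K_def wt_N_def)
  have Ky1: "wt_W * (2 / \<alpha>) / Lb\<^sup>2 * Ky \<le> wt_K * (3 / 4 * p) * K + 64 * (L\<^sup>2 / (\<alpha>\<^sup>2 * Lb\<^sup>2)) * D"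
  proof -
    have "wt_W * (2 / \<alpha>) / Lb\<^sup>2 * Ky \<le> wt_W * (2 / \<alpha>) / Lb\<^sup>2 * (2 * K + 4 * L * D)"
      using pos wt_nonneg(1) by (intro mult_left_mono[OF Ky]) auto
    also have "\<dots> = 32 * (L / (\<alpha>\<^sup>2 * Lb\<^sup>2)) * K + 64 * (L\<^sup>2 / (\<alpha>\<^sup>2 * Lb\<^sup>2)) * D"
      using pos by (simp add: wt_W_def field_simps power2_eq_square)
    \<comment> \<open>32 is needed; 36, three quarters of the 48 in \<open>wt_K\<close>, is
      available.\<close>
    also have "32 * (L / (\<alpha>\<^sup>2 * Lb\<^sup>2)) * K \<le> 36 * (L / (\<alpha>\<^sup>2 * Lb\<^sup>2)) * K"
      using pos nn by (intro mult_right_mono) auto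
    also have "\<dots> = wt_K * (3 / 4 * p) * K"
      using pos by (simp add: wt_K_def)
    finally show ?thesis by simp
  qed
  have V1: "V / Lb + wt_W / Lb\<^sup>2 * V + wt_N * \<tau>\<^sup>2 * \<omega> / n * 2 * H
      \<le> wt_H * (\<beta> / 4) * H + 8 * (Lmax * \<omega> / (n * Lb)) * D"
  proof -
    \<comment> \<open>The noise inside \<open>W'\<close> thus costs no more than the noise in the
      objective, and together they are charged as 2 V / Lb.\<close>
    have "wt_W / Lb\<^sup>2 \<le> 1 / Lb"
      using L_le_Lb(2) wt_nonneg(1) pos by (simp add: power2_eq_square field_simps)
    then have "wt_W / Lb\<^sup>2 * V \<le> 1 / Lb * V" using nn by (intro mult_right_mono)
    then have "V / Lb + wt_W / Lb\<^sup>2 * V \<le> 2 / Lb * V" by simp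
    also have "\<dots> \<le> 2 / Lb * (2 * \<omega> / n * (2 * Lmax * D + H))"
      using pos by (intro mult_left_mono[OF V]) auto
    also have "\<dots> = 8 * (Lmax * \<omega> / (n * Lb)) * D + 4 * \<omega> / (n * Lb) * H"
      using pos by (simp add: field_simps)
    finally have "V / Lb + wt_W / Lb\<^sup>2 * V \<le> \<dots>" .
    \<comment> \<open>\<open>wt_H\<close> has two summands because H is needed twice: the first pays
      for H in the bound of V, the second for H in the recursion of N.\<close>
    moreover have "4 * \<omega> / (n * Lb) * H + wt_N * \<tau>\<^sup>2 * \<omega> / n * 2 * H = wt_H * (\<beta> / 4) * H"
      using pos by (simp add: wt_H_def wt_N_def field_simps power2_eq_square)
    ultimately show ?thesis by linarith
  qed
  let ?X = "L * \<theta>\<^sup>2 * X"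
  have X0: "0 \<le> ?X" using pos nn by simp
  have G1: "cost_G * G \<le> 4 / 1000 * D + 2 / 1000 * ?X"
  proof -
    have "cost_G * G \<le> cost_G * (4 * Lmax * D + 2 * L * Lmax * \<theta>\<^sup>2 * X)"
      by (rule mult_left_mono[OF G wt_nonneg(5)])
    also have "\<dots> = (Lmax * cost_G) * (4 * D + 2 * ?X)" by (simp add: algebra_simps)
    also have "\<dots> \<le> 1 / 1000 * (4 * D + 2 * ?X)"
      using nn X0 by (intro mult_right_mono[OF cost_G_small]) auto
    finally show ?thesis by simp
  qed
  have GF1: "cost_GF * GF \<le> 4 / 1000 * D + 2 / 1000 * ?X"
  proof -
    have "cost_GF * GF \<le> cost_GF * (4 * L * D + 2 * L\<^sup>2 * \<theta>\<^sup>2 * X)"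
      by (rule mult_left_mono[OF GF wt_nonneg(6)])
    also have "\<dots> = (L * cost_GF) * (4 * D + 2 * ?X)" by (simp add: algebra_simps power2_eq_square)
    also have "\<dots> \<le> 1 / 1000 * (4 * D + 2 * ?X)"
      using nn X0 by (intro mult_right_mono[OF cost_GF_small]) auto
    finally show ?thesis by simp
  qed
  have cG: "wt_H * (p + 2 * p\<^sup>2 / \<beta>) * G + 2 * p * wt_N * \<tau>\<^sup>2 * \<omega> / n * G = cost_G * G"
    by (simp add: cost_G_def distrib_right)
  have cGF: "2 * p * wt_K * GF + wt_N * (p + 2 * p\<^sup>2 / \<tau>) * GF = cost_GF * GF"
    by (simp add: cost_GF_def distrib_right)
  \<comment> \<open>A full unit of L \<theta>^2 X is available. Half of it covers the smoothness
    defect, the other half the gradient changes.\<close>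
  have X1: "?X \<le> Lb * \<theta>\<^sup>2 / 2 * Y + wt_W * (\<alpha> / 4) * \<theta>\<^sup>2 * W"
  proof -
    have "?X \<le> L * \<theta>\<^sup>2 * (2 * Y + 2 * W)" using pos by (intro mult_left_mono[OF X]) auto
    also have "\<dots> = 4 * L * (\<theta>\<^sup>2 / 2 * Y) + wt_W * (\<alpha> / 4) * \<theta>\<^sup>2 * W"
      using pos by (simp add: wt_W_def algebra_simps)
    also have "4 * L * (\<theta>\<^sup>2 / 2 * Y) \<le> Lb * (\<theta>\<^sup>2 / 2 * Y)"
      using nn by (intro mult_right_mono[OF L_le_Lb(1)]) auto
    finally show ?thesis by simp
  qed
  have D1: "64 * (L\<^sup>2 / (\<alpha>\<^sup>2 * Lb\<^sup>2)) * D \<le> 1 / 100 * D" "8 * (Lmax * \<omega> / (n * Lb)) * D \<le> 1 / 100 * D"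
    using small_terms(1,6) nn by (auto intro!: mult_right_mono simp del: times_divide_eq_left)
  have "(3 / 4) * D \<le> (1 - \<theta>) * D" using nn \<theta>(2) by (intro mult_right_mono) auto
  moreover have "L * \<theta>\<^sup>2 / 2 * X = ?X / 2" by simp
  ultimately have "V / Lb + L * \<theta>\<^sup>2 / 2 * X + (wt_H * H' + wt_W * \<theta>'\<^sup>2 * W' + wt_K * K' + wt_N * N')
    \<le> (1 - \<theta>) * D + Lb * \<theta>\<^sup>2 / 2 * Y + (wt_H * ((1 - p * \<theta>) * H) + wt_W * \<theta>\<^sup>2 * ((1 - p * \<theta>) * W)
      + wt_K * ((1 - p * \<theta>) * K) + wt_N * ((1 - p * \<theta>) * N))"
    by (rule linear_budget[OF H1 N1 K1 W1 cancel_N Ky1 V1 G1 GF1 cG cGF X1 D1 X0 nn(1)])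
  then show ?thesis by (simp add: distrib_left mult.left_commute)
qed

end

section \<open>Independent sources of randomness\<close>

lemma abs_inner_le_sum_squares: "\<bar>inner x y\<bar> \<le> (norm x)\<^sup>2 + (norm y)\<^sup>2" for x y :: "'a::real_inner"
  using Cauchy_Schwarz_ineq2[of x y] sum_squares_bound[of "norm x" "norm y"]
    mult_nonneg_nonneg[OF norm_ge_zero[of x] norm_ge_zero[of y]]
  by linarith

text \<open>Independence is assumed for pi-systems indexed by seed names, from which independence of
  the sigma-algebras generated by disjoint sets of names follows. A set \<open>J\<close> of names
  stands for the information that these seeds carry.\<close>

locale indep_sources = prob_space M for M :: "'m measure" +
  fixes E :: "'j \<Rightarrow> 'm set set" and I :: "'j set"
  assumes indep_E: "indep_sets E I" and Int_stable_E: "\<And>j. j \<in> I \<Longrightarrow> Int_stable (E j)"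
begin

definition hist :: "'j set \<Rightarrow> 'm measure" where
  "hist J = sigma (space M) (\<Union>j\<in>J. E j)"

definition source :: "'j \<Rightarrow> ('m \<Rightarrow> 'r) \<Rightarrow> 'r measure \<Rightarrow> bool" where
  "source j X R \<longleftrightarrow> j \<in> I \<and> X \<in> measurable M R \<and> E j = gen_events M X R"

text \<open>Measurability in the seeds of \<open>J\<close> and a finite second moment are kept
  together: the first yields independence of fresh seeds, the second integrability of inner
  products.\<close>

definition L2 :: "'j set \<Rightarrow> ('m \<Rightarrow> 'b::euclidean_space) \<Rightarrow> bool" where
  "L2 J X \<longleftrightarrow> J \<subseteq> I \<and> X \<in> borel_measurable (hist J) \<and> integrable M (\<lambda>s. (norm (X s))\<^sup>2)"

lemma E_events: "j \<in> I \<Longrightarrow> E j \<subseteq> events"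
  using indep_E by (auto simp: indep_sets_def)

lemma E_Pow: "J \<subseteq> I \<Longrightarrow> (\<Union>j\<in>J. E j) \<subseteq> Pow (space M)"
  using E_events sets.sets_into_space by blast

lemma space_hist [simp]: "space (hist J) = space M"
  by (simp add: hist_def space_measure_of_conv)

lemma sets_hist: "J \<subseteq> I \<Longrightarrow> sets (hist J) = sigma_sets (space M) (\<Union>j\<in>J. E j)"
  unfolding hist_def by (rule sets_measure_of[OF E_Pow])

lemma sets_hist_mono: "J \<subseteq> K \<Longrightarrow> K \<subseteq> I \<Longrightarrow> sets (hist J) \<subseteq> sets (hist K)"
  by (subst (1 2) sets_hist) (auto intro!: sigma_sets_mono')

lemma sets_hist_events: "J \<subseteq> I \<Longrightarrow> sets (hist J) \<subseteq> events"
  by (subst sets_hist) (auto intro!: sets.sigma_sets_subset dest: E_events)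

lemma measurable_hist_mono:
  "X \<in> measurable (hist J) N \<Longrightarrow> J \<subseteq> K \<Longrightarrow> K \<subseteq> I \<Longrightarrow> X \<in> measurable (hist K) N"
  using sets_hist_mono[of J K] by (simp add: measurable_def) blast

lemma measurable_hist_M:
  "X \<in> measurable (hist J) N \<Longrightarrow> J \<subseteq> I \<Longrightarrow> X \<in> measurable M N"
  using sets_hist_events[of J] by (simp add: measurable_def) blast

lemma source_measurable:
  assumes "source j X R" "j \<in> J" "J \<subseteq> I"
  shows "X \<in> measurable (hist J) R"
proof (rule measurableI)
  fix A assume "A \<in> sets R"
  then have "X -` A \<inter> space M \<in> E j" using assms(1) by (auto simp: source_def gen_events_def)
  then show "X -` A \<inter> space (hist J) \<in> sets (hist J)"
    using assms by (auto simp: sets_hist)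
qed (use assms in \<open>auto simp: source_def measurable_space\<close>)

text \<open>The blocks \<open>{j}\<close> and \<open>J\<close> are disjoint, so the sigma-algebras
  they generate are independent, and the joint law agrees with the product measure on rectangles.
  This replaces conditioning on the past.\<close>

lemma fresh_distr:
  assumes X: "source j X R" and J: "j \<notin> J" "J \<subseteq> I" and Y: "Y \<in> measurable (hist J) N"
  shows "distr M (R \<Otimes>\<^sub>M N) (\<lambda>s. (X s, Y s)) = distr M R X \<Otimes>\<^sub>M distr M N Y"
proof -
  have jI: "j \<in> I" using X by (simp add: source_def)
  have "indep_sets (\<lambda>b. sigma_sets (space M) (\<Union>i\<in>(case_bool {j} J) b. E i)) UNIV"
  proof (rule indep_sets_collect_sigma)
    show "indep_sets E (\<Union>b\<in>UNIV. case_bool {j} J b)"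
      by (rule indep_sets_mono_index[OF _ indep_E]) (use jI J in \<open>simp add: UNIV_bool\<close>)
    show "Int_stable (E i)" if "i \<in> case_bool {j} J b" for i b
      using that jI J by (cases b) (auto intro: Int_stable_E)
    show "disjoint_family_on (case_bool {j} J) UNIV"
      using J by (simp add: disjoint_family_on_def UNIV_bool)
  qed
  then have "indep_set (sigma_sets (space M) {X -` A \<inter> space M |A. A \<in> sets R})
     (sigma_sets (space M) {Y -` A \<inter> space M |A. A \<in> sets N})"
    unfolding indep_set_def
  proof (rule indep_sets_mono_sets)
    have "{Y -` A \<inter> space M |A. A \<in> sets N} \<subseteq> sigma_sets (space M) (\<Union>i\<in>J. E i)"
      using measurable_sets[OF Y] by (auto simp: sets_hist[OF J(2), symmetric])
    then have "sigma_sets (space M) {Y -` A \<inter> space M |A. A \<in> sets N}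
        \<subseteq> sigma_sets (space M) (\<Union>i\<in>J. E i)"
      by (rule sigma_sets_mono)
    moreover have "{X -` A \<inter> space M |A. A \<in> sets R} = E j"
      using X by (simp add: source_def gen_events_def)
    ultimately show "(case b of True \<Rightarrow> sigma_sets (space M) {X -` A \<inter> space M |A. A \<in> sets R}
        | False \<Rightarrow> sigma_sets (space M) {Y -` A \<inter> space M |A. A \<in> sets N})
       \<subseteq> sigma_sets (space M) (\<Union>i\<in>(case_bool {j} J) b. E i)" for b
      by (cases b) auto
  qed
  then have ind: "prob ((X -` A \<inter> space M) \<inter> (Y -` B \<inter> space M))
      = prob (X -` A \<inter> space M) * prob (Y -` B \<inter> space M)" if "A \<in> sets R" "B \<in> sets N" for A B
    using that by (blast intro: indep_setD)
  have XM [measurable]: "X \<in> measurable M R" using X by (simp add: source_def)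
  have YM [measurable]: "Y \<in> measurable M N" by (rule measurable_hist_M[OF Y J(2)])
  interpret R: prob_space "distr M R X" by (rule prob_space_distr[OF XM])
  interpret N: prob_space "distr M N Y" by (rule prob_space_distr[OF YM])
  show ?thesis
  proof (rule pair_measure_eqI[symmetric])
    show "sets (distr M R X \<Otimes>\<^sub>M distr M N Y) = sets (distr M (R \<Otimes>\<^sub>M N) (\<lambda>s. (X s, Y s)))"
      by (simp cong: sets_pair_measure_cong)
    fix A B assume "A \<in> sets (distr M R X)" "B \<in> sets (distr M N Y)"
    then have AB [measurable]: "A \<in> sets R" "B \<in> sets N" by auto
    have "(\<lambda>s. (X s, Y s)) -` (A \<times> B) \<inter> space M = (X -` A \<inter> space M) \<inter> (Y -` B \<inter> space M)"
      by auto
    then show "emeasure (distr M R X) A * emeasure (distr M N Y) B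
        = emeasure (distr M (R \<Otimes>\<^sub>M N) (\<lambda>s. (X s, Y s))) (A \<times> B)"
      using ind[OF AB] by (simp add: emeasure_distr emeasure_eq_measure ennreal_mult)
  qed (unfold_locales)
qed

text \<open>The version for nonnegative integrands is what proves second moments finite; the centred
  version below already presupposes integrability.\<close>

lemma fresh_nn_integral:
  assumes X: "source j X R" and J: "j \<notin> J" "J \<subseteq> I" and Y: "Y \<in> measurable (hist J) N"
    and \<phi>: "\<phi> \<in> borel_measurable (R \<Otimes>\<^sub>M N)"
  shows "(\<integral>\<^sup>+ s. \<phi> (X s, Y s) \<partial>M) = (\<integral>\<^sup>+ s. (\<integral>\<^sup>+ r. \<phi> (r, Y s) \<partial>distr M R X) \<partial>M)"
proof -
  have XM: "X \<in> measurable M R" using X by (simp add: source_def)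
  have YM: "Y \<in> measurable M N" by (rule measurable_hist_M[OF Y J(2)])
  interpret R: prob_space "distr M R X" by (rule prob_space_distr[OF XM])
  interpret N: prob_space "distr M N Y" by (rule prob_space_distr[OF YM])
  interpret P: pair_sigma_finite "distr M R X" "distr M N Y" ..
  have \<phi>': "\<phi> \<in> borel_measurable (distr M R X \<Otimes>\<^sub>M distr M N Y)"
    using \<phi> by (subst measurable_cong_sets[OF sets_pair_measure_cong refl]) (rule sets_distr)+
  have "(\<integral>\<^sup>+ s. \<phi> (X s, Y s) \<partial>M) = (\<integral>\<^sup>+ q. \<phi> q \<partial>distr M (R \<Otimes>\<^sub>M N) (\<lambda>s. (X s, Y s)))"
    using XM YM \<phi> by (subst nn_integral_distr) auto
  also have "\<dots> = (\<integral>\<^sup>+ y. (\<integral>\<^sup>+ r. \<phi> (r, y) \<partial>distr M R X) \<partial>distr M N Y)"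
    unfolding fresh_distr[OF X J Y] using P.nn_integral_snd[OF \<phi>'] by simp
  also have "\<dots> = (\<integral>\<^sup>+ s. (\<integral>\<^sup>+ r. \<phi> (r, Y s) \<partial>distr M R X) \<partial>M)"
  proof (rule nn_integral_distr[OF YM])
    show "(\<lambda>y. \<integral>\<^sup>+ r. \<phi> (r, y) \<partial>distr M R X) \<in> borel_measurable (distr M N Y)"
      using \<phi>' by measurable
  qed
  finally show ?thesis .
qed

lemma fresh_centred_expectation:
  fixes \<phi> :: "'r \<times> 'b \<Rightarrow> real"
  assumes X: "source j X R" and J: "j \<notin> J" "J \<subseteq> I" and Y: "Y \<in> measurable (hist J) N"
    and \<phi>: "\<phi> \<in> borel_measurable (R \<Otimes>\<^sub>M N)" and int: "integrable M (\<lambda>s. \<phi> (X s, Y s))"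
    and centred: "\<And>y. (\<integral>r. \<phi> (r, y) \<partial>distr M R X) = 0"
  shows "expectation (\<lambda>s. \<phi> (X s, Y s)) = 0"
proof -
  have XM: "X \<in> measurable M R" using X by (simp add: source_def)
  have YM: "Y \<in> measurable M N" by (rule measurable_hist_M[OF Y J(2)])
  interpret R: prob_space "distr M R X" by (rule prob_space_distr[OF XM])
  interpret N: prob_space "distr M N Y" by (rule prob_space_distr[OF YM])
  interpret P: pair_sigma_finite "distr M R X" "distr M N Y" ..
  have XY: "(\<lambda>s. (X s, Y s)) \<in> measurable M (R \<Otimes>\<^sub>M N)" using XM YM by simp
  have int': "integrable (distr M R X \<Otimes>\<^sub>M distr M N Y) \<phi>"
    unfolding fresh_distr[OF X J Y, symmetric] by (subst integrable_distr_eq[OF XY \<phi>]) (rule int)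
  have "expectation (\<lambda>s. \<phi> (X s, Y s)) = (\<integral>q. \<phi> q \<partial>distr M (R \<Otimes>\<^sub>M N) (\<lambda>s. (X s, Y s)))"
    by (subst integral_distr[OF XY \<phi>]) simp
  also have "\<dots> = (\<integral>y. (\<integral>r. \<phi> (r, y) \<partial>distr M R X) \<partial>distr M N Y)"
    unfolding fresh_distr[OF X J Y] using P.integral_snd[of "curry \<phi>"] int' by simp
  finally show ?thesis by (simp add: centred)
qed

section \<open>Square-integrable random vectors and their mean squares\<close>

lemma L2_J: "L2 J X \<Longrightarrow> J \<subseteq> I"
  and L2_hist: "L2 J X \<Longrightarrow> X \<in> borel_measurable (hist J)"
  and L2_integrable: "L2 J X \<Longrightarrow> integrable M (\<lambda>s. (norm (X s))\<^sup>2)"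
  by (simp_all add: L2_def)

lemma L2_measurable: "L2 J X \<Longrightarrow> X \<in> borel_measurable M"
  by (rule measurable_hist_M[OF L2_hist L2_J])

lemma L2_mono:
  assumes "L2 J X" "J \<subseteq> K" "K \<subseteq> I"
  shows "L2 K X"
  unfolding L2_def
  by (intro conjI assms(3) L2_integrable[OF assms(1)] measurable_hist_mono[OF L2_hist[OF assms(1)] assms(2,3)])

lemma L2_const: "J \<subseteq> I \<Longrightarrow> L2 J (\<lambda>_. a)"
  by (simp add: L2_def)

lemma L2_add:
  assumes "L2 J X" "L2 J Y"
  shows "L2 J (\<lambda>s. X s + Y s)"
proof -
  note [measurable] = assms[THEN L2_measurable]
  have "integrable M (\<lambda>s. (norm (X s + Y s))\<^sup>2)"
    by (rule Bochner_Integration.integrable_bound[where f = "\<lambda>s. 2 * (norm (X s))\<^sup>2 + 2 * (norm (Y s))\<^sup>2"])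
      (use assms in \<open>auto simp: L2_def intro!: norm_add_sq_le_double\<close>)
  then show ?thesis using L2_J[OF assms(1)] L2_hist[OF assms(1)] L2_hist[OF assms(2)] by (simp add: L2_def borel_measurable_add)
qed

lemma L2_scaleR: "L2 J X \<Longrightarrow> L2 J (\<lambda>s. a *\<^sub>R X s)"
  by (simp add: L2_def power_mult_distrib borel_measurable_scaleR)

lemma L2_uminus: "L2 J X \<Longrightarrow> L2 J (\<lambda>s. - X s)"
  using L2_scaleR[of J X "-1"] by simp

lemma L2_diff: "L2 J X \<Longrightarrow> L2 J Y \<Longrightarrow> L2 J (\<lambda>s. X s - Y s)"
  using L2_add[OF _ L2_uminus, of J X Y] by simp

text \<open>The Lipschitz bound gives continuity, hence measurability, and together with the value
  at 0 linear growth, hence a second moment.\<close>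

lemma L2_lipschitz:
  fixes g :: "'b::euclidean_space \<Rightarrow> 'c::euclidean_space"
  assumes X: "L2 J X" and lip: "\<And>x y. norm (g x - g y) \<le> L * norm (x - y)"
  shows "L2 J (\<lambda>s. g (X s))"
proof -
  note [measurable] = L2_measurable[OF X]
  have "continuous_on UNIV g"
  proof (rule lipschitz_on_continuous_on, rule lipschitz_onI)
    show "dist (g x) (g y) \<le> \<bar>L\<bar> * dist x y" for x y
      unfolding dist_norm by (rule order_trans[OF lip]) (simp add: mult_right_mono)
  qed simp
  then have [measurable]: "g \<in> borel_measurable borel" by (rule borel_measurable_continuous_onI)
  have "integrable M (\<lambda>s. (norm (g (X s)))\<^sup>2)"
  proof (rule Bochner_Integration.integrable_bound)
    show "integrable M (\<lambda>s. 2 * (L\<^sup>2 * (norm (X s))\<^sup>2) + 2 * (norm (g 0))\<^sup>2)"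
      using X by (auto simp: L2_def)
    have "(norm (g x))\<^sup>2 \<le> 2 * (L\<^sup>2 * (norm x)\<^sup>2) + 2 * (norm (g 0))\<^sup>2" for x
    proof -
      have "(norm (g x - g 0))\<^sup>2 \<le> (L * norm (x - 0))\<^sup>2"
        by (rule power_mono[OF lip]) simp
      then show ?thesis
        using norm_add_sq_le_double[of "g x - g 0" "g 0"] by (simp add: power_mult_distrib)
    qed
    then show "AE s in M. norm ((norm (g (X s)))\<^sup>2) \<le> norm (2 * (L\<^sup>2 * (norm (X s))\<^sup>2) + 2 * (norm (g 0))\<^sup>2)"
      by (intro AE_I2) (smt (verit) real_norm_def zero_le_power2)
  qed measurable
  moreover have "(\<lambda>s. g (X s)) \<in> borel_measurable (hist J)"
    by (rule measurable_compose[OF L2_hist[OF X]]) measurable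
  ultimately show ?thesis using X by (simp add: L2_def)
qed

lemma integrable_inner:
  fixes X Y :: "'m \<Rightarrow> 'b::euclidean_space"
  assumes X: "L2 J X" and Y: "L2 K Y"
  shows "integrable M (\<lambda>s. inner (X s) (Y s))"
proof (rule Bochner_Integration.integrable_bound)
  show "integrable M (\<lambda>s. (norm (X s))\<^sup>2 + (norm (Y s))\<^sup>2)"
    by (rule Bochner_Integration.integrable_add[OF L2_integrable[OF X] L2_integrable[OF Y]])
  show "(\<lambda>s. inner (X s) (Y s)) \<in> borel_measurable M"
    by (rule borel_measurable_inner[OF L2_measurable[OF X] L2_measurable[OF Y]])
  show "AE s in M. norm (inner (X s) (Y s)) \<le> norm ((norm (X s))\<^sup>2 + (norm (Y s))\<^sup>2)"
    by (simp add: abs_inner_le_sum_squares)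
qed

lemma expectation_norm_add_sq:
  fixes X Y :: "'m \<Rightarrow> 'b::euclidean_space"
  assumes "L2 J X" "L2 K Y"
  shows "expectation (\<lambda>s. (norm (X s + Y s))\<^sup>2)
    = expectation (\<lambda>s. (norm (X s))\<^sup>2) + 2 * expectation (\<lambda>s. inner (X s) (Y s))
      + expectation (\<lambda>s. (norm (Y s))\<^sup>2)"
proof -
  have "(norm (x + y))\<^sup>2 = (norm x)\<^sup>2 + 2 * inner x y + (norm y)\<^sup>2" for x y :: 'b
    by (simp add: power2_norm_eq_inner inner_add_left inner_add_right inner_commute)
  then have "expectation (\<lambda>s. (norm (X s + Y s))\<^sup>2)
      = expectation (\<lambda>s. (norm (X s))\<^sup>2 + 2 * inner (X s) (Y s) + (norm (Y s))\<^sup>2)"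
    by simp
  then show ?thesis
    using L2_integrable[OF assms(1)] L2_integrable[OF assms(2)] integrable_inner[OF assms] by simp
qed

abbreviation msq :: "('m \<Rightarrow> 'b::real_normed_vector) \<Rightarrow> real" where
  "msq X \<equiv> expectation (\<lambda>s. (norm (X s))\<^sup>2)"

lemma msq_nonneg: "0 \<le> msq X" by simp

lemma msq_scaleR: "msq (\<lambda>s. a *\<^sub>R X s) = a\<^sup>2 * msq X"
  by (simp add: power_mult_distrib)

lemma msq_add_le:
  assumes "L2 J X" "L2 J Y" "a > 0"
  shows "msq (\<lambda>s. X s + Y s) \<le> (1 + a) * msq X + (1 + 1 / a) * msq Y"
proof -
  have "msq (\<lambda>s. X s + Y s) \<le> expectation (\<lambda>s. (1 + a) * (norm (X s))\<^sup>2 + (1 + 1 / a) * (norm (Y s))\<^sup>2)"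
    using L2_integrable[OF assms(1)] L2_integrable[OF assms(2)] L2_integrable[OF L2_add[OF assms(1,2)]]
    by (intro integral_mono norm_add_sq_le[OF assms(3)]) auto
  also have "\<dots> = (1 + a) * msq X + (1 + 1 / a) * msq Y"
    using L2_integrable[OF assms(1)] L2_integrable[OF assms(2)] by simp
  finally show ?thesis .
qed

lemma msq_add_le_double: "L2 J X \<Longrightarrow> L2 J Y \<Longrightarrow> msq (\<lambda>s. X s + Y s) \<le> 2 * msq X + 2 * msq Y"
  using msq_add_le[of J X Y 1] by simp

lemma msq_add_orthogonal:
  assumes "L2 J X" "L2 J Y" "expectation (\<lambda>s. inner (X s) (Y s)) = 0"
  shows "msq (\<lambda>s. X s + Y s) = msq X + msq Y"
  using expectation_norm_add_sq[OF assms(1,2)] assms(3) by simp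

lemma msq_triangle:
  assumes "L2 J X" "L2 J Y" "L2 J Z"
  shows "msq (\<lambda>s. X s - Z s) \<le> 2 * msq (\<lambda>s. X s - Y s) + 2 * msq (\<lambda>s. Y s - Z s)"
  using msq_add_le_double[OF L2_diff[OF assms(1,2)] L2_diff[OF assms(2,3)]] by simp

lemma msq_triangle':
  assumes "L2 J X" "L2 J Y" "L2 J Z"
  shows "msq (\<lambda>s. X s - Z s) \<le> 2 * msq (\<lambda>s. X s - Y s) + 2 * msq (\<lambda>s. Z s - Y s)"
  using msq_triangle[OF assms] by (simp add: norm_minus_commute)

lemma msq_triangle_sym:
  assumes "L2 J X" "L2 J Y" "L2 J Z"
  shows "msq (\<lambda>s. X s - Z s) \<le> 2 * msq (\<lambda>s. Y s - X s) + 2 * msq (\<lambda>s. Y s - Z s)"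
  using msq_triangle[OF assms] by (simp add: norm_minus_commute)

section \<open>Errors of compressors with fresh seeds\<close>

text \<open>With \<open>Y\<close> frozen, the seed is integrated first. Only the second-moment bound
  enters, so the lemma serves both the unbiased worker compressors and the contractive server
  compressor.\<close>

lemma compressor_L2:
  fixes C :: "'r \<Rightarrow> 'b::euclidean_space \<Rightarrow> 'b"
  assumes X: "source j X R" "distr M R X = R" and J: "j \<notin> J" and Y: "L2 J Y"
    and C: "(\<lambda>(r, x). C r x) \<in> borel_measurable (R \<Otimes>\<^sub>M borel)" and \<delta>: "\<delta> \<ge> 0"
    and bound: "\<And>x. (\<integral>\<^sup>+ r. ennreal ((norm (C r x - x))\<^sup>2) \<partial>R) \<le> ennreal (\<delta> * (norm x)\<^sup>2)"
  shows "L2 (insert j J) (\<lambda>s. C (X s) (Y s) - Y s)" (is ?L)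
    and "expectation (\<lambda>s. (norm (C (X s) (Y s) - Y s))\<^sup>2) \<le> \<delta> * expectation (\<lambda>s. (norm (Y s))\<^sup>2)" (is ?B)
proof -
  have jI: "j \<in> I" and JI: "J \<subseteq> I" using X Y by (auto simp: source_def L2_J)
  have "X \<in> measurable (hist (insert j J)) R"
    using X jI JI by (intro source_measurable) auto
  moreover have Y': "Y \<in> borel_measurable (hist (insert j J))"
    using L2_hist[OF Y] jI JI by (rule_tac measurable_hist_mono) auto
  ultimately have "(\<lambda>s. (X s, Y s)) \<in> measurable (hist (insert j J)) (R \<Otimes>\<^sub>M borel)"
    by (rule measurable_Pair)
  from measurable_compose[OF this C]
  have "(\<lambda>s. C (X s) (Y s)) \<in> borel_measurable (hist (insert j J))" by simp
  then have mh: "(\<lambda>s. C (X s) (Y s) - Y s) \<in> borel_measurable (hist (insert j J))"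
    using Y' by (rule borel_measurable_diff)
  then have mM [measurable]: "(\<lambda>s. C (X s) (Y s) - Y s) \<in> borel_measurable M"
    using jI JI by (intro measurable_hist_M[OF mh]) auto
  define \<phi> where "\<phi> = (\<lambda>q. ennreal ((norm ((\<lambda>(r, x). C r x) q - snd q))\<^sup>2))"
  have "\<phi> \<in> borel_measurable (R \<Otimes>\<^sub>M borel)" unfolding \<phi>_def using C by measurable
  from fresh_nn_integral[OF X(1) J JI L2_hist[OF Y] this]
  have "(\<integral>\<^sup>+ s. ennreal ((norm (C (X s) (Y s) - Y s))\<^sup>2) \<partial>M)
      = (\<integral>\<^sup>+ s. (\<integral>\<^sup>+ r. ennreal ((norm (C r (Y s) - Y s))\<^sup>2) \<partial>R) \<partial>M)"
    by (simp add: \<phi>_def X(2))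
  also have "\<dots> \<le> (\<integral>\<^sup>+ s. ennreal (\<delta> * (norm (Y s))\<^sup>2) \<partial>M)"
    by (intro nn_integral_mono bound)
  also have "\<dots> = ennreal (\<delta> * expectation (\<lambda>s. (norm (Y s))\<^sup>2))"
    using Y \<delta> by (subst nn_integral_eq_integral) (auto simp: L2_def)
  finally have le: "(\<integral>\<^sup>+ s. ennreal ((norm (C (X s) (Y s) - Y s))\<^sup>2) \<partial>M)
      \<le> ennreal (\<delta> * expectation (\<lambda>s. (norm (Y s))\<^sup>2))" .
  have int: "integrable M (\<lambda>s. (norm (C (X s) (Y s) - Y s))\<^sup>2)"
  proof (rule integrableI_nonneg)
    show "(\<integral>\<^sup>+ s. ennreal ((norm (C (X s) (Y s) - Y s))\<^sup>2) \<partial>M) < \<infinity>"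
      using le by (rule le_less_trans) simp
  qed auto
  show ?L using mh int jI JI by (simp add: L2_def)
  show ?B using le \<delta> by (subst (asm) nn_integral_eq_integral[OF int]) (auto simp: ennreal_le_iff)
qed

text \<open>For frozen values of \<open>Y\<close> and \<open>Z\<close> the inner product is centred
  in the seed by unbiasedness. \<open>Z\<close> may be anything known before the seed is drawn, in
  particular \<open>Y\<close> itself.\<close>

lemma compressor_orthogonal:
  fixes C :: "'r \<Rightarrow> 'b::euclidean_space \<Rightarrow> 'b"
  assumes X: "source j X R" "distr M R X = R" and J: "j \<notin> J" and Y: "L2 J Y" and Z: "L2 J Z"
    and C: "unbiased_comp R C \<delta>" and \<delta>: "\<delta> \<ge> 0"
  shows "expectation (\<lambda>s. inner (C (X s) (Y s) - Y s) (Z s)) = 0"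
proof -
  define \<phi> where "\<phi> = (\<lambda>q. inner ((\<lambda>(r, x). C r x) (fst q, fst (snd q)) - fst (snd q)) (snd (snd q)))"
  have Cm: "(\<lambda>(r, x). C r x) \<in> borel_measurable (R \<Otimes>\<^sub>M borel)"
    using C by (simp add: unbiased_comp_def)
  have JI: "J \<subseteq> I" using Y by (rule L2_J)
  have "expectation (\<lambda>s. \<phi> (X s, (Y s, Z s))) = 0"
  proof (rule fresh_centred_expectation[OF X(1) J JI])
    show "(\<lambda>s. (Y s, Z s)) \<in> measurable (hist J) (borel \<Otimes>\<^sub>M borel)"
      using L2_hist[OF Y] L2_hist[OF Z] by (rule measurable_Pair)
    have "(\<lambda>q. (\<lambda>(r, x). C r x) (fst q, fst (snd q))) \<in> borel_measurable (R \<Otimes>\<^sub>M (borel \<Otimes>\<^sub>M (borel :: 'b measure)))"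
      by (rule measurable_compose[OF _ Cm]) measurable
    moreover have "(\<lambda>q. fst (snd q)) \<in> borel_measurable (R \<Otimes>\<^sub>M (borel \<Otimes>\<^sub>M (borel :: 'b measure)))"
      "(\<lambda>q. snd (snd q)) \<in> borel_measurable (R \<Otimes>\<^sub>M ((borel :: 'b measure) \<Otimes>\<^sub>M borel))"
      by measurable
    ultimately show "\<phi> \<in> borel_measurable (R \<Otimes>\<^sub>M (borel \<Otimes>\<^sub>M borel))"
      unfolding \<phi>_def by (rule borel_measurable_inner[OF borel_measurable_diff])
    have "L2 (insert j J) (\<lambda>s. C (X s) (Y s) - Y s)"
      by (rule compressor_L2(1)[OF X J Y Cm \<delta>]) (use C in \<open>simp add: unbiased_comp_def\<close>)
    from integrable_inner[OF this Z] show "integrable M (\<lambda>s. \<phi> (X s, (Y s, Z s)))"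
      by (simp add: \<phi>_def)
    fix q :: "'b \<times> 'b"
    interpret R: prob_space R using C by (simp add: unbiased_comp_def)
    have "integrable R (\<lambda>r. C r (fst q))" "(\<integral>r. C r (fst q) \<partial>R) = fst q"
      using C by (auto simp: unbiased_comp_def)
    then show "(\<integral>r. \<phi> (r, q) \<partial>distr M R X) = 0"
      by (simp add: \<phi>_def X(2) R.prob_space)
  qed
  then show ?thesis by (simp add: \<phi>_def)
qed

context
  fixes n :: nat and j :: "nat \<Rightarrow> 'j" and X :: "nat \<Rightarrow> 'm \<Rightarrow> 'r" and R :: "nat \<Rightarrow> 'r measure"
    and C :: "nat \<Rightarrow> 'r \<Rightarrow> 'b::euclidean_space \<Rightarrow> 'b" and Y :: "nat \<Rightarrow> 'm \<Rightarrow> 'b" and J :: "'j set" and \<delta> :: real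
  assumes X: "\<And>i. i < n \<Longrightarrow> source (j i) (X i) (R i)" "\<And>i. i < n \<Longrightarrow> distr M (R i) (X i) = R i"
    and j: "inj_on j {..<n}" "\<And>i. i < n \<Longrightarrow> j i \<notin> J" and J: "J \<subseteq> I"
    and Y: "\<And>i. i < n \<Longrightarrow> L2 J (Y i)"
    and C: "\<And>i. i < n \<Longrightarrow> unbiased_comp (R i) (C i) \<delta>" and \<delta>: "\<delta> \<ge> 0"
begin

lemma compressor_error_L2:
  assumes "i < n"
  shows "L2 (insert (j i) J) (\<lambda>s. C i (X i s) (Y i s) - Y i s)"
    and "expectation (\<lambda>s. (norm (C i (X i s) (Y i s) - Y i s))\<^sup>2) \<le> \<delta> * expectation (\<lambda>s. (norm (Y i s))\<^sup>2)"
proof -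
  have "(\<lambda>(r, x). C i r x) \<in> borel_measurable (R i \<Otimes>\<^sub>M borel)"
    "\<And>x. (\<integral>\<^sup>+ r. ennreal ((norm (C i r x - x))\<^sup>2) \<partial>R i) \<le> ennreal (\<delta> * (norm x)\<^sup>2)"
    using C[OF assms] unfolding unbiased_comp_def by blast+
  note * = compressor_L2[OF X(1)[OF assms] X(2)[OF assms] j(2)[OF assms] Y[OF assms] this(1) \<delta> this(2)]
  show "L2 (insert (j i) J) (\<lambda>s. C i (X i s) (Y i s) - Y i s)"
    and "expectation (\<lambda>s. (norm (C i (X i s) (Y i s) - Y i s))\<^sup>2) \<le> \<delta> * expectation (\<lambda>s. (norm (Y i s))\<^sup>2)"
    by (rule *)+
qed

text \<open>In the induction the seed of summand \<open>m\<close> is fresh for the history of the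
  earlier ones, so the new error is orthogonal to their sum and the second moments add without cross
  terms. This is the origin of the factor 1/n in the variance of the average.\<close>

lemma compressor_sum_error:
  assumes "m \<le> n"
  shows "L2 (J \<union> j ` {..<m}) (\<lambda>s. \<Sum>i<m. C i (X i s) (Y i s) - Y i s)
    \<and> expectation (\<lambda>s. (norm (\<Sum>i<m. C i (X i s) (Y i s) - Y i s))\<^sup>2)
      \<le> \<delta> * (\<Sum>i<m. expectation (\<lambda>s. (norm (Y i s))\<^sup>2))"
  using assms
proof (induction m)
  case 0
  then show ?case using J by (simp add: L2_const)
next
  case (Suc m)
  then have m: "m < n" and IH: "L2 (J \<union> j ` {..<m}) (\<lambda>s. \<Sum>i<m. C i (X i s) (Y i s) - Y i s)"
    "expectation (\<lambda>s. (norm (\<Sum>i<m. C i (X i s) (Y i s) - Y i s))\<^sup>2)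
      \<le> \<delta> * (\<Sum>i<m. expectation (\<lambda>s. (norm (Y i s))\<^sup>2))" by auto
  have jI: "j i \<in> I" if "i < n" for i using X(1)[OF that] by (simp add: source_def)
  have sub: "J \<union> j ` {..<Suc m} \<subseteq> I" using J jI m by auto
  have "insert (j m) J \<subseteq> J \<union> j ` {..<Suc m}" by auto
  note e = L2_mono[OF compressor_error_L2(1)[OF m] this sub]
  have S: "L2 (J \<union> j ` {..<Suc m}) (\<lambda>s. \<Sum>i<m. C i (X i s) (Y i s) - Y i s)"
    by (rule L2_mono[OF IH(1) _ sub]) auto
  have "j m \<notin> J \<union> j ` {..<m}" using j m by (auto dest: inj_onD)
  moreover have "L2 (J \<union> j ` {..<m}) (Y m)"
    using Y[OF m] by (rule L2_mono) (use sub in auto)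
  ultimately have "expectation (\<lambda>s. inner (C m (X m s) (Y m s) - Y m s) (\<Sum>i<m. C i (X i s) (Y i s) - Y i s)) = 0"
    by (intro compressor_orthogonal[OF X(1)[OF m] X(2)[OF m] _ _ IH(1) C[OF m] \<delta>])
  then have "expectation (\<lambda>s. inner (\<Sum>i<m. C i (X i s) (Y i s) - Y i s) (C m (X m s) (Y m s) - Y m s)) = 0"
    by (simp add: inner_commute)
  then have "expectation (\<lambda>s. (norm (\<Sum>i<Suc m. C i (X i s) (Y i s) - Y i s))\<^sup>2)
      \<le> \<delta> * (\<Sum>i<Suc m. expectation (\<lambda>s. (norm (Y i s))\<^sup>2))"
    using expectation_norm_add_sq[OF S e] IH(2) compressor_error_L2(2)[OF m] by (simp add: distrib_left)
  then show ?case using L2_add[OF S e] by simp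
qed

lemma compressor_average:
  shows compressor_average_L2:
      "L2 (J \<union> j ` {..<n}) (\<lambda>s. (1 / real n) *\<^sub>R (\<Sum>i<n. C i (X i s) (Y i s) - Y i s))"
    and compressor_average_variance:
      "expectation (\<lambda>s. (norm ((1 / real n) *\<^sub>R (\<Sum>i<n. C i (X i s) (Y i s) - Y i s)))\<^sup>2)
        \<le> \<delta> / real n * ((1 / real n) * (\<Sum>i<n. expectation (\<lambda>s. (norm (Y i s))\<^sup>2)))"
proof -
  note * = compressor_sum_error[OF order_refl]
  show "L2 (J \<union> j ` {..<n}) (\<lambda>s. (1 / real n) *\<^sub>R (\<Sum>i<n. C i (X i s) (Y i s) - Y i s))"
    by (rule L2_scaleR[OF *[THEN conjunct1]])
  have "(1 / real n)\<^sup>2 * expectation (\<lambda>s. (norm (\<Sum>i<n. C i (X i s) (Y i s) - Y i s))\<^sup>2)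
      \<le> (1 / real n)\<^sup>2 * (\<delta> * (\<Sum>i<n. expectation (\<lambda>s. (norm (Y i s))\<^sup>2)))"
    by (rule mult_left_mono[OF *[THEN conjunct2]]) simp
  then show "expectation (\<lambda>s. (norm ((1 / real n) *\<^sub>R (\<Sum>i<n. C i (X i s) (Y i s) - Y i s)))\<^sup>2)
        \<le> \<delta> / real n * ((1 / real n) * (\<Sum>i<n. expectation (\<lambda>s. (norm (Y i s))\<^sup>2)))"
    by (simp add: power_divide power2_eq_square[of "real n"])
qed

lemma compressor_average_orthogonal:
  assumes Z: "L2 J Z"
  shows "expectation (\<lambda>s. inner ((1 / real n) *\<^sub>R (\<Sum>i<n. C i (X i s) (Y i s) - Y i s)) (Z s)) = 0"
proof -
  have "expectation (\<lambda>s. inner (C i (X i s) (Y i s) - Y i s) (Z s)) = 0" if "i < n" for i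
    by (rule compressor_orthogonal[OF X(1)[OF that] X(2)[OF that] j(2)[OF that] Y[OF that] Z C[OF that] \<delta>])
  moreover have "integrable M (\<lambda>s. inner (C i (X i s) (Y i s) - Y i s) (Z s))" if "i < n" for i
    by (rule integrable_inner[OF compressor_error_L2(1)[OF that] Z])
  ultimately have "expectation (\<lambda>s. \<Sum>i<n. inner (C i (X i s) (Y i s) - Y i s) (Z s)) = 0"
    by (subst Bochner_Integration.integral_sum) auto
  then show ?thesis by (simp add: inner_sum_left)
qed

end

section \<open>The coin\<close>

text \<open>The product of \<open>of_bool (c s) - p\<close> and \<open>a s - b s\<close> is exactly
  the difference between the selected value and its average over the coin, and it is centred in the
  coin for every frozen value of \<open>a s - b s\<close>.\<close>

lemma coin_expectation:
  fixes c :: "'m \<Rightarrow> bool"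
  assumes c: "source j c (count_space UNIV)" "prob {s\<in>space M. c s} = p"
    and J: "j \<notin> J" "J \<subseteq> I"
    and a: "a \<in> borel_measurable (hist J)" "integrable M a"
    and b: "b \<in> borel_measurable (hist J)" "integrable M b"
  shows "integrable M (\<lambda>s. if c s then a s else b s)"
    and "expectation (\<lambda>s. if c s then a s else b s) = p * expectation a + (1 - p) * expectation b"
proof -
  have cM [measurable]: "c \<in> measurable M (count_space UNIV)" using c(1) by (simp add: source_def)
  have [measurable]: "a \<in> borel_measurable M" "b \<in> borel_measurable M" using a b by auto
  show int: "integrable M (\<lambda>s. if c s then a s else b s)"
    by (rule Bochner_Integration.integrable_bound[where f = "\<lambda>s. \<bar>a s\<bar> + \<bar>b s\<bar>"]) (use a b in auto)
  define \<phi> :: "bool \<times> real \<Rightarrow> real" where "\<phi> = (\<lambda>q. (of_bool (fst q) - p) * snd q)"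
  have ab: "(\<lambda>s. a s - b s) \<in> borel_measurable (hist J)" using a b by auto
  have eq: "\<phi> (c s, a s - b s) = (if c s then a s else b s) - p * a s - (1 - p) * b s" for s
    by (auto simp: \<phi>_def algebra_simps)
  have "expectation (\<lambda>s. \<phi> (c s, a s - b s)) = 0"
  proof (rule fresh_centred_expectation[OF c(1) J ab])
    show "\<phi> \<in> borel_measurable (count_space UNIV \<Otimes>\<^sub>M borel)"
      unfolding \<phi>_def by measurable
    show "integrable M (\<lambda>s. \<phi> (c s, a s - b s))"
      unfolding eq using int a b by auto
    have "expectation (\<lambda>s. of_bool (c s)) = prob {s\<in>space M. c s}"
      by (subst Bochner_Integration.integral_cong[where N = M and g = "indicator {s\<in>space M. c s}"])
        (auto simp: indicator_def)
    moreover have "integrable M (\<lambda>s. of_bool (c s) :: real)"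
      by (rule integrable_const_bound[where B = 1]) auto
    ultimately have "expectation (\<lambda>s. (of_bool (c s) - p) * y) = 0" for y
      using c(2) by (simp add: prob_space)
    then show "(\<integral>r. \<phi> (r, y) \<partial>distr M (count_space UNIV) c) = 0" for y
      by (subst integral_distr) (auto simp: \<phi>_def)
  qed
  then show "expectation (\<lambda>s. if c s then a s else b s) = p * expectation a + (1 - p) * expectation b"
    unfolding eq using int a b by simp
qed

lemma coin_msq:
  assumes c: "source j c (count_space UNIV)" "prob {s\<in>space M. c s} = p"
    and J: "j \<notin> J" and a: "L2 J a" and b: "L2 J b"
  shows "L2 (insert j J) (\<lambda>s. if c s then a s else b s)"
    and "expectation (\<lambda>s. (norm (if c s then a s else b s))\<^sup>2)
      = p * expectation (\<lambda>s. (norm (a s))\<^sup>2) + (1 - p) * expectation (\<lambda>s. (norm (b s))\<^sup>2)"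
proof -
  have jI: "insert j J \<subseteq> I" using c a by (auto simp: source_def dest: L2_J)
  have eq: "(norm (if c s then a s else b s))\<^sup>2 = (if c s then (norm (a s))\<^sup>2 else (norm (b s))\<^sup>2)" for s
    by simp
  have "(\<lambda>s. (norm (a s))\<^sup>2) \<in> borel_measurable (hist J)" "(\<lambda>s. (norm (b s))\<^sup>2) \<in> borel_measurable (hist J)"
    using L2_hist[OF a] L2_hist[OF b] by measurable
  note * = coin_expectation[OF c J L2_J[OF a] this(1) L2_integrable[OF a] this(2) L2_integrable[OF b]]
  show "expectation (\<lambda>s. (norm (if c s then a s else b s))\<^sup>2)
      = p * expectation (\<lambda>s. (norm (a s))\<^sup>2) + (1 - p) * expectation (\<lambda>s. (norm (b s))\<^sup>2)"
    unfolding eq by (rule *)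
  have "(\<lambda>s. if c s then a s else b s) \<in> borel_measurable (hist (insert j J))"
    using source_measurable[OF c(1) _ jI] measurable_hist_mono[OF L2_hist[OF a] _ jI]
      measurable_hist_mono[OF L2_hist[OF b] _ jI]
    by (intro measurable_If) (auto simp: pred_def intro: predE)
  then show "L2 (insert j J) (\<lambda>s. if c s then a s else b s)"
    using * jI by (simp add: L2_def eq)
qed

end

section \<open>Finite-sum problems\<close>

locale finite_sum_problem =
  fixes f :: "nat \<Rightarrow> 'a::euclidean_space \<Rightarrow> real" and g :: "nat \<Rightarrow> 'a \<Rightarrow> 'a"
    and F :: "'a \<Rightarrow> real" and gF :: "'a \<Rightarrow> 'a" and n :: nat and Li :: "nat \<Rightarrow> real"
    and Lmax L \<mu> :: real and xstar :: 'a
  assumes n_pos: "n \<ge> 1"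
    and F_def: "F = (\<lambda>x. (1 / real n) * (\<Sum>i<n. f i x))"
    and gF_def: "gF = (\<lambda>x. (1 / real n) *\<^sub>R (\<Sum>i<n. g i x))"
    and grad: "\<And>i x. i < n \<Longrightarrow> GDERIV (f i) x :> g i x"
    and smooth_i: "\<And>i x y. i < n \<Longrightarrow> norm (g i x - g i y) \<le> Li i * norm (x - y)"
    and Lmax_def: "Lmax = Max (Li ` {..<n})"
    and smooth: "\<And>x y. norm (gF x - gF y) \<le> L * norm (x - y)"
    and convex_i: "\<And>i. i < n \<Longrightarrow> convex_on UNIV (f i)"
    and strong: "strongly_convex F \<mu>" and mu_pos: "\<mu> > 0"
    and xstar: "\<And>x. F xstar \<le> F x"
begin

definition bregman :: "'a \<Rightarrow> 'a \<Rightarrow> real" where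
  "bregman x y = F x - F y - inner (gF y) (x - y)"

lemma smooth_Lmax: "i < n \<Longrightarrow> norm (g i x - g i y) \<le> Lmax * norm (x - y)"
  using smooth_i[of i x y] by (rule order_trans) (auto simp: Lmax_def intro!: mult_right_mono)

lemma Lmax_nonneg: "0 \<le> Lmax"
proof -
  obtain b :: 'a where "b \<in> Basis" using nonempty_Basis by blast
  then show ?thesis
    using order_trans[OF norm_ge_zero smooth_Lmax[of 0 b 0]] n_pos by simp
qed

lemma GDERIV_F: "GDERIV F x :> gF x"
proof -
  have "(f i has_derivative (\<lambda>h. inner h (g i x))) (at x)" if "i < n" for i
    using grad[OF that] by (simp add: gderiv_def)
  then have "((\<lambda>x. \<Sum>i<n. f i x) has_derivative (\<lambda>h. \<Sum>i<n. inner h (g i x))) (at x)"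
    by (intro has_derivative_sum) auto
  then have "((\<lambda>x. (1 / real n) * (\<Sum>i<n. f i x)) has_derivative (\<lambda>h. (1 / real n) * (\<Sum>i<n. inner h (g i x)))) (at x)"
    by (rule has_derivative_mult_right)
  then show ?thesis by (simp add: gderiv_def F_def gF_def inner_sum_right)
qed

text \<open>The divergence is linear in the function. Through this identity the cocoercivity of the
  single \<open>f i\<close> bounds their average gradient change by one divergence of
  \<open>F\<close>.\<close>

lemma bregman_average:
  "bregman x y = (1 / real n) * (\<Sum>i<n. f i x - f i y - inner (g i y) (x - y))"
  unfolding bregman_def
  by (simp add: F_def gF_def inner_sum_left sum_subtractf right_diff_distrib diff_divide_distrib)

lemma bregman_nonneg: "0 \<le> bregman x y"
  unfolding bregman_average
proof (intro mult_nonneg_nonneg sum_nonneg)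
  fix i assume "i \<in> {..<n}"
  then show "0 \<le> f i x - f i y - inner (g i y) (x - y)"
    using convex_on_above_gradient[OF convex_i grad, of i y x] by simp
qed simp

lemma bregman_le: "bregman x y \<le> L / 2 * (norm (x - y))\<^sup>2"
  using lipschitz_gradient_upper[OF GDERIV_F smooth, of x y] by (simp add: bregman_def)

lemma average_gradient_le_bregman:
  "(1 / real n) * (\<Sum>i<n. (norm (g i x - g i y))\<^sup>2) \<le> 2 * Lmax * bregman x y"
proof -
  have "(\<Sum>i<n. (norm (g i x - g i y))\<^sup>2) \<le> (\<Sum>i<n. 2 * Lmax * (f i x - f i y - inner (g i y) (x - y)))"
    using lipschitz_gradient_cocoercive[OF convex_on_above_gradient[OF convex_i grad] grad smooth_Lmax]
    by (intro sum_mono) simp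
  then have "(1 / real n) * (\<Sum>i<n. (norm (g i x - g i y))\<^sup>2)
      \<le> (1 / real n) * (\<Sum>i<n. 2 * Lmax * (f i x - f i y - inner (g i y) (x - y)))"
    by (intro mult_left_mono) auto
  then show ?thesis by (simp add: bregman_average sum_distrib_left[symmetric])
qed

text \<open>Cocoercivity with \<open>Lmax\<close> followed by smoothness of \<open>F\<close> with
  \<open>L\<close>. This product is the source of sqrt (L Lmax) in the constants.\<close>

lemma average_gradient_le:
  "(1 / real n) * (\<Sum>i<n. (norm (g i x - g i y))\<^sup>2) \<le> L * Lmax * (norm (x - y))\<^sup>2"
  using average_gradient_le_bregman[of x y] mult_left_mono[OF bregman_le[of x y], of "2 * Lmax"] Lmax_nonneg
  by (simp add: ac_simps)

lemma gF_le_bregman: "(norm (gF x - gF y))\<^sup>2 \<le> 2 * L * bregman x y"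
  unfolding bregman_def
proof (rule lipschitz_gradient_cocoercive[OF _ GDERIV_F smooth])
  show "F y + inner (gF y) (x - y) \<le> F x" for x y
    using bregman_nonneg[of x y] by (simp add: bregman_def)
qed

text \<open>Subtracting the quadratic leaves a convex function; its gradient inequality at
  \<open>y\<close> rearranges to the claim.\<close>

lemma strong_lower: "\<mu> / 2 * (norm (x - y))\<^sup>2 \<le> bregman x y"
proof -
  have "GDERIV (\<lambda>x. \<mu> / 2 * (norm x)\<^sup>2) y :> \<mu> *\<^sub>R y"
    unfolding gderiv_def power2_norm_eq_inner
    by (auto intro!: derivative_eq_intros simp: inner_commute)
  then have "GDERIV (\<lambda>x. F x - \<mu> / 2 * (norm x)\<^sup>2) y :> gF y - \<mu> *\<^sub>R y"
    by (rule GDERIV_diff[OF GDERIV_F])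
  with strong have "F y - \<mu> / 2 * (norm y)\<^sup>2 + inner (gF y - \<mu> *\<^sub>R y) (x - y) \<le> F x - \<mu> / 2 * (norm x)\<^sup>2"
    unfolding strongly_convex_def by (rule convex_on_above_gradient)
  moreover have "\<mu> / 2 * (norm (x - y))\<^sup>2
      = \<mu> / 2 * (norm x)\<^sup>2 - \<mu> / 2 * (norm y)\<^sup>2 - \<mu> * inner y (x - y)"
    by (simp add: power2_norm_eq_inner inner_diff_left inner_diff_right inner_commute algebra_simps)
  ultimately show ?thesis
    by (simp add: bregman_def inner_diff_left)
qed

text \<open>At a unit vector and 0 the Bregman divergence lies between \<mu>/2 and L/2.\<close>

lemma L_pos: "0 < L"
proof -
  obtain b :: 'a where b: "b \<in> Basis" using nonempty_Basis by blast
  show ?thesis using order_trans[OF strong_lower[of b 0] bregman_le] b mu_pos by simp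
qed

end

section \<open>The iterates of 2Direction\<close>

definition rand_events ::
  "'m measure \<Rightarrow> (nat \<Rightarrow> nat \<Rightarrow> 'm \<Rightarrow> 'r) \<Rightarrow> (nat \<Rightarrow> 'r measure) \<Rightarrow> (nat \<Rightarrow> nat \<Rightarrow> 'm \<Rightarrow> 'r) \<Rightarrow> (nat \<Rightarrow> 'r measure)
   \<Rightarrow> (nat \<Rightarrow> 'm \<Rightarrow> 'r) \<Rightarrow> 'r measure \<Rightarrow> (nat \<Rightarrow> 'm \<Rightarrow> bool) \<Rightarrow> rand_idx \<Rightarrow> 'm set set" where
  "rand_events M ry Ry rz Rz rp RP c = (\<lambda>j. case j of RY t i \<Rightarrow> gen_events M (ry t i) (Ry i)
     | RZ t i \<Rightarrow> gen_events M (rz t i) (Rz i) | RPs t \<Rightarrow> gen_events M (rp t) RP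
     | RC t \<Rightarrow> gen_events M (c t) (count_space UNIV))"

primrec rand_time :: "rand_idx \<Rightarrow> nat" where
  "rand_time (RY t i) = t" | "rand_time (RZ t i) = t" | "rand_time (RPs t) = t" | "rand_time (RC t) = t"

lemma Int_stable_gen_events: "Int_stable (gen_events M X N)"
proof (rule Int_stableI)
  fix a b assume "a \<in> gen_events M X N" "b \<in> gen_events M X N"
  then obtain A B where "A \<in> sets N" "B \<in> sets N" "a = X -` A \<inter> space M" "b = X -` B \<inter> space M"
    by (auto simp: gen_events_def)
  then show "a \<inter> b \<in> gen_events M X N"
    unfolding gen_events_def by (intro CollectI exI[of _ "A \<inter> B"]) auto
qed

lemma Int_stable_rand_events: "Int_stable (rand_events M ry Ry rz Rz rp RP c j)"
  by (auto simp: rand_events_def Int_stable_gen_events split: rand_idx.split)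

locale two_direction =
  finite_sum_problem f g F gF n Li Lmax L \<mu> xstar +
  two_direction_params \<alpha> \<beta> p \<tau> \<omega> L Lmax Lb "real n" +
  indep_sources M "rand_events M ry Ry rz Rz rp RP c" "rand_indices n"
  for f :: "nat \<Rightarrow> 'a::euclidean_space \<Rightarrow> real" and g F gF n Li Lmax L \<mu> xstar \<alpha> \<beta> p \<tau> \<omega> Lb
    and M :: "'m measure" and ry :: "nat \<Rightarrow> nat \<Rightarrow> 'm \<Rightarrow> 'r" and Ry rz Rz rp RP c +
  fixes CDy CDz :: "nat \<Rightarrow> 'r \<Rightarrow> 'a \<Rightarrow> 'a" and CP :: "'r \<Rightarrow> 'a \<Rightarrow> 'a" and thmin \<Gamma>0 :: real and x0 :: 'a
  assumes beta_omega: "\<beta> * (\<omega> + 1) = 1"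
    and thmin: "0 < thmin" "thmin \<le> 1 / 4" "p * thmin \<le> \<alpha> / 4" "p * thmin \<le> \<tau> / 4" "p * thmin \<le> \<beta> / 4"
    and Gamma0: "\<Gamma>0 \<ge> 1"
    and CDy: "\<And>i. i < n \<Longrightarrow> unbiased_comp (Ry i) (CDy i) \<omega>"
    and CDz: "\<And>i. i < n \<Longrightarrow> unbiased_comp (Rz i) (CDz i) \<omega>"
    and CP: "contractive_comp RP CP \<alpha>"
    and ry_meas: "\<And>t i. i < n \<Longrightarrow> ry t i \<in> measurable M (Ry i)"
    and rz_meas: "\<And>t i. i < n \<Longrightarrow> rz t i \<in> measurable M (Rz i)"
    and rp_meas: "\<And>t. rp t \<in> measurable M RP"
    and c_meas: "\<And>t. c t \<in> measurable M (count_space UNIV)"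
    and ry_distr: "\<And>t i. i < n \<Longrightarrow> distr M (Ry i) (ry t i) = Ry i"
    and rz_distr: "\<And>t i. i < n \<Longrightarrow> distr M (Rz i) (rz t i) = Rz i"
    and rp_distr: "\<And>t. distr M RP (rp t) = RP"
    and c_distr: "\<And>t. prob {s \<in> space M. c t s} = p"
begin

section \<open>The sequences of step sizes\<close>

definition G :: "nat \<Rightarrow> real" where "G = Gam Lb \<mu> p thmin \<Gamma>0"
text \<open>Indices are shifted: \<open>\<theta> t\<close> and \<open>\<gamma> t\<close>, and
  further below \<open>y t\<close>, \<open>x t\<close> and \<open>q t\<close>, carry the index t + 1
  in the algorithm, whereas \<open>G t\<close> is \<Gamma>_t.\<close>

definition \<theta> :: "nat \<Rightarrow> real" where "\<theta> t = theta_next Lb \<mu> p thmin (G t)"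
definition \<gamma> :: "nat \<Rightarrow> real" where "\<gamma> t = gamma_next Lb \<mu> p thmin (G t)"
text \<open>The curvature of the proximal term centred at u or w; \<open>A t + \<mu>\<close> is the
  curvature of the whole subproblem.\<close>

definition A :: "nat \<Rightarrow> real" where "A t = (Lb + G t * \<mu>) / \<gamma> t"

lemma G_Suc: "G (Suc t) = G t + \<gamma> t"
  by (simp add: G_def \<gamma>_def)

lemma \<gamma>_eq: "\<gamma> t = p * \<theta> t * G t / (1 - p * \<theta> t)"
  by (simp add: \<gamma>_def gamma_next_def \<theta>_def)

lemma \<theta>_pos_aux: "0 < G t \<Longrightarrow> 0 < \<theta> t"
  using theta_bar_pos[of Lb \<mu> p "G t"] pos mu_pos thmin by (simp add: \<theta>_def theta_next_def)

lemma \<theta>_le_thmin: "\<theta> t \<le> thmin"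
  by (simp add: \<theta>_def theta_next_def)

lemma p\<theta>_le: "p * \<theta> t \<le> p * thmin"
  using \<theta>_le_thmin pos by simp

lemma p\<theta>_le_quarter: "p * \<theta> t \<le> 1 / 4"
  using p\<theta>_le[of t] thmin(3) pos(2) by linarith

lemma G_pos: "0 < G t"
proof (induction t)
  case 0
  then show ?case using Gamma0 by (simp add: G_def)
next
  case (Suc t)
  have "0 < \<gamma> t"
    unfolding \<gamma>_eq using Suc \<theta>_pos_aux[OF Suc] p\<theta>_le_quarter[of t] pos by (intro divide_pos_pos mult_pos_pos) auto
  then show ?case using Suc by (simp add: G_Suc)
qed

lemma \<theta>_pos: "0 < \<theta> t"
  by (rule \<theta>_pos_aux[OF G_pos])

lemma \<gamma>_pos: "0 < \<gamma> t"
  unfolding \<gamma>_eq using G_pos \<theta>_pos[of t] p\<theta>_le_quarter[of t] pos by (intro divide_pos_pos mult_pos_pos) auto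

text \<open>This explains the formula for \<gamma>: the Lyapunov step contracts the error part by 1
  - p \<theta>, and \<Gamma> grows by the inverse of that factor.\<close>

lemma G_eq: "G t = (1 - p * \<theta> t) * G (Suc t)"
  using p\<theta>_le_quarter[of t] by (simp add: G_Suc \<gamma>_eq field_simps)

lemma \<gamma>_eq': "\<gamma> t = p * \<theta> t * G (Suc t)"
  using G_eq[of t] by (simp add: G_Suc algebra_simps)

lemma \<theta>_Suc_le: "\<theta> (Suc t) \<le> \<theta> t"
proof -
  have "theta_bar Lb \<mu> p (G (Suc t)) \<le> theta_bar Lb \<mu> p (G t)"
    using pos mu_pos G_pos[of t] \<gamma>_pos[of t] by (intro theta_bar_antimono) (auto simp: G_Suc)
  then show ?thesis by (simp add: \<theta>_def theta_next_def)
qed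

text \<open>Multiplied by 1 - p \<theta>, which turns \<Gamma>_{t+1} into \<Gamma>_t, this is the
  quadratic inequality satisfied below the root.\<close>

lemma \<theta>_quadratic: "p * Lb * G (Suc t) * (\<theta> t)\<^sup>2 \<le> Lb + G t * \<mu>"
proof -
  have "\<theta> t \<le> theta_bar Lb \<mu> p (G t)" by (simp add: \<theta>_def theta_next_def)
  then have "p * Lb * G t * (\<theta> t)\<^sup>2 + p * (Lb + G t * \<mu>) * \<theta> t \<le> Lb + G t * \<mu>"
    using le_theta_bar_iff[of Lb \<mu> p "G t" "\<theta> t"] pos mu_pos G_pos \<theta>_pos[of t] by simp
  moreover have "(p * Lb * G (Suc t) * (\<theta> t)\<^sup>2) * (1 - p * \<theta> t) = p * Lb * G t * (\<theta> t)\<^sup>2"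
    unfolding G_eq[of t] by simp
  moreover have "(Lb + G t * \<mu>) * (1 - p * \<theta> t) = (Lb + G t * \<mu>) - p * (Lb + G t * \<mu>) * \<theta> t"
    by (simp add: right_diff_distrib)
  ultimately have "(p * Lb * G (Suc t) * (\<theta> t)\<^sup>2) * (1 - p * \<theta> t) \<le> (Lb + G t * \<mu>) * (1 - p * \<theta> t)"
    by linarith
  then show ?thesis using p\<theta>_le_quarter[of t] by (auto simp: mult_le_cancel_right)
qed

text \<open>The purpose of the quadratic in the algorithm: the proximal term becomes strong enough
  to supply Lb \<theta>^2 |u^{t+1} - u^t|^2 / 2.\<close>

lemma A_ge: "\<theta> t * Lb \<le> A t"
  using \<theta>_quadratic[of t] \<gamma>_pos[of t]
  by (simp add: A_def pos_le_divide_eq \<gamma>_eq' power2_eq_square mult_ac)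

lemma A_pos: "0 < A t"
  using A_ge[of t] \<theta>_pos[of t] pos by (meson less_le_trans mult_pos_pos)

section \<open>The iterates as random vectors\<close>

definition state :: "nat \<Rightarrow> 'm \<Rightarrow> 'a alg_state" where
  "state t s = alg_iter n g CDy CDz CP Lb \<mu> p thmin \<beta> \<tau> \<Gamma>0
     \<lparr>st_w = x0, st_z = x0, st_u = x0, st_k = gF x0, st_v = gF x0,
      st_hi = (\<lambda>i. g i x0), st_h = (1 / real n) *\<^sub>R (\<Sum>i<n. g i x0)\<rparr> ry rz rp c t s"

definition w :: "nat \<Rightarrow> 'm \<Rightarrow> 'a" where "w t s = st_w (state t s)"
definition z :: "nat \<Rightarrow> 'm \<Rightarrow> 'a" where "z t s = st_z (state t s)"
definition u :: "nat \<Rightarrow> 'm \<Rightarrow> 'a" where "u t s = st_u (state t s)"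
definition k :: "nat \<Rightarrow> 'm \<Rightarrow> 'a" where "k t s = st_k (state t s)"
definition v :: "nat \<Rightarrow> 'm \<Rightarrow> 'a" where "v t s = st_v (state t s)"
definition hi :: "nat \<Rightarrow> nat \<Rightarrow> 'm \<Rightarrow> 'a" where "hi t i s = st_hi (state t s) i"
definition y :: "nat \<Rightarrow> 'm \<Rightarrow> 'a" where "y t s = \<theta> t *\<^sub>R w t s + (1 - \<theta> t) *\<^sub>R z t s"
definition ey :: "nat \<Rightarrow> 'm \<Rightarrow> 'a" where
  "ey t s = (1 / real n) *\<^sub>R (\<Sum>i<n. CDy i (ry t i s) (g i (y t s) - hi t i s) - (g i (y t s) - hi t i s))"
definition q :: "nat \<Rightarrow> 'm \<Rightarrow> 'a" where
  "q t s = (1 / (A t + \<mu>)) *\<^sub>R (A t *\<^sub>R w t s + \<mu> *\<^sub>R y t s - k t s)"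
definition x :: "nat \<Rightarrow> 'm \<Rightarrow> 'a" where "x t s = \<theta> t *\<^sub>R u (Suc t) s + (1 - \<theta> t) *\<^sub>R z t s"
definition d :: "nat \<Rightarrow> nat \<Rightarrow> 'm \<Rightarrow> 'a" where "d t i s = g i (z (Suc t) s) - hi t i s"
definition ez :: "nat \<Rightarrow> 'm \<Rightarrow> 'a" where
  "ez t s = (1 / real n) *\<^sub>R (\<Sum>i<n. CDz i (rz t i s) (d t i s) - d t i s)"

lemmas iterate_defs = w_def z_def u_def k_def v_def hi_def

lemma iterate_0: "w 0 s = x0" "z 0 s = x0" "u 0 s = x0" "k 0 s = gF x0" "v 0 s = gF x0" "hi 0 i s = g i x0"
  by (simp_all add: iterate_defs state_def)

lemma state_Suc: "state (Suc t) s = alg_step n g CDy CDz CP Lb \<mu> p thmin \<beta> \<tau> (G t)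
    (\<lambda>i. ry t i s) (\<lambda>i. rz t i s) (rp t s) (c t s) (state t s)"
  by (simp add: state_def G_def)

lemmas step_unfold = state_Suc alg_step_def Let_def \<theta>_def[symmetric] \<gamma>_def[symmetric]

text \<open>The server vector moves by \<beta> times the average of the same messages that move the
  workers' vectors, so the invariant persists and \<open>st_h\<close> can be eliminated.\<close>

lemma h_average: "st_h (state t s) = (1 / real n) *\<^sub>R (\<Sum>i<n. hi t i s)"
proof (induction t)
  case 0
  then show ?case by (simp add: state_def hi_def)
next
  case (Suc t)
  then show ?case
    by (simp add: step_unfold hi_def sum.distrib scaleR_add_right scaleR_sum_right[symmetric])
qed

lemma prox: "arg_min (\<lambda>x. inner a x + (Lb + G t * \<mu>) / (2 * \<gamma> t) * (norm (x - b))\<^sup>2 + \<mu> / 2 * (norm (x - e))\<^sup>2) (\<lambda>_. True)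
    = (1 / (A t + \<mu>)) *\<^sub>R (A t *\<^sub>R b + \<mu> *\<^sub>R e - a)"
proof -
  have half: "(Lb + G t * \<mu>) / (2 * \<gamma> t) = A t / 2" by (simp add: A_def)
  show ?thesis unfolding half using A_pos[of t] mu_pos by (intro arg_min_prox) simp
qed

text \<open>The memories cancel: their average plus the average message is the exact gradient plus
  the average compression error. This makes the estimate at y equal to
  \<open>gF (y t s) + ey t s\<close> and the target of \<open>v\<close> equal to
  \<open>gF (z (Suc t) s) + ez t s\<close>.\<close>

lemma average_shift:
  "(1 / real n) *\<^sub>R (\<Sum>i<n. hi t i s) + (1 / real n) *\<^sub>R (\<Sum>i<n. C i)
    = gF a + (1 / real n) *\<^sub>R (\<Sum>i<n. C i - (g i a - hi t i s))"
  by (simp add: gF_def sum_subtractf scaleR_diff_right)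

lemma u_Suc: "u (Suc t) s = (1 / (A t + \<mu>)) *\<^sub>R (A t *\<^sub>R u t s + \<mu> *\<^sub>R y t s - (gF (y t s) + ey t s))"
  unfolding ey_def average_shift[of t s, symmetric]
  by (simp only: u_def step_unfold prox) (simp add: y_def w_def z_def h_average hi_def)

lemma w_Suc: "w (Suc t) s = q t s + CP (rp t s) (u (Suc t) s - q t s)"
  unfolding u_def q_def w_def
  by (simp only: step_unfold prox) (simp add: y_def w_def z_def k_def)

lemma k_Suc: "k (Suc t) s = (if c t s then v t s else k t s)"
  by (simp add: step_unfold k_def v_def)

lemma z_Suc: "z (Suc t) s = (if c t s then x t s else z t s)"
  unfolding x_def u_def z_def by (simp add: step_unfold)

lemma hi_Suc: "hi (Suc t) i s = hi t i s + \<beta> *\<^sub>R CDz i (rz t i s) (d t i s)"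
  unfolding d_def z_def hi_def by (simp add: step_unfold)

lemma v_Suc: "v (Suc t) s = (1 - \<tau>) *\<^sub>R v t s + \<tau> *\<^sub>R (gF (z (Suc t) s) + ez t s)"
proof -
  have "gF (z (Suc t) s) + ez t s
      = (1 / real n) *\<^sub>R (\<Sum>i<n. hi t i s) + (1 / real n) *\<^sub>R (\<Sum>i<n. CDz i (rz t i s) (d t i s))"
    unfolding ez_def average_shift[of t s _ "z (Suc t) s"] d_def ..
  moreover have "st_v (state (Suc t) s) = (1 - \<tau>) *\<^sub>R st_v (state t s)
      + \<tau> *\<^sub>R (st_h (state t s) + (1 / real n) *\<^sub>R (\<Sum>i<n. CDz i (rz t i s) (d t i s)))"
    unfolding d_def z_def hi_def by (simp add: step_unfold)
  ultimately show ?thesis by (simp add: v_def h_average)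
qed

text \<open>The seeds of step \<open>t\<close> are revealed in the order: workers at \<open>y\<close>, coin, workers at \<open>z\<close>.
  The server seed needs only the first of these.\<close>

definition past :: "nat \<Rightarrow> rand_idx set" where
  "past t = {j \<in> rand_indices n. rand_time j < t}"

definition past_y :: "nat \<Rightarrow> rand_idx set" where "past_y t = past t \<union> RY t ` {..<n}"
definition past_c :: "nat \<Rightarrow> rand_idx set" where "past_c t = insert (RC t) (past_y t)"
definition past_z :: "nat \<Rightarrow> rand_idx set" where "past_z t = past_c t \<union> RZ t ` {..<n}"
definition past_p :: "nat \<Rightarrow> rand_idx set" where "past_p t = insert (RPs t) (past_y t)"

lemmas past_defs = past_def past_y_def past_c_def past_z_def past_p_def rand_indices_def

lemma past_subset:
  "past t \<subseteq> rand_indices n" "past_y t \<subseteq> rand_indices n" "past_c t \<subseteq> rand_indices n"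
  "past_z t \<subseteq> rand_indices n" "past_p t \<subseteq> rand_indices n"
  by (auto simp: past_defs)

lemma past_mono:
  "past t \<subseteq> past_y t" "past_y t \<subseteq> past_c t" "past t \<subseteq> past_c t" "past_c t \<subseteq> past_z t"
  "past_y t \<subseteq> past_p t" "past_z t \<subseteq> past (Suc t)" "past_p t \<subseteq> past (Suc t)"
  by (auto simp: past_defs)

lemma past_fresh:
  "RY t i \<notin> past t" "RC t \<notin> past_y t" "RZ t i \<notin> past_c t" "RPs t \<notin> past_y t"
  by (auto simp: past_defs)

lemma sources:
  "i < n \<Longrightarrow> source (RY t i) (ry t i) (Ry i)" "i < n \<Longrightarrow> source (RZ t i) (rz t i) (Rz i)"
  "source (RPs t) (rp t) RP" "source (RC t) (c t) (count_space UNIV)"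
  using ry_meas rz_meas rp_meas c_meas
  unfolding source_def by (auto simp: rand_indices_def rand_events_def)

section \<open>Square integrability of the iterates\<close>

definition iterates_L2 :: "nat \<Rightarrow> bool" where
  "iterates_L2 t \<longleftrightarrow> L2 (past t) (w t) \<and> L2 (past t) (z t) \<and> L2 (past t) (u t)
     \<and> L2 (past t) (k t) \<and> L2 (past t) (v t) \<and> (\<forall>i<n. L2 (past t) (hi t i))"

lemma L2_gradient: "L2 J X \<Longrightarrow> L2 J (\<lambda>s. gF (X s))" "i < n \<Longrightarrow> L2 J X \<Longrightarrow> L2 J (\<lambda>s. g i (X s))"
  using L2_lipschitz[OF _ smooth] L2_lipschitz[OF _ smooth_i] by blast+

text \<open>Young's inequality is applied only in the branch where z moves, so its parameter enters
  the factor of \<open>a\<close> multiplied by p. Choices as large as \<beta> / (2p) are then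
  affordable and leave the factor 1 + \<beta>/2.\<close>

lemma coin_msq_le:
  assumes a: "L2 (past_y t) a" and b: "L2 (past_y t) b" and r: "r > 0"
  shows "msq (\<lambda>s. if c t s then b s else a s) \<le> (1 + p * r) * msq a + (p + p / r) * msq (\<lambda>s. b s - a s)"
proof -
  have "msq b \<le> (1 + r) * msq a + (1 + 1 / r) * msq (\<lambda>s. b s - a s)"
    using msq_add_le[OF a L2_diff[OF b a] r] by simp
  then have "p * msq b \<le> p * ((1 + r) * msq a + (1 + 1 / r) * msq (\<lambda>s. b s - a s))"
    using pos by (intro mult_left_mono) auto
  then show ?thesis
    using coin_msq(2)[OF sources(4) c_distr past_fresh(2) b a] by (simp add: algebra_simps)
qed

context
  fixes t assumes iterates: "iterates_L2 t"
begin

lemma L2_now: "L2 (past t) (w t)" "L2 (past t) (z t)" "L2 (past t) (u t)" "L2 (past t) (k t)" "L2 (past t) (v t)"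
    "i < n \<Longrightarrow> L2 (past t) (hi t i)"
  using iterates by (auto simp: iterates_L2_def)

lemma L2_now_y: "L2 (past_y t) (w t)" "L2 (past_y t) (z t)" "L2 (past_y t) (u t)" "L2 (past_y t) (k t)"
    "L2 (past_y t) (v t)" "i < n \<Longrightarrow> L2 (past_y t) (hi t i)"
  using L2_now L2_mono past_mono(1) past_subset(2) by blast+

lemma L2_y: "L2 (past t) (y t)"
  unfolding y_def by (intro L2_add L2_scaleR L2_now)

lemma L2_y_y: "L2 (past_y t) (y t)"
  by (rule L2_mono[OF L2_y past_mono(1) past_subset(2)])

lemma L2_dy: "i < n \<Longrightarrow> L2 (past t) (\<lambda>s. g i (y t s) - hi t i s)"
  by (intro L2_diff L2_gradient L2_y L2_now)


lemma inj_RY: "inj_on (RY t) {..<n}" and inj_RZ: "inj_on (RZ t) {..<n}"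
  by (auto simp: inj_on_def)

lemma L2_ey: "L2 (past_y t) (ey t)"
  unfolding ey_def past_y_def
  by (rule compressor_average_L2[OF sources(1) ry_distr inj_RY past_fresh(1) past_subset(1) L2_dy CDy pos(9)])

lemma msq_ey_le: "msq (ey t) \<le> \<omega> / real n * ((1 / real n) * (\<Sum>i<n. msq (\<lambda>s. g i (y t s) - hi t i s)))"
  unfolding ey_def
  by (rule compressor_average_variance[OF sources(1) ry_distr inj_RY past_fresh(1) past_subset(1) L2_dy CDy pos(9)])

lemma ey_orthogonal: "L2 (past t) Z \<Longrightarrow> expectation (\<lambda>s. inner (ey t s) (Z s)) = 0"
  unfolding ey_def
  by (rule compressor_average_orthogonal[OF sources(1) ry_distr inj_RY past_fresh(1) past_subset(1) L2_dy CDy pos(9)])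

lemma L2_u_Suc: "L2 (past_y t) (u (Suc t))"
  unfolding u_Suc by (intro L2_add L2_diff L2_scaleR L2_gradient L2_now_y L2_y_y L2_ey)

lemma L2_q: "L2 (past_y t) (q t)"
  unfolding q_def by (intro L2_add L2_diff L2_scaleR L2_gradient L2_now_y L2_y_y)

lemma L2_x: "L2 (past_y t) (x t)"
  unfolding x_def by (intro L2_add L2_scaleR L2_u_Suc L2_now_y)

lemmas coin = coin_msq[OF sources(4) c_distr past_fresh(2), folded past_c_def]

lemma L2_z_Suc: "L2 (past_c t) (z (Suc t))"
  unfolding z_Suc by (intro coin L2_x L2_now_y)

lemma L2_k_Suc: "L2 (past_c t) (k (Suc t))"
  unfolding k_Suc by (intro coin L2_now_y)

lemma L2_d: "i < n \<Longrightarrow> L2 (past_c t) (d t i)"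
  unfolding d_def using L2_mono[OF L2_now(6) past_mono(3) past_subset(3)]
  by (intro L2_diff L2_gradient L2_z_Suc)

lemma L2_ez: "L2 (past_z t) (ez t)"
  unfolding ez_def past_z_def
  by (rule compressor_average_L2[OF sources(2) rz_distr inj_RZ past_fresh(3) past_subset(3) L2_d CDz pos(9)])

lemma msq_ez_le: "msq (ez t) \<le> \<omega> / real n * ((1 / real n) * (\<Sum>i<n. msq (d t i)))"
  unfolding ez_def
  by (rule compressor_average_variance[OF sources(2) rz_distr inj_RZ past_fresh(3) past_subset(3) L2_d CDz pos(9)])

lemma ez_orthogonal: "L2 (past_c t) Z \<Longrightarrow> expectation (\<lambda>s. inner (ez t s) (Z s)) = 0"
  unfolding ez_def
  by (rule compressor_average_orthogonal[OF sources(2) rz_distr inj_RZ past_fresh(3) past_subset(3) L2_d CDz pos(9)])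

lemma CDz_facts:
  assumes i: "i < n"
  shows "L2 (past_z t) (\<lambda>s. CDz i (rz t i s) (d t i s) - d t i s)"
    and "msq (\<lambda>s. CDz i (rz t i s) (d t i s) - d t i s) \<le> \<omega> * msq (d t i)"
    and "expectation (\<lambda>s. inner (CDz i (rz t i s) (d t i s) - d t i s) (d t i s)) = 0"
proof -
  note e = compressor_error_L2[OF sources(2) rz_distr inj_RZ past_fresh(3) past_subset(3) L2_d CDz pos(9) i]
  show "L2 (past_z t) (\<lambda>s. CDz i (rz t i s) (d t i s) - d t i s)"
    by (rule L2_mono[OF e(1) _ past_subset(4)]) (use i in \<open>auto simp: past_z_def\<close>)
  show "msq (\<lambda>s. CDz i (rz t i s) (d t i s) - d t i s) \<le> \<omega> * msq (d t i)"
    by (rule e(2))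
  show "expectation (\<lambda>s. inner (CDz i (rz t i s) (d t i s) - d t i s) (d t i s)) = 0"
    by (rule compressor_orthogonal[OF sources(2)[OF i] rz_distr[OF i] past_fresh(3) L2_d[OF i] L2_d[OF i] CDz[OF i] pos(9)])
qed

lemma L2_hi_Suc: "i < n \<Longrightarrow> L2 (past_z t) (hi (Suc t) i)"
proof -
  assume i: "i < n"
  have eq: "hi (Suc t) i = (\<lambda>s. hi t i s + \<beta> *\<^sub>R ((CDz i (rz t i s) (d t i s) - d t i s) + d t i s))"
    by (simp add: hi_Suc fun_eq_iff)
  have "past t \<subseteq> past_z t" using past_mono by blast
  note * = L2_mono[OF L2_now(6)[OF i] this past_subset(4)] L2_mono[OF L2_d[OF i] past_mono(4) past_subset(4)]
  show ?thesis unfolding eq by (intro L2_add L2_scaleR CDz_facts(1)[OF i] *)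
qed

lemma L2_v_Suc: "L2 (past_z t) (v (Suc t))"
proof -
  have "past t \<subseteq> past_z t" using past_mono by blast
  from L2_mono[OF L2_now(5) this past_subset(4)] show ?thesis
    unfolding v_Suc using L2_mono[OF L2_z_Suc past_mono(4) past_subset(4)]
    by (intro L2_add L2_scaleR L2_gradient L2_ez)
qed

lemma CP_facts:
  shows "L2 (past_p t) (\<lambda>s. CP (rp t s) (u (Suc t) s - q t s) - (u (Suc t) s - q t s))"
    and "msq (\<lambda>s. CP (rp t s) (u (Suc t) s - q t s) - (u (Suc t) s - q t s)) \<le> (1 - \<alpha>) * msq (\<lambda>s. u (Suc t) s - q t s)"
proof -
  have "(\<lambda>(r, x). CP r x) \<in> borel_measurable (RP \<Otimes>\<^sub>M borel)"
    "\<And>x. (\<integral>\<^sup>+ r. ennreal ((norm (CP r x - x))\<^sup>2) \<partial>RP) \<le> ennreal ((1 - \<alpha>) * (norm x)\<^sup>2)"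
    using CP unfolding contractive_comp_def by blast+
  moreover have "0 \<le> 1 - \<alpha>" using pos by simp
  ultimately have *: "L2 (insert (RPs t) (past_y t)) (\<lambda>s. CP (rp t s) (u (Suc t) s - q t s) - (u (Suc t) s - q t s))"
    "msq (\<lambda>s. CP (rp t s) (u (Suc t) s - q t s) - (u (Suc t) s - q t s)) \<le> (1 - \<alpha>) * msq (\<lambda>s. u (Suc t) s - q t s)"
    by (blast intro: compressor_L2[OF sources(3) rp_distr past_fresh(4) L2_diff[OF L2_u_Suc L2_q]])+
  then show "L2 (past_p t) (\<lambda>s. CP (rp t s) (u (Suc t) s - q t s) - (u (Suc t) s - q t s))"
    and "msq (\<lambda>s. CP (rp t s) (u (Suc t) s - q t s) - (u (Suc t) s - q t s)) \<le> (1 - \<alpha>) * msq (\<lambda>s. u (Suc t) s - q t s)"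
    by (simp_all add: past_p_def)
qed

lemma w_Suc': "w (Suc t) s = (CP (rp t s) (u (Suc t) s - q t s) - (u (Suc t) s - q t s)) + u (Suc t) s"
  by (simp add: w_Suc)

lemma L2_w_Suc: "L2 (past_p t) (w (Suc t))"
  unfolding w_Suc' by (intro L2_add CP_facts(1) L2_mono[OF L2_u_Suc past_mono(5) past_subset(5)])

lemma iterates_L2_Suc: "iterates_L2 (Suc t)"
proof -
  have "past_y t \<subseteq> past (Suc t)" "past_c t \<subseteq> past (Suc t)" using past_mono by blast+
  then show ?thesis
    unfolding iterates_L2_def
    using L2_mono[OF L2_w_Suc past_mono(7) past_subset(1)] L2_mono[OF L2_z_Suc _ past_subset(1)]
      L2_mono[OF L2_u_Suc _ past_subset(1)] L2_mono[OF L2_k_Suc _ past_subset(1)]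
      L2_mono[OF L2_v_Suc past_mono(6) past_subset(1)] L2_mono[OF L2_hi_Suc past_mono(6) past_subset(1)]
    by blast
qed

end

lemma iterates_L2: "iterates_L2 t"
proof (induction t)
  case 0
  then show ?case
    unfolding iterates_L2_def by (simp add: iterate_0[abs_def] L2_const past_subset)
qed (rule iterates_L2_Suc)

section \<open>One-step estimates\<close>

lemmas L2_state = L2_now[OF iterates_L2]
lemmas L2_state_y = L2_now_y[OF iterates_L2]
lemmas L2_step = L2_y[OF iterates_L2] L2_y_y[OF iterates_L2] L2_ey[OF iterates_L2] L2_u_Suc[OF iterates_L2]
  L2_q[OF iterates_L2] L2_x[OF iterates_L2] L2_z_Suc[OF iterates_L2] L2_d[OF iterates_L2] L2_ez[OF iterates_L2]

lemma L2_const_state: "L2 (past t) (\<lambda>_. a)" "L2 (past_y t) (\<lambda>_. a)" "L2 (past_c t) (\<lambda>_. a)"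
  by (intro L2_const past_subset)+

lemma F_borel: "F \<in> borel_measurable borel"
proof (rule borel_measurable_continuous_onI)
  show "continuous_on UNIV F"
    using GDERIV_F by (auto simp: gderiv_def intro!: has_derivative_continuous_on)
qed

lemma bregman_integrable:
  assumes X: "L2 J X" and Y: "L2 J Y"
  shows "integrable M (\<lambda>s. bregman (X s) (Y s))"
proof (rule Bochner_Integration.integrable_bound)
  show "integrable M (\<lambda>s. L / 2 * (norm (X s - Y s))\<^sup>2)"
    by (intro integrable_mult_right L2_integrable[OF L2_diff[OF X Y]])
  have "(\<lambda>s. F (X s)) \<in> borel_measurable M" "(\<lambda>s. F (Y s)) \<in> borel_measurable M"
    using measurable_compose[OF L2_measurable[OF X] F_borel] measurable_compose[OF L2_measurable[OF Y] F_borel] .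
  then show "(\<lambda>s. bregman (X s) (Y s)) \<in> borel_measurable M"
    unfolding bregman_def
    by (intro borel_measurable_diff borel_measurable_inner L2_measurable[OF L2_gradient(1)[OF Y]]
        L2_measurable[OF X] L2_measurable[OF Y])
  show "AE s in M. norm (bregman (X s) (Y s)) \<le> norm (L / 2 * (norm (X s - Y s))\<^sup>2)"
  proof (rule AE_I2)
    fix s show "norm (bregman (X s) (Y s)) \<le> norm (L / 2 * (norm (X s - Y s))\<^sup>2)"
      unfolding real_norm_def abs_of_nonneg[OF bregman_nonneg] by (rule order_trans[OF bregman_le abs_ge_self])
  qed
qed

lemma gap_integrable:
  assumes X: "L2 J X"
  shows "integrable M (\<lambda>s. F (X s) - F xstar)"
proof -
  have C: "L2 J (\<lambda>_. a)" for a :: 'a by (rule L2_const[OF L2_J[OF X]])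
  have "integrable M (\<lambda>s. bregman (X s) xstar + inner (gF xstar) (X s - xstar))"
    by (intro Bochner_Integration.integrable_add bregman_integrable[OF X C] integrable_inner[OF C L2_diff[OF X C]])
  then show ?thesis by (simp add: bregman_def)
qed

lemma average_msq_gradient:
  assumes X: "L2 J X" and Y: "L2 J Y"
  shows "(1 / real n) * (\<Sum>i<n. msq (\<lambda>s. g i (X s) - g i (Y s))) \<le> 2 * Lmax * expectation (\<lambda>s. bregman (X s) (Y s))" (is ?A)
    and "(1 / real n) * (\<Sum>i<n. msq (\<lambda>s. g i (X s) - g i (Y s))) \<le> L * Lmax * msq (\<lambda>s. X s - Y s)" (is ?B)
    and "msq (\<lambda>s. gF (X s) - gF (Y s)) \<le> 2 * L * expectation (\<lambda>s. bregman (X s) (Y s))" (is ?C)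
    and "msq (\<lambda>s. gF (X s) - gF (Y s)) \<le> L\<^sup>2 * msq (\<lambda>s. X s - Y s)" (is ?D)
proof -
  have int: "integrable M (\<lambda>s. (norm (g i (X s) - g i (Y s)))\<^sup>2)" if "i < n" for i
    by (intro L2_integrable[OF L2_diff[OF L2_gradient(2)[OF that X] L2_gradient(2)[OF that Y]]])
  have intF: "integrable M (\<lambda>s. (norm (gF (X s) - gF (Y s)))\<^sup>2)"
    by (intro L2_integrable[OF L2_diff[OF L2_gradient(1)[OF X] L2_gradient(1)[OF Y]]])
  have intd: "integrable M (\<lambda>s. (norm (X s - Y s))\<^sup>2)"
    by (rule L2_integrable[OF L2_diff[OF X Y]])
  have eq: "(1 / real n) * (\<Sum>i<n. msq (\<lambda>s. g i (X s) - g i (Y s)))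
      = expectation (\<lambda>s. (1 / real n) * (\<Sum>i<n. (norm (g i (X s) - g i (Y s)))\<^sup>2))"
    using int by (simp add: Bochner_Integration.integral_sum)
  have int': "integrable M (\<lambda>s. (1 / real n) * (\<Sum>i<n. (norm (g i (X s) - g i (Y s)))\<^sup>2))"
    using int by (intro integrable_mult_right Bochner_Integration.integrable_sum) auto
  have intd': "integrable M (\<lambda>s. a * (norm (X s - Y s))\<^sup>2)"
    and intb': "integrable M (\<lambda>s. a * bregman (X s) (Y s))" for a
    using intd bregman_integrable[OF X Y] by (auto intro: integrable_mult_right)
  show ?A unfolding eq integral_mult_right_zero[symmetric]
    by (rule integral_mono[OF int' intb' average_gradient_le_bregman])
  show ?B unfolding eq integral_mult_right_zero[symmetric]
    by (rule integral_mono[OF int' intd' average_gradient_le])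
  show ?C unfolding integral_mult_right_zero[symmetric]
    by (rule integral_mono[OF intF intb' gF_le_bregman])
  have "(norm (gF a - gF b))\<^sup>2 \<le> L\<^sup>2 * (norm (a - b))\<^sup>2" for a b
    unfolding power_mult_distrib[symmetric] by (intro power_mono smooth) simp
  then show ?D unfolding integral_mult_right_zero[symmetric]
    by (rule integral_mono[OF intF intd'])
qed

section \<open>Mean squares entering the Lyapunov function and their bounds through the Bregman
  term\<close>

definition "Fgap t = expectation (\<lambda>s. F (z t s) - F xstar)"
definition "mU t = msq (\<lambda>s. u t s - xstar)"
definition "mH t = (1 / real n) * (\<Sum>i<n. msq (\<lambda>s. g i (z t s) - hi t i s))"
definition "mW t = msq (\<lambda>s. u t s - w t s)"
definition "mK t = msq (\<lambda>s. k t s - gF (z t s))"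
definition "mN t = msq (\<lambda>s. v t s - gF (z t s))"
definition "mD t = expectation (\<lambda>s. bregman (z t s) (y t s))"
definition "mX t = msq (\<lambda>s. u (Suc t) s - w t s)"
definition "mY t = msq (\<lambda>s. u (Suc t) s - u t s)"
definition "mKy t = msq (\<lambda>s. k t s - gF (y t s))"
definition "mG t = (1 / real n) * (\<Sum>i<n. msq (\<lambda>s. g i (x t s) - g i (z t s)))"
definition "mGF t = msq (\<lambda>s. gF (x t s) - gF (z t s))"
definition "b t = 1 / (A t + \<mu>)"

lemmas m_defs = mU_def mH_def mW_def mK_def mN_def mD_def mX_def mY_def mKy_def mG_def mGF_def

lemma m_nonneg: "0 \<le> mU t" "0 \<le> mH t" "0 \<le> mW t" "0 \<le> mK t" "0 \<le> mN t" "0 \<le> mD t" "0 \<le> mX t"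
    "0 \<le> mY t" "0 \<le> mKy t" "0 \<le> mG t" "0 \<le> mGF t"
  by (auto simp: m_defs bregman_nonneg intro!: sum_nonneg divide_nonneg_nonneg integral_nonneg)

lemma average_add: "(1 / real n) * (\<Sum>i<n. a * e i + b' * e' i)
    = a * ((1 / real n) * (\<Sum>i<n. e i)) + b' * ((1 / real n) * (\<Sum>i<n. e' i))" for e e' :: "nat \<Rightarrow> real"
  by (simp add: sum.distrib sum_distrib_left[symmetric] add_divide_distrib)

lemma average_mono: "(\<And>i. i < n \<Longrightarrow> e i \<le> e' i) \<Longrightarrow> (1 / real n) * (\<Sum>i<n. e i) \<le> (1 / real n) * (\<Sum>i<n. e' i)"
  for e e' :: "nat \<Rightarrow> real"
  by (intro mult_left_mono sum_mono) auto

text \<open>The memories track the gradients at z, while the messages are formed at y; inserting the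
  gradient at z splits the message into a Bregman part and H.\<close>

lemma mV_le: "msq (ey t) \<le> 2 * \<omega> / real n * (2 * Lmax * mD t + mH t)"
proof -
  have "(1 / real n) * (\<Sum>i<n. msq (\<lambda>s. g i (y t s) - hi t i s))
      \<le> (1 / real n) * (\<Sum>i<n. 2 * msq (\<lambda>s. g i (z t s) - g i (y t s)) + 2 * msq (\<lambda>s. g i (z t s) - hi t i s))"
  proof (rule average_mono)
    fix i assume i: "i < n"
    show "msq (\<lambda>s. g i (y t s) - hi t i s)
        \<le> 2 * msq (\<lambda>s. g i (z t s) - g i (y t s)) + 2 * msq (\<lambda>s. g i (z t s) - hi t i s)"
      by (rule msq_triangle_sym[OF L2_gradient(2)[OF i L2_step(1)] L2_gradient(2)[OF i L2_state(2)] L2_state(6)[OF i]])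
  qed
  also have "\<dots> \<le> 2 * (2 * Lmax * mD t) + 2 * mH t"
    unfolding average_add mD_def mH_def
    by (intro add_mono mult_left_mono average_msq_gradient(1)[OF L2_state(2) L2_step(1)]) auto
  finally have "\<omega> / real n * ((1 / real n) * (\<Sum>i<n. msq (\<lambda>s. g i (y t s) - hi t i s)))
      \<le> \<omega> / real n * (2 * (2 * Lmax * mD t) + 2 * mH t)"
    using pos by (intro mult_left_mono) auto
  then show ?thesis using msq_ey_le[OF iterates_L2, of t] by (simp add: algebra_simps)
qed

lemma mX_le: "mX t \<le> 2 * mY t + 2 * mW t"
  unfolding mX_def mY_def mW_def by (rule msq_triangle[OF L2_step(4) L2_state_y(3) L2_state_y(1)])

lemma x_minus_y: "x t s - y t s = \<theta> t *\<^sub>R (u (Suc t) s - w t s)"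
  by (simp add: x_def y_def scaleR_diff_right)

lemma msq_x_minus_y: "msq (\<lambda>s. x t s - y t s) = (\<theta> t)\<^sup>2 * mX t"
  unfolding x_minus_y msq_scaleR mX_def ..

lemma mG_le: "mG t \<le> 4 * Lmax * mD t + 2 * L * Lmax * (\<theta> t)\<^sup>2 * mX t"
proof -
  have "mG t \<le> (1 / real n) * (\<Sum>i<n. 2 * msq (\<lambda>s. g i (x t s) - g i (y t s)) + 2 * msq (\<lambda>s. g i (z t s) - g i (y t s)))"
    unfolding mG_def
  proof (rule average_mono)
    fix i assume i: "i < n"
    show "msq (\<lambda>s. g i (x t s) - g i (z t s))
        \<le> 2 * msq (\<lambda>s. g i (x t s) - g i (y t s)) + 2 * msq (\<lambda>s. g i (z t s) - g i (y t s))"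
      by (rule msq_triangle'[OF L2_gradient(2)[OF i L2_step(6)] L2_gradient(2)[OF i L2_step(2)]
          L2_gradient(2)[OF i L2_state_y(2)]])
  qed
  also have "\<dots> \<le> 2 * (L * Lmax * msq (\<lambda>s. x t s - y t s)) + 2 * (2 * Lmax * mD t)"
    unfolding average_add mD_def
    by (intro add_mono mult_left_mono average_msq_gradient(1)[OF L2_state_y(2) L2_step(2)]
        average_msq_gradient(2)[OF L2_step(6) L2_step(2)]) auto
  finally show ?thesis unfolding msq_x_minus_y by (simp add: mult.assoc)
qed

lemma mGF_le: "mGF t \<le> 4 * L * mD t + 2 * L\<^sup>2 * (\<theta> t)\<^sup>2 * mX t"
proof -
  have "mGF t \<le> 2 * msq (\<lambda>s. gF (x t s) - gF (y t s)) + 2 * msq (\<lambda>s. gF (z t s) - gF (y t s))"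
    unfolding mGF_def
    by (rule msq_triangle'[OF L2_gradient(1)[OF L2_step(6)] L2_gradient(1)[OF L2_step(2)] L2_gradient(1)[OF L2_state_y(2)]])
  also have "\<dots> \<le> 2 * (L\<^sup>2 * msq (\<lambda>s. x t s - y t s)) + 2 * (2 * L * mD t)"
    unfolding mD_def
    by (intro add_mono mult_left_mono average_msq_gradient(3)[OF L2_state_y(2) L2_step(2)]
        average_msq_gradient(4)[OF L2_step(6) L2_step(2)]) auto
  finally show ?thesis unfolding msq_x_minus_y by (simp add: mult.assoc)
qed

lemma mKy_le: "mKy t \<le> 2 * mK t + 4 * L * mD t"
proof -
  have "mKy t \<le> 2 * mK t + 2 * msq (\<lambda>s. gF (z t s) - gF (y t s))"
    unfolding mKy_def mK_def
    by (rule msq_triangle[OF L2_state(4) L2_gradient(1)[OF L2_state(2)] L2_gradient(1)[OF L2_step(1)]])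
  also have "\<dots> \<le> 2 * mK t + 2 * (2 * L * mD t)"
    unfolding mD_def by (intro add_mono mult_left_mono average_msq_gradient(3)[OF L2_state(2) L2_step(1)]) auto
  finally show ?thesis by simp
qed

section \<open>Recursions of the memory errors H, K and N\<close>

lemma msq_d_le:
  assumes i: "i < n" and r: "r > 0"
  shows "msq (d t i) \<le> (1 + p * r) * msq (\<lambda>s. g i (z t s) - hi t i s)
      + (p + p / r) * msq (\<lambda>s. g i (x t s) - g i (z t s))"
proof -
  have "msq (d t i) = msq (\<lambda>s. if c t s then g i (x t s) - hi t i s else g i (z t s) - hi t i s)"
    unfolding d_def z_Suc by (intro Bochner_Integration.integral_cong) auto
  also have "\<dots> \<le> (1 + p * r) * msq (\<lambda>s. g i (z t s) - hi t i s)
      + (p + p / r) * msq (\<lambda>s. (g i (x t s) - hi t i s) - (g i (z t s) - hi t i s))"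
    by (intro coin_msq_le L2_diff L2_gradient L2_step L2_state_y i r)
  finally show ?thesis by simp
qed

lemma average_msq_d_le:
  assumes r: "r > 0"
  shows "(1 / real n) * (\<Sum>i<n. msq (d t i)) \<le> (1 + p * r) * mH t + (p + p / r) * mG t"
proof -
  have "(1 / real n) * (\<Sum>i<n. msq (d t i))
      \<le> (1 / real n) * (\<Sum>i<n. (1 + p * r) * msq (\<lambda>s. g i (z t s) - hi t i s)
      + (p + p / r) * msq (\<lambda>s. g i (x t s) - g i (z t s)))"
    by (rule average_mono[OF msq_d_le[OF _ r]])
  then show ?thesis unfolding average_add mH_def mG_def .
qed

text \<open>Bias and noise are orthogonal, which gives the factor \<beta>^2 \<omega> + (1 -
  \<beta>)^2; by \<beta> (\<omega> + 1) = 1 it equals 1 - \<beta>.\<close>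

lemma msq_hi_Suc:
  assumes i: "i < n"
  shows "msq (\<lambda>s. g i (z (Suc t) s) - hi (Suc t) i s) \<le> (1 - \<beta>) * msq (d t i)"
proof -
  let ?e = "\<lambda>s. CDz i (rz t i s) (d t i s) - d t i s"
  note e = CDz_facts[OF iterates_L2 i, of t]
  have dz: "L2 (past_z t) (d t i)" by (rule L2_mono[OF L2_step(8)[OF i] past_mono(4) past_subset(4)])
  have eq: "g i (z (Suc t) s) - hi (Suc t) i s = (- \<beta>) *\<^sub>R ?e s + (1 - \<beta>) *\<^sub>R d t i s" for s
    unfolding hi_Suc d_def by (simp add: algebra_simps)
  have "msq (\<lambda>s. (- \<beta>) *\<^sub>R ?e s + (1 - \<beta>) *\<^sub>R d t i s) = msq (\<lambda>s. (- \<beta>) *\<^sub>R ?e s) + msq (\<lambda>s. (1 - \<beta>) *\<^sub>R d t i s)"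
  proof (rule msq_add_orthogonal[OF L2_scaleR[OF e(1)] L2_scaleR[OF dz]])
    show "expectation (\<lambda>s. inner ((- \<beta>) *\<^sub>R ?e s) ((1 - \<beta>) *\<^sub>R d t i s)) = 0"
      using e(3) by simp
  qed
  also have "\<dots> = \<beta>\<^sup>2 * msq ?e + (1 - \<beta>)\<^sup>2 * msq (d t i)"
    unfolding msq_scaleR by simp
  also have "\<dots> \<le> \<beta>\<^sup>2 * (\<omega> * msq (d t i)) + (1 - \<beta>)\<^sup>2 * msq (d t i)"
    using e(2) by (intro add_mono mult_left_mono) auto
  also have "\<dots> = (1 - 2 * \<beta> + \<beta> * (\<beta> * (\<omega> + 1))) * msq (d t i)"
    by (simp add: power2_eq_square algebra_simps)
  finally show ?thesis unfolding eq beta_omega by simp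
qed

lemma contraction_half: "0 \<le> a \<Longrightarrow> a \<le> 1 \<Longrightarrow> (1 - a) * (1 + a / 2) \<le> 1 - a / 2" for a :: real
  by (simp add: field_simps)

lemma mH_Suc: "mH (Suc t) \<le> (1 - \<beta> / 2) * mH t + (p + 2 * p\<^sup>2 / \<beta>) * mG t"
proof -
  have r: "p * (\<beta> / (2 * p)) = \<beta> / 2" "p / (\<beta> / (2 * p)) = 2 * p\<^sup>2 / \<beta>"
    using pos by (auto simp: power2_eq_square)
  \<comment> \<open>The summand \<open>0 * 0\<close> brings the average into the two-term shape of
    \<open>average_add\<close>.\<close>
  have "mH (Suc t) \<le> (1 / real n) * (\<Sum>i<n. (1 - \<beta>) * msq (d t i) + 0 * 0)"
    unfolding mH_def using msq_hi_Suc by (intro average_mono) auto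
  also have "\<dots> = (1 - \<beta>) * ((1 / real n) * (\<Sum>i<n. msq (d t i)))"
    unfolding average_add by simp
  also have "\<dots> \<le> (1 - \<beta>) * ((1 + \<beta> / 2) * mH t + (p + 2 * p\<^sup>2 / \<beta>) * mG t)"
    using average_msq_d_le[of "\<beta> / (2 * p)" t] pos unfolding r by (intro mult_left_mono) auto
  also have "\<dots> = ((1 - \<beta>) * (1 + \<beta> / 2)) * mH t + (1 - \<beta>) * ((p + 2 * p\<^sup>2 / \<beta>) * mG t)"
    by (simp add: algebra_simps)
  also have "\<dots> \<le> (1 - \<beta> / 2) * mH t + 1 * ((p + 2 * p\<^sup>2 / \<beta>) * mG t)"
    using pos m_nonneg by (intro add_mono mult_right_mono contraction_half mult_nonneg_nonneg add_nonneg_nonneg) auto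
  finally show ?thesis by simp
qed

lemma mK_Suc: "mK (Suc t) \<le> (1 - p) * mK t + 2 * p * mN t + 2 * p * mGF t"
proof -
  have "mK (Suc t) = msq (\<lambda>s. if c t s then v t s - gF (x t s) else k t s - gF (z t s))"
    unfolding mK_def k_Suc z_Suc by (intro Bochner_Integration.integral_cong) auto
  also have "\<dots> = p * msq (\<lambda>s. v t s - gF (x t s)) + (1 - p) * mK t"
    unfolding mK_def
    by (intro coin_msq(2)[OF sources(4) c_distr past_fresh(2)] L2_diff L2_gradient L2_step L2_state_y)
  finally have "mK (Suc t) = p * msq (\<lambda>s. v t s - gF (x t s)) + (1 - p) * mK t" .
  moreover have "p * msq (\<lambda>s. v t s - gF (x t s)) \<le> p * (2 * mN t + 2 * mGF t)"
    unfolding mN_def mGF_def using pos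
    by (intro mult_left_mono msq_triangle'[of "past_y t"] L2_gradient L2_step L2_state_y) auto
  ultimately show ?thesis by (simp add: distrib_left)
qed

text \<open>The fresh noise is orthogonal to the rest and therefore enters with \<tau>^2 only. The
  Young parameter is 1 inside the noise, where a bounded factor suffices, and \<tau> / (2p) in the
  drift, where contraction must survive.\<close>

lemma mN_Suc: "mN (Suc t) \<le> (1 - \<tau> / 2) * mN t + (p + 2 * p\<^sup>2 / \<tau>) * mGF t
    + \<tau>\<^sup>2 * \<omega> / real n * (2 * mH t + 2 * p * mG t)"
proof -
  let ?a = "\<lambda>s. v t s - gF (z (Suc t) s)"
  have r: "p * (\<tau> / (2 * p)) = \<tau> / 2" "p / (\<tau> / (2 * p)) = 2 * p\<^sup>2 / \<tau>"
    using pos by (auto simp: power2_eq_square)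
  have a: "L2 (past_c t) ?a"
    by (intro L2_diff L2_gradient L2_step L2_mono[OF L2_state(5) past_mono(3) past_subset(3)])
  have az: "L2 (past_z t) ?a" by (rule L2_mono[OF a past_mono(4) past_subset(4)])
  have "v (Suc t) s - gF (z (Suc t) s) = \<tau> *\<^sub>R ez t s + (1 - \<tau>) *\<^sub>R ?a s" for s
    unfolding v_Suc by (simp add: algebra_simps)
  then have "mN (Suc t) = msq (\<lambda>s. \<tau> *\<^sub>R ez t s + (1 - \<tau>) *\<^sub>R ?a s)"
    by (simp add: mN_def)
  also have "\<dots> = msq (\<lambda>s. \<tau> *\<^sub>R ez t s) + msq (\<lambda>s. (1 - \<tau>) *\<^sub>R ?a s)"
  proof (rule msq_add_orthogonal[OF L2_scaleR[OF L2_step(9)] L2_scaleR[OF az]])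
    show "expectation (\<lambda>s. inner (\<tau> *\<^sub>R ez t s) ((1 - \<tau>) *\<^sub>R ?a s)) = 0"
      using ez_orthogonal[OF iterates_L2 a] by simp
  qed
  also have "\<dots> = \<tau>\<^sup>2 * msq (ez t) + (1 - \<tau>)\<^sup>2 * msq ?a"
    unfolding msq_scaleR ..
  finally have main: "mN (Suc t) = \<tau>\<^sup>2 * msq (ez t) + (1 - \<tau>)\<^sup>2 * msq ?a" .
  have "msq (ez t) \<le> \<omega> / real n * ((1 / real n) * (\<Sum>i<n. msq (d t i)))"
    by (rule msq_ez_le[OF iterates_L2])
  also have "\<dots> \<le> \<omega> / real n * (2 * mH t + 2 * p * mG t)"
  proof (rule mult_left_mono)
    have "(1 / real n) * (\<Sum>i<n. msq (d t i)) \<le> (1 + p) * mH t + 2 * p * mG t"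
      using average_msq_d_le[of 1 t] by simp
    moreover have "(1 + p) * mH t \<le> 2 * mH t" using pos m_nonneg by (intro mult_right_mono) auto
    ultimately show "(1 / real n) * (\<Sum>i<n. msq (d t i)) \<le> 2 * mH t + 2 * p * mG t" by linarith
  qed (use pos in auto)
  finally have "\<tau>\<^sup>2 * msq (ez t) \<le> \<tau>\<^sup>2 * (\<omega> / real n * (2 * mH t + 2 * p * mG t))"
    by (intro mult_left_mono) auto
  moreover have "(1 - \<tau>)\<^sup>2 * msq ?a \<le> (1 - \<tau> / 2) * mN t + (p + 2 * p\<^sup>2 / \<tau>) * mGF t"
  proof -
    have "msq ?a = msq (\<lambda>s. if c t s then v t s - gF (x t s) else v t s - gF (z t s))"
      unfolding z_Suc by (intro Bochner_Integration.integral_cong) auto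
    also have "\<dots> \<le> (1 + p * (\<tau> / (2 * p))) * mN t
        + (p + p / (\<tau> / (2 * p))) * msq (\<lambda>s. (v t s - gF (x t s)) - (v t s - gF (z t s)))"
      unfolding mN_def using pos by (intro coin_msq_le L2_diff L2_gradient L2_step L2_state_y) auto
    also have "msq (\<lambda>s. (v t s - gF (x t s)) - (v t s - gF (z t s))) = mGF t"
      unfolding mGF_def by (simp add: norm_minus_commute)
    finally have "msq ?a \<le> (1 + \<tau> / 2) * mN t + (p + 2 * p\<^sup>2 / \<tau>) * mGF t" unfolding r .
    then have "(1 - \<tau>)\<^sup>2 * msq ?a \<le> (1 - \<tau>)\<^sup>2 * ((1 + \<tau> / 2) * mN t + (p + 2 * p\<^sup>2 / \<tau>) * mGF t)"
      by (intro mult_left_mono) auto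
    also have "\<dots> \<le> (1 - \<tau>) * ((1 + \<tau> / 2) * mN t + (p + 2 * p\<^sup>2 / \<tau>) * mGF t)"
    proof (rule mult_right_mono)
      show "(1 - \<tau>)\<^sup>2 \<le> 1 - \<tau>"
        using mult_left_le[of "1 - \<tau>" "1 - \<tau>"] pos by (simp add: power2_eq_square)
    qed (use pos m_nonneg in \<open>intro add_nonneg_nonneg mult_nonneg_nonneg, auto\<close>)
    also have "\<dots> = ((1 - \<tau>) * (1 + \<tau> / 2)) * mN t + (1 - \<tau>) * ((p + 2 * p\<^sup>2 / \<tau>) * mGF t)"
      by (simp add: algebra_simps)
    also have "\<dots> \<le> (1 - \<tau> / 2) * mN t + 1 * ((p + 2 * p\<^sup>2 / \<tau>) * mGF t)"
      using pos m_nonneg by (intro add_mono mult_right_mono contraction_half mult_nonneg_nonneg add_nonneg_nonneg) auto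
    finally show ?thesis by simp
  qed
  ultimately show ?thesis unfolding main by simp
qed

section \<open>Lyapunov descent\<close>

lemma b_pos: "0 < b t" "b t * (A t + \<mu>) = 1" "b t * A t \<le> 1"
  using A_pos[of t] mu_pos by (auto simp: b_def field_simps)

lemma b_le: "\<theta> t * b t \<le> 1 / Lb"
proof -
  have "\<theta> t * Lb \<le> A t + \<mu>" using A_ge[of t] mu_pos by simp
  then show ?thesis using A_pos[of t] mu_pos pos by (simp add: b_def field_simps)
qed

lemma u_Suc': "u (Suc t) s = b t *\<^sub>R (A t *\<^sub>R u t s + \<mu> *\<^sub>R y t s - gF (y t s)) - b t *\<^sub>R ey t s"
  unfolding u_Suc b_def by (simp add: algebra_simps)

text \<open>u^{t+1} and q^{t+1} solve the same proximal problem up to centre and linear term, so y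
  cancels and their difference is b A (u - w) + b (k - \<open>gF\<close> y) - b \<open>ey\<close>.
  The noise is orthogonal to the other terms, b A \<le> 1, and Young's inequality with parameter
  \<alpha>/2 leaves the factor 1 - \<alpha>/2.\<close>

lemma mW_Suc: "mW (Suc t) \<le> (1 - \<alpha> / 2) * mW t + 2 / \<alpha> * (b t)\<^sup>2 * mKy t + (b t)\<^sup>2 * msq (ey t)"
proof -
  let ?D = "\<lambda>s. b t *\<^sub>R (A t *\<^sub>R (u t s - w t s)) + b t *\<^sub>R (k t s - gF (y t s))"
  have "mW (Suc t) = msq (\<lambda>s. CP (rp t s) (u (Suc t) s - q t s) - (u (Suc t) s - q t s))"
  proof -
    have "norm (u (Suc t) s - w (Suc t) s) = norm (CP (rp t s) (u (Suc t) s - q t s) - (u (Suc t) s - q t s))" for s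
      unfolding norm_minus_commute[of "u (Suc t) s"] by (simp add: w_Suc algebra_simps)
    then show ?thesis by (simp add: mW_def)
  qed
  then have W: "mW (Suc t) \<le> (1 - \<alpha>) * msq (\<lambda>s. u (Suc t) s - q t s)"
    using CP_facts(2)[OF iterates_L2, of t] by simp
  have "u (Suc t) s - q t s = (- b t) *\<^sub>R ey t s + ?D s" for s
    unfolding u_Suc' q_def b_def[symmetric] by (simp add: algebra_simps)
  then have "msq (\<lambda>s. u (Suc t) s - q t s) = msq (\<lambda>s. (- b t) *\<^sub>R ey t s + ?D s)" by simp
  also have "\<dots> = msq (\<lambda>s. (- b t) *\<^sub>R ey t s) + msq ?D"
  proof (rule msq_add_orthogonal[of "past_y t"])
    have "L2 (past t) ?D" by (intro L2_add L2_scaleR L2_diff L2_gradient L2_state L2_step)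
    then show "expectation (\<lambda>s. inner ((- b t) *\<^sub>R ey t s) (?D s)) = 0"
      using ey_orthogonal[OF iterates_L2, of t ?D] by simp
  qed (intro L2_add L2_scaleR L2_diff L2_gradient L2_state_y L2_step)+
  also have "msq (\<lambda>s. (- b t) *\<^sub>R ey t s) = (b t)\<^sup>2 * msq (ey t)"
    unfolding msq_scaleR by simp
  finally have Q: "msq (\<lambda>s. u (Suc t) s - q t s) = (b t)\<^sup>2 * msq (ey t) + msq ?D" .
  have D: "msq ?D \<le> (1 + \<alpha> / 2) * mW t + (1 + 2 / \<alpha>) * ((b t)\<^sup>2 * mKy t)"
  proof -
    have e1: "msq (\<lambda>s. b t *\<^sub>R (A t *\<^sub>R (u t s - w t s))) = (b t * A t)\<^sup>2 * mW t"
      unfolding msq_scaleR mW_def by (simp add: power_mult_distrib)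
    have e2: "msq (\<lambda>s. b t *\<^sub>R (k t s - gF (y t s))) = (b t)\<^sup>2 * mKy t"
      unfolding msq_scaleR mKy_def ..
    have "(b t * A t)\<^sup>2 * mW t \<le> 1 * mW t"
      using b_pos[of t] A_pos[of t] m_nonneg by (intro mult_right_mono power_le_one) auto
    then have "(1 + \<alpha> / 2) * ((b t * A t)\<^sup>2 * mW t) \<le> (1 + \<alpha> / 2) * mW t"
      using pos by (intro mult_left_mono) auto
    moreover have "msq ?D \<le> (1 + \<alpha> / 2) * ((b t * A t)\<^sup>2 * mW t) + (1 + 1 / (\<alpha> / 2)) * ((b t)\<^sup>2 * mKy t)"
      unfolding e1[symmetric] e2[symmetric]
      using pos by (intro msq_add_le[of "past t"] L2_scaleR L2_diff L2_gradient L2_state L2_step) auto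
    ultimately show ?thesis by simp
  qed
  have "mW (Suc t) \<le> (1 - \<alpha>) * ((b t)\<^sup>2 * msq (ey t)
      + ((1 + \<alpha> / 2) * mW t + (1 + 2 / \<alpha>) * ((b t)\<^sup>2 * mKy t)))"
    using pos D unfolding Q by (intro order_trans[OF W[unfolded Q]] mult_left_mono) auto
  also have "\<dots> = (1 - \<alpha>) * ((b t)\<^sup>2 * msq (ey t)) + ((1 - \<alpha>) * (1 + \<alpha> / 2)) * mW t
      + ((1 - \<alpha>) * (1 + 2 / \<alpha>)) * ((b t)\<^sup>2 * mKy t)"
    by (simp add: algebra_simps)
  also have "\<dots> \<le> 1 * ((b t)\<^sup>2 * msq (ey t)) + (1 - \<alpha> / 2) * mW t + (2 / \<alpha>) * ((b t)\<^sup>2 * mKy t)"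
  proof (intro add_mono mult_right_mono contraction_half)
    show "(1 - \<alpha>) * (1 + 2 / \<alpha>) \<le> 2 / \<alpha>" using pos by (simp add: field_simps)
  qed (use pos m_nonneg in auto)
  finally show ?thesis by simp
qed

text \<open>Smoothness is used between x and y, where x - y = \<theta> (u^{t+1} - y) + (1 -
  \<theta>) (z - y). The z part is evaluated exactly, which is why the negative Bregman term
  survives. The u part is compared with \<open>xstar\<close> by the completed square and strong
  convexity, whose term \<mu>/2 |xstar - y|^2 cancels the one of the subproblem.\<close>

lemma objective_step:
  "F (x t s) - F xstar \<le> (1 - \<theta> t) * ((F (z t s) - F xstar) - bregman (z t s) (y t s))
    + \<theta> t * (A t / 2 * ((norm (u t s - xstar))\<^sup>2 - (norm (u (Suc t) s - u t s))\<^sup>2)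
        - (A t + \<mu>) / 2 * (norm (u (Suc t) s - xstar))\<^sup>2 - inner (ey t s) (u (Suc t) s - xstar))
    + L / 2 * ((\<theta> t)\<^sup>2 * (norm (u (Suc t) s - w t s))\<^sup>2)"
proof -
  let ?x = "x t s" and ?y = "y t s" and ?z = "z t s" and ?u = "u t s" and ?u' = "u (Suc t) s" and ?w = "w t s"
  let ?g = "gF ?y + ey t s"
  have 1: "F ?x \<le> F ?y + inner (gF ?y) (?x - ?y) + L / 2 * ((\<theta> t)\<^sup>2 * (norm (?u' - ?w))\<^sup>2)"
    using bregman_le[of ?x ?y] unfolding x_minus_y by (simp add: bregman_def x_minus_y power_mult_distrib)
  have "?x - ?y = \<theta> t *\<^sub>R (?u' - ?y) + (1 - \<theta> t) *\<^sub>R (?z - ?y)"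
    by (simp add: x_def algebra_simps)
  then have 2: "inner (gF ?y) (?x - ?y) = \<theta> t * inner (gF ?y) (?u' - ?y) + (1 - \<theta> t) * (F ?z - F ?y - bregman ?z ?y)"
    by (simp add: bregman_def inner_add_right)
  have "inner ?g xstar + A t / 2 * (norm (xstar - ?u))\<^sup>2 + \<mu> / 2 * (norm (xstar - ?y))\<^sup>2
      = inner ?g ?u' + A t / 2 * (norm (?u' - ?u))\<^sup>2 + \<mu> / 2 * (norm (?u' - ?y))\<^sup>2
        + (A t + \<mu>) / 2 * (norm (xstar - ?u'))\<^sup>2"
    by (rule sum_of_squares_shift[OF _ u_Suc]) (use A_pos[of t] mu_pos in auto)
  moreover have "F xstar \<ge> F ?y + inner (gF ?y) (xstar - ?y) + \<mu> / 2 * (norm (xstar - ?y))\<^sup>2"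
    using strong_lower[of xstar ?y] by (simp add: bregman_def)
  moreover have "0 \<le> \<mu> / 2 * (norm (?u' - ?y))\<^sup>2" using mu_pos by simp
  ultimately have "F ?y + inner (gF ?y) (?u' - ?y) \<le> F xstar
      + (A t / 2 * (norm (xstar - ?u))\<^sup>2 - A t / 2 * (norm (?u' - ?u))\<^sup>2
        - (A t + \<mu>) / 2 * (norm (xstar - ?u'))\<^sup>2 - inner (ey t s) (?u' - xstar))"
    by (simp add: inner_add_left inner_diff_right)
  then have "\<theta> t * (F ?y + inner (gF ?y) (?u' - ?y)) \<le> \<theta> t * (F xstar
      + (A t / 2 * (norm (xstar - ?u))\<^sup>2 - A t / 2 * (norm (?u' - ?u))\<^sup>2
        - (A t + \<mu>) / 2 * (norm (xstar - ?u'))\<^sup>2 - inner (ey t s) (?u' - xstar)))"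
    using \<theta>_pos[of t] by (intro mult_left_mono) auto
  moreover have "F ?y + inner (gF ?y) (?x - ?y)
      = (1 - \<theta> t) * (F ?z - bregman ?z ?y) + \<theta> t * (F ?y + inner (gF ?y) (?u' - ?y))"
    unfolding 2 by (simp add: algebra_simps)
  ultimately show ?thesis
    using 1 by (simp add: norm_minus_commute[of xstar] algebra_simps)
qed

text \<open>The noise enters u^{t+1} only through the summand -b \<open>ey\<close>, and the other
  summands are known before it is drawn. Hence noise and iterate are negatively correlated, and the
  objective estimate has to pay b times the variance.\<close>

lemma ey_u_Suc: "expectation (\<lambda>s. inner (ey t s) (u (Suc t) s - xstar)) = - b t * msq (ey t)"
proof -
  let ?Z = "\<lambda>s. b t *\<^sub>R (A t *\<^sub>R u t s + \<mu> *\<^sub>R y t s - gF (y t s)) - xstar"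
  have Z: "L2 (past t) ?Z"
    by (intro L2_add L2_scaleR L2_diff L2_gradient L2_state L2_step L2_const_state)
  have "inner (ey t s) (u (Suc t) s - xstar) = inner (ey t s) (?Z s) - b t * (norm (ey t s))\<^sup>2" for s
    unfolding u_Suc' by (simp add: inner_diff_right power2_norm_eq_inner)
  then have "expectation (\<lambda>s. inner (ey t s) (u (Suc t) s - xstar))
      = expectation (\<lambda>s. inner (ey t s) (?Z s)) - b t * msq (ey t)"
    using integrable_inner[OF L2_step(3) Z] L2_integrable[OF L2_step(3)[of t]] by simp
  then show ?thesis using ey_orthogonal[OF iterates_L2 Z] by simp
qed

lemma expected_objective_step:
  "expectation (\<lambda>s. F (x t s) - F xstar) \<le> (1 - \<theta> t) * (Fgap t - mD t)
    + \<theta> t * (A t / 2 * (mU t - mY t) - (A t + \<mu>) / 2 * mU (Suc t) + b t * msq (ey t))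
    + L / 2 * ((\<theta> t)\<^sup>2 * mX t)"
proof -
  have i1: "integrable M (\<lambda>s. F (z t s) - F xstar)" by (rule gap_integrable[OF L2_state(2)])
  have i2: "integrable M (\<lambda>s. bregman (z t s) (y t s))" by (rule bregman_integrable[OF L2_state(2) L2_step(1)])
  have i3: "integrable M (\<lambda>s. (norm (u t s - xstar))\<^sup>2)"
    by (intro L2_integrable[of "past t"] L2_diff L2_state L2_const_state)
  have i4: "integrable M (\<lambda>s. (norm (u (Suc t) s - u t s))\<^sup>2)" "integrable M (\<lambda>s. (norm (u (Suc t) s - xstar))\<^sup>2)"
    "integrable M (\<lambda>s. (norm (u (Suc t) s - w t s))\<^sup>2)"
    by (intro L2_integrable[of "past_y t"] L2_diff L2_state_y L2_step L2_const_state)+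
  have i5: "integrable M (\<lambda>s. inner (ey t s) (u (Suc t) s - xstar))"
    by (intro integrable_inner[of "past_y t" _ "past_y t"] L2_diff L2_step L2_const_state)
  note ints = i1 i2 i3 i4 i5
  have "expectation (\<lambda>s. F (x t s) - F xstar) \<le> expectation (\<lambda>s.
    (1 - \<theta> t) * ((F (z t s) - F xstar) - bregman (z t s) (y t s))
    + \<theta> t * (A t / 2 * ((norm (u t s - xstar))\<^sup>2 - (norm (u (Suc t) s - u t s))\<^sup>2)
        - (A t + \<mu>) / 2 * (norm (u (Suc t) s - xstar))\<^sup>2 - inner (ey t s) (u (Suc t) s - xstar))
    + L / 2 * ((\<theta> t)\<^sup>2 * (norm (u (Suc t) s - w t s))\<^sup>2))"
    by (intro integral_mono objective_step gap_integrable[OF L2_step(6)] Bochner_Integration.integrable_add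
        Bochner_Integration.integrable_diff integrable_mult_right ints)
  also have "\<dots> = (1 - \<theta> t) * (Fgap t - mD t)
    + \<theta> t * (A t / 2 * (mU t - mY t) - (A t + \<mu>) / 2 * mU (Suc t)
        - expectation (\<lambda>s. inner (ey t s) (u (Suc t) s - xstar)))
    + L / 2 * ((\<theta> t)\<^sup>2 * mX t)"
  proof -
    have c1: "integrable M (\<lambda>s. (F (z t s) - F xstar) - bregman (z t s) (y t s))"
      and c2: "integrable M (\<lambda>s. (norm (u t s - xstar))\<^sup>2 - (norm (u (Suc t) s - u t s))\<^sup>2)"
      by (intro Bochner_Integration.integrable_diff ints)+
    have c3: "integrable M (\<lambda>s. A t / 2 * ((norm (u t s - xstar))\<^sup>2 - (norm (u (Suc t) s - u t s))\<^sup>2))"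
      "integrable M (\<lambda>s. (A t + \<mu>) / 2 * (norm (u (Suc t) s - xstar))\<^sup>2)"
      by (intro integrable_mult_right c2 ints)+
    have c4: "integrable M (\<lambda>s. A t / 2 * ((norm (u t s - xstar))\<^sup>2 - (norm (u (Suc t) s - u t s))\<^sup>2)
        - (A t + \<mu>) / 2 * (norm (u (Suc t) s - xstar))\<^sup>2)"
      by (intro Bochner_Integration.integrable_diff c3)
    have c5: "integrable M (\<lambda>s. A t / 2 * ((norm (u t s - xstar))\<^sup>2 - (norm (u (Suc t) s - u t s))\<^sup>2)
        - (A t + \<mu>) / 2 * (norm (u (Suc t) s - xstar))\<^sup>2 - inner (ey t s) (u (Suc t) s - xstar))"
      by (intro Bochner_Integration.integrable_diff c4 ints)
    have c6: "integrable M (\<lambda>s. (1 - \<theta> t) * ((F (z t s) - F xstar) - bregman (z t s) (y t s)))"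
      "integrable M (\<lambda>s. \<theta> t * (A t / 2 * ((norm (u t s - xstar))\<^sup>2 - (norm (u (Suc t) s - u t s))\<^sup>2)
        - (A t + \<mu>) / 2 * (norm (u (Suc t) s - xstar))\<^sup>2 - inner (ey t s) (u (Suc t) s - xstar)))"
      "integrable M (\<lambda>s. L / 2 * ((\<theta> t)\<^sup>2 * (norm (u (Suc t) s - w t s))\<^sup>2))"
      by (intro integrable_mult_right c1 c5 ints)+
    show ?thesis
      unfolding Bochner_Integration.integral_add[OF Bochner_Integration.integrable_add[OF c6(1,2)] c6(3)]
        Bochner_Integration.integral_add[OF c6(1,2)] integral_mult_right_zero
        Bochner_Integration.integral_diff[OF i1 i2] Bochner_Integration.integral_diff[OF c4 i5]
        Bochner_Integration.integral_diff[OF c3] Bochner_Integration.integral_diff[OF i3 i4(1)]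
        Fgap_def mD_def mU_def mY_def mX_def ..
  qed
  finally show ?thesis unfolding ey_u_Suc by simp
qed

lemma Fgap_Suc: "Fgap (Suc t) = p * expectation (\<lambda>s. F (x t s) - F xstar) + (1 - p) * Fgap t"
proof -
  have m: "(\<lambda>s. F (X s) - F xstar) \<in> borel_measurable (hist (past_y t))" if "L2 (past_y t) X" for X
    by (intro borel_measurable_diff measurable_compose[OF L2_hist[OF that] F_borel]) simp
  have "Fgap (Suc t) = expectation (\<lambda>s. if c t s then F (x t s) - F xstar else F (z t s) - F xstar)"
    unfolding Fgap_def z_Suc by (intro Bochner_Integration.integral_cong) auto
  also have "\<dots> = p * expectation (\<lambda>s. F (x t s) - F xstar) + (1 - p) * Fgap t"
    unfolding Fgap_def
    by (intro coin_expectation(2)[OF sources(4) c_distr past_fresh(2) past_subset(2)] m gap_integrable[of "past_y t"] L2_step L2_state_y)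
  finally show ?thesis .
qed

section \<open>The Lyapunov function and its descent\<close>

definition "err t = wt_H * mH t + wt_W * (\<theta> t)\<^sup>2 * mW t + wt_K * mK t + wt_N * mN t"

definition "\<Psi> t = G t * Fgap t + (Lb + G t * \<mu>) / 2 * mU t + p * G t * err t"

lemma err_nonneg: "0 \<le> err t"
  unfolding err_def using m_nonneg wt_nonneg by (intro add_nonneg_nonneg mult_nonneg_nonneg) auto

lemma err_Suc:
  "msq (ey t) / Lb + L * (\<theta> t)\<^sup>2 / 2 * mX t + err (Suc t)
    \<le> (1 - \<theta> t) * mD t + Lb * (\<theta> t)\<^sup>2 / 2 * mY t + (1 - p * \<theta> t) * err t"
  unfolding err_def
proof (rule error_terms_recursion[where b = "(b t)\<^sup>2"])
  have "(\<theta> t * b t)\<^sup>2 \<le> (1 / Lb)\<^sup>2"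
    using b_le[of t] \<theta>_pos[of t] b_pos(1)[of t] by (intro power_mono) auto
  then show "(\<theta> t)\<^sup>2 * (b t)\<^sup>2 \<le> 1 / Lb\<^sup>2"
    by (simp add: power_mult_distrib power_divide)
  show "\<theta> t \<le> 1 / 4" "p * \<theta> t \<le> \<alpha> / 4" "p * \<theta> t \<le> \<beta> / 4" "p * \<theta> t \<le> \<tau> / 4"
    using \<theta>_le_thmin[of t] p\<theta>_le[of t] thmin by linarith+
qed (rule m_nonneg msq_nonneg \<theta>_pos \<theta>_Suc_le less_imp_le[OF \<theta>_pos]
    mV_le mX_le mG_le mGF_le mKy_le mH_Suc mW_Suc mK_Suc mN_Suc)+

text \<open>The estimate is multiplied by p \<Gamma>_{t+1}. As \<gamma> = p \<theta> \<Gamma>_{t+1},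
  the distances receive the weights \<gamma> A = Lb + \<Gamma>_t \<mu> and \<gamma> (A + \<mu>) = Lb
  + \<Gamma>_{t+1} \<mu>, hence telescope. The coin contributes (1 - p) \<Gamma>_{t+1} to the
  coefficient of the old gap, which becomes (1 - p \<theta>) \<Gamma>_{t+1} = \<Gamma>_t.\<close>

lemma \<Psi>_Suc: "\<Psi> (Suc t) \<le> \<Psi> t"
proof -
  let ?G = "G (Suc t)" and ?\<theta> = "\<theta> t" and ?V = "msq (ey t)"
  have \<theta>V: "?\<theta> * (b t * ?V) \<le> ?V / Lb"
    using mult_right_mono[OF b_le[of t], of ?V] by simp
  \<comment> \<open>The amount of Y spent in the error recursion is covered by the negative proximal
    term of the objective estimate.\<close>
  have \<theta>Y: "Lb * ?\<theta>\<^sup>2 / 2 * mY t \<le> ?\<theta> * A t / 2 * mY t"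
  proof (rule mult_right_mono)
    show "Lb * ?\<theta>\<^sup>2 / 2 \<le> ?\<theta> * A t / 2"
      using mult_left_mono[OF A_ge[of t] less_imp_le[OF \<theta>_pos[of t]]] by (simp add: power2_eq_square mult_ac)
  qed (rule m_nonneg)
  have "expectation (\<lambda>s. F (x t s) - F xstar) + err (Suc t)
      \<le> (1 - ?\<theta>) * Fgap t + ?\<theta> * A t / 2 * mU t - ?\<theta> * (A t + \<mu>) / 2 * mU (Suc t) + (1 - p * ?\<theta>) * err t"
    using expected_objective_step[of t] err_Suc[of t] \<theta>V \<theta>Y by (simp add: algebra_simps)
  from mult_left_mono[OF this, of "p * ?G"]
  have "p * ?G * expectation (\<lambda>s. F (x t s) - F xstar) + p * ?G * err (Suc t)
      \<le> p * ?G * (1 - ?\<theta>) * Fgap t + \<gamma> t * A t / 2 * mU t - \<gamma> t * (A t + \<mu>) / 2 * mU (Suc t)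
        + p * ((1 - p * ?\<theta>) * ?G) * err t"
    using pos G_pos[of "Suc t"] by (simp add: \<gamma>_eq' algebra_simps)
  moreover have "\<gamma> t * A t = Lb + G t * \<mu>" using \<gamma>_pos[of t] by (simp add: A_def)
  moreover have "\<gamma> t * (A t + \<mu>) = Lb + ?G * \<mu>" using calculation(2) by (simp add: G_Suc algebra_simps)
  moreover have "?G * Fgap (Suc t) = p * ?G * expectation (\<lambda>s. F (x t s) - F xstar) + (1 - p) * ?G * Fgap t"
    unfolding Fgap_Suc by (simp add: algebra_simps)
  moreover have "p * ?G * (1 - ?\<theta>) * Fgap t + (1 - p) * ?G * Fgap t = G t * Fgap t"
    unfolding G_eq[of t] by (simp add: algebra_simps)
  moreover have "p * ((1 - p * ?\<theta>) * ?G) * err t = p * G t * err t"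
    by (simp only: G_eq[of t, symmetric])
  ultimately show ?thesis
    unfolding \<Psi>_def times_divide_eq_left[symmetric] by simp
qed

lemma \<Psi>_0: "\<Psi> 0 = \<Gamma>0 * (F x0 - F xstar) + (Lb + \<Gamma>0 * \<mu>) / 2 * (norm (x0 - xstar))\<^sup>2"
  by (simp add: \<Psi>_def err_def m_defs Fgap_def iterate_0 G_def prob_space)

lemma \<Psi>_le: "\<Psi> t \<le> \<Psi> 0"
  by (induction t) (auto intro: order_trans[OF \<Psi>_Suc])

section \<open>The linear rate\<close>

lemma G_growth:
  assumes r: "\<And>t. r \<le> p * \<theta> t"
  shows "\<Gamma>0 \<le> exp (- real t * r) * G t"
proof (induction t)
  case 0
  then show ?case by (simp add: G_def)
next
  case (Suc t)
  have "1 - p * \<theta> t \<le> exp (- r)"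
    using r[of t] exp_ge_add_one_self[of "- r"] by linarith
  then have "G t \<le> exp (- r) * G (Suc t)"
    unfolding G_eq[of t] using G_pos[of "Suc t"] by (intro mult_right_mono) auto
  then have "exp (- real t * r) * G t \<le> exp (- real t * r) * (exp (- r) * G (Suc t))"
    by (intro mult_left_mono) auto
  also have "\<dots> = exp (- real (Suc t) * r) * G (Suc t)"
    by (simp add: exp_add[symmetric] algebra_simps)
  finally show ?case using Suc by linarith
qed

text \<open>The errors and the \<open>Lb\<close> part of the distance term are nonnegative and
  dropped; what remains of the Lyapunov function is \<Gamma>_t times the left-hand side, and its
  initial value is \<Gamma>_0 times the bracket.\<close>

lemma expected_gap_le:
  assumes r: "\<And>t. r \<le> p * \<theta> t"
  shows "Fgap t + \<mu> / 2 * mU t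
    \<le> exp (- real t * r) * ((F x0 - F xstar) + (Lb / \<Gamma>0 + \<mu>) / 2 * (norm (x0 - xstar))\<^sup>2)"
proof -
  let ?R = "(F x0 - F xstar) + (Lb / \<Gamma>0 + \<mu>) / 2 * (norm (x0 - xstar))\<^sup>2"
  have R: "0 \<le> ?R" using xstar[of x0] pos mu_pos Gamma0 by (intro add_nonneg_nonneg mult_nonneg_nonneg) auto
  have "G t * (Fgap t + \<mu> / 2 * mU t) = \<Psi> t - Lb / 2 * mU t - p * G t * err t"
    by (simp add: \<Psi>_def algebra_simps)
  also have "\<dots> \<le> \<Psi> t"
  proof -
    have "0 \<le> Lb / 2 * mU t" "0 \<le> p * G t * err t"
      using pos m_nonneg G_pos[of t] err_nonneg[of t] by auto
    then show ?thesis by linarith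
  qed
  also have "\<dots> \<le> \<Psi> 0" by (rule \<Psi>_le)
  also have "\<dots> = \<Gamma>0 * ?R" unfolding \<Psi>_0 using Gamma0 by (simp add: field_simps)
  also have "\<dots> \<le> (exp (- real t * r) * G t) * ?R"
    by (rule mult_right_mono[OF G_growth[OF r] R])
  finally have "G t * (Fgap t + \<mu> / 2 * mU t) \<le> G t * (exp (- real t * r) * ?R)"
    by (simp only: mult_ac)
  then show ?thesis using G_pos[of t] by (simp only: mult_le_cancel_left_pos)
qed

text \<open>Integrability of the gap and of the squared distance identifies the extended nonnegative
  integrals of the theorem with the expectations above.\<close>

lemma nn_integral_le:
  assumes r: "\<And>t. r \<le> p * \<theta> t"
  shows "(\<integral>\<^sup>+ s. ennreal (F (z t s) - F xstar) \<partial>M) + ennreal (\<mu> / 2) * (\<integral>\<^sup>+ s. ennreal ((norm (u t s - xstar))\<^sup>2) \<partial>M)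
    \<le> ennreal (exp (- real t * r) * ((F x0 - F xstar) + (Lb / \<Gamma>0 + \<mu>) / 2 * (norm (x0 - xstar))\<^sup>2))"
proof -
  have "integrable M (\<lambda>s. (norm (u t s - xstar))\<^sup>2)"
    by (intro L2_integrable[of "past t"] L2_diff L2_state L2_const_state)
  then have "(\<integral>\<^sup>+ s. ennreal ((norm (u t s - xstar))\<^sup>2) \<partial>M) = ennreal (mU t)"
    unfolding mU_def by (intro nn_integral_eq_integral) auto
  moreover have "(\<integral>\<^sup>+ s. ennreal (F (z t s) - F xstar) \<partial>M) = ennreal (Fgap t)"
    unfolding Fgap_def using gap_integrable[OF L2_state(2)] xstar by (intro nn_integral_eq_integral) auto
  moreover have "0 \<le> Fgap t" unfolding Fgap_def by (intro Bochner_Integration.integral_nonneg) (simp add: xstar)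
  ultimately have "(\<integral>\<^sup>+ s. ennreal (F (z t s) - F xstar) \<partial>M)
      + ennreal (\<mu> / 2) * (\<integral>\<^sup>+ s. ennreal ((norm (u t s - xstar))\<^sup>2) \<partial>M) = ennreal (Fgap t + \<mu> / 2 * mU t)"
    using m_nonneg(1)[of t] mu_pos by (simp add: ennreal_mult[symmetric] ennreal_plus[symmetric] del: ennreal_plus)
  then show ?thesis using ennreal_leI[OF expected_gap_le[OF r, of t]] by (simp only:)
qed

text \<open>Test r / p in the quadratic: its square term is at most \<Gamma>_t \<mu> / 4 by the
  bound on r^2, its linear term at most half of Lb + \<Gamma>_t \<mu> since r \<le> 1/2. Both scale
  with \<Gamma>_t as the right-hand side does, so the bound is uniform in t.\<close>

lemma le_p\<theta>:
  assumes r: "0 < r" "r \<le> p * thmin" "r\<^sup>2 \<le> p * \<mu> / (4 * Lb)"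
  shows "r \<le> p * \<theta> t"
proof -
  have "r / p \<le> theta_bar Lb \<mu> p (G t)"
  proof (subst le_theta_bar_iff)
    have "r \<le> 1 / 2" using r(2) thmin(3) pos(2) by linarith
    then have "(Lb + G t * \<mu>) * r \<le> (Lb + G t * \<mu>) * (1 / 2)"
      using pos mu_pos G_pos[of t] by (intro mult_left_mono) auto
    moreover have "Lb * G t / p * r\<^sup>2 \<le> Lb * G t / p * (p * \<mu> / (4 * Lb))"
      using pos G_pos[of t] by (intro mult_left_mono[OF r(3)]) auto
    moreover have "Lb * G t / p * (p * \<mu> / (4 * Lb)) = G t * \<mu> / 4" using pos by simp
    moreover have "0 < G t * \<mu>" using G_pos mu_pos by simp
    moreover have "p * Lb * G t * (r / p)\<^sup>2 + p * (Lb + G t * \<mu>) * (r / p)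
        = Lb * G t / p * r\<^sup>2 + (Lb + G t * \<mu>) * r"
      using pos by (simp add: power_divide power2_eq_square[of p])
    moreover have "h \<le> a + c" if "e \<le> (a + c) * (1 / 2)" "x \<le> d" "d = c / 4" "0 < c" "h = x + e" "0 < a"
      for a c d e h x :: real
      using that by (simp add: distrib_right)
    ultimately show "p * Lb * G t * (r / p)\<^sup>2 + p * (Lb + G t * \<mu>) * (r / p) \<le> Lb + G t * \<mu>"
      using pos(12) by blast
  qed (use pos mu_pos G_pos r in auto)
  moreover have "r / p \<le> thmin" using r(2) pos by (simp add: pos_divide_le_eq mult.commute)
  ultimately have "r / p \<le> \<theta> t" by (simp add: \<theta>_def theta_next_def)
  then show ?thesis using pos by (simp add: pos_divide_le_eq mult.commute)
qed

end

section \<open>From the parameter choices to the rate\<close>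

text \<open>The rate 1/Q has to satisfy two conditions: it is at most \<open>p * thmin\<close>,
  which accounts for the last four entries of the maximum in Q, and its square is at most p \<mu> /
  (4 Lb), which accounts for the first six.\<close>

theorem theorem7:
  fixes f :: "nat \<Rightarrow> 'a::euclidean_space \<Rightarrow> real" and g :: "nat \<Rightarrow> 'a \<Rightarrow> 'a"
    and F :: "'a \<Rightarrow> real" and gF :: "'a \<Rightarrow> 'a"
    and n :: nat and Li :: "nat \<Rightarrow> real" and Lmax Lhat L \<mu> :: real and xstar x0 :: 'a
    and M :: "'m measure" and Ry Rz :: "nat \<Rightarrow> 'r measure" and RP :: "'r measure"
    and CDy CDz :: "nat \<Rightarrow> 'r \<Rightarrow> 'a \<Rightarrow> 'a" and CP :: "'r \<Rightarrow> 'a \<Rightarrow> 'a"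
    and ry rz :: "nat \<Rightarrow> nat \<Rightarrow> 'm \<Rightarrow> 'r" and rp :: "nat \<Rightarrow> 'm \<Rightarrow> 'r" and c :: "nat \<Rightarrow> 'm \<Rightarrow> bool"
    and \<omega> \<alpha> p \<tau> \<beta> \<Gamma>0 Lb thmin Q :: real and s0 :: "'a alg_state" and T :: nat
  assumes n_pos: "n \<ge> 1"
    and F_def: "F = (\<lambda>x. (1 / real n) * (\<Sum>i<n. f i x))"
    and gF_def: "gF = (\<lambda>x. (1 / real n) *\<^sub>R (\<Sum>i<n. g i x))"
    \<comment> \<open>Assumption 1\<close>
    and grad: "\<And>i x. i < n \<Longrightarrow> GDERIV (f i) x :> g i x"
    and smooth_i: "\<And>i x y. i < n \<Longrightarrow> norm (g i x - g i y) \<le> Li i * norm (x - y)"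
    and Lmax_def: "Lmax = Max (Li ` {..<n})"
    and Lhat_pos: "Lhat > 0"
    and Lhat: "\<And>x y. (1 / real n) * (\<Sum>i<n. (norm (g i x - g i y))\<^sup>2) \<le> Lhat\<^sup>2 * (norm (x - y))\<^sup>2"
    \<comment> \<open>Assumption 2\<close>
    and smooth: "\<And>x y. norm (gF x - gF y) \<le> L * norm (x - y)"
    \<comment> \<open>Assumption 3\<close>
    and convex_i: "\<And>i. i < n \<Longrightarrow> convex_on UNIV (f i)"
    and strong: "strongly_convex F \<mu>" and mu_pos: "\<mu> > 0"
    and xstar: "\<And>x. F xstar \<le> F x"
    \<comment> \<open>compressors and parameters\<close>
    and omega: "\<omega> \<ge> 0" and alpha: "0 < \<alpha>" "\<alpha> \<le> 1"
    and p: "0 < p" "p \<le> 1" and tau: "0 < \<tau>" "\<tau> \<le> 1" and Gamma0: "\<Gamma>0 \<ge> 1"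
    and CDy: "\<And>i. i < n \<Longrightarrow> unbiased_comp (Ry i) (CDy i) \<omega>"
    and CDz: "\<And>i. i < n \<Longrightarrow> unbiased_comp (Rz i) (CDz i) \<omega>"
    and CP: "contractive_comp RP CP \<alpha>"
    \<comment> \<open>probability space, distributions of seeds and coins, Assumption 4 (independence)\<close>
    and M: "prob_space M"
    and ry_meas: "\<And>t i. i < n \<Longrightarrow> ry t i \<in> measurable M (Ry i)"
    and rz_meas: "\<And>t i. i < n \<Longrightarrow> rz t i \<in> measurable M (Rz i)"
    and rp_meas: "\<And>t. rp t \<in> measurable M RP"
    and c_meas: "\<And>t. c t \<in> measurable M (count_space UNIV)"
    and ry_distr: "\<And>t i. i < n \<Longrightarrow> distr M (Ry i) (ry t i) = Ry i"
    and rz_distr: "\<And>t i. i < n \<Longrightarrow> distr M (Rz i) (rz t i) = Rz i"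
    and rp_distr: "\<And>t. distr M RP (rp t) = RP"
    and c_distr: "\<And>t. measure M {\<omega>\<in>space M. c t \<omega>} = p"
    and indep: "prob_space.indep_sets M
       (\<lambda>j. case j of RY t i \<Rightarrow> gen_events M (ry t i) (Ry i)
                   | RZ t i \<Rightarrow> gen_events M (rz t i) (Rz i)
                   | RPs t \<Rightarrow> gen_events M (rp t) RP
                   | RC t \<Rightarrow> gen_events M (c t) (count_space UNIV)) (rand_indices n)"
    \<comment> \<open>parameter choices of the theorem\<close>
    and Lb_def: "Lb = 660508 * Max {L / \<alpha>, L * p / (\<alpha> * \<tau>),
        sqrt (L * Lmax) * p * sqrt (\<omega> * \<tau>) / (\<alpha> * \<beta> * sqrt (real n)),
        sqrt (L * Lmax) * sqrt p * sqrt (\<omega> * \<tau>) / (\<alpha> * sqrt \<beta> * sqrt (real n)),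
        Lmax * \<omega> * p\<^sup>2 / (\<beta>\<^sup>2 * real n), Lmax * \<omega> / real n}"
    and beta_def: "\<beta> = 1 / (\<omega> + 1)"
    and thmin_def: "thmin = 1 / 4 * Min {1, \<alpha> / p, \<tau> / p, \<beta> / p}"
    and s0_def: "s0 = \<lparr>st_w = x0, st_z = x0, st_u = x0, st_k = gF x0, st_v = gF x0,
                       st_hi = (\<lambda>i. g i x0), st_h = (1 / real n) *\<^sub>R (\<Sum>i<n. g i x0)\<rparr>"
    and Q_def: "Q = 2 * sqrt 660508 * Max {sqrt (L / (\<alpha> * p * \<mu>)), sqrt (L / (\<alpha> * \<tau> * \<mu>)),
        sqrt (sqrt (L * Lmax) * (\<omega> + 1) * sqrt (\<omega> * \<tau>) / (\<alpha> * sqrt (real n) * \<mu>)),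
        sqrt (sqrt (L * Lmax) * sqrt (\<omega> + 1) * sqrt (\<omega> * \<tau>) / (\<alpha> * sqrt p * sqrt (real n) * \<mu>)),
        sqrt (Lmax * \<omega> * (\<omega> + 1)\<^sup>2 * p / (real n * \<mu>)), sqrt (Lmax * \<omega> / (real n * p * \<mu>)),
        1 / \<alpha>, 1 / \<tau>, \<omega> + 1, 1 / p}"
  shows "(\<integral>\<^sup>+ s. ennreal (F (st_z (alg_iter n g CDy CDz CP Lb \<mu> p thmin \<beta> \<tau> \<Gamma>0 s0 ry rz rp c T s))
                            - F xstar) \<partial>M)
         + ennreal (\<mu> / 2) * (\<integral>\<^sup>+ s. ennreal ((norm (st_u (alg_iter n g CDy CDz CP Lb \<mu> p thmin \<beta> \<tau> \<Gamma>0 s0 ry rz rp c T s)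
                            - xstar))\<^sup>2) \<partial>M)
       \<le> ennreal (2 * exp (- real T / Q) * ((F x0 - F xstar) + (Lb / \<Gamma>0 + \<mu>) * (norm (x0 - xstar))\<^sup>2))"
proof -
  have "finite_sum_problem f g F gF n Li Lmax L \<mu> xstar"
    by (rule finite_sum_problem.intro) (fact n_pos F_def gF_def grad smooth_i Lmax_def smooth convex_i strong mu_pos xstar)+
  then interpret P: finite_sum_problem f g F gF n Li Lmax L \<mu> xstar .
  have L: "0 < L" by (rule P.L_pos)
  have \<beta>: "0 < \<beta>" "\<beta> \<le> 1" "1 / \<beta> = \<omega> + 1" "\<beta> * (\<omega> + 1) = 1"
    using omega by (auto simp: beta_def)

  let ?S = "{L / \<alpha>, L * p / (\<alpha> * \<tau>),
        sqrt (L * Lmax) * p * sqrt (\<omega> * \<tau>) / (\<alpha> * \<beta> * sqrt (real n)),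
        sqrt (L * Lmax) * sqrt p * sqrt (\<omega> * \<tau>) / (\<alpha> * sqrt \<beta> * sqrt (real n)),
        Lmax * \<omega> * p\<^sup>2 / (\<beta>\<^sup>2 * real n), Lmax * \<omega> / real n}"
  have S_le: "660508 * e \<le> Lb" if "e \<in> ?S" for e
    unfolding Lb_def
    by (rule mult_left_mono[OF Max_ge[OF _ that]]) (simp_all only: finite_insert finite.emptyI zero_le_numeral)
  have Lb: "0 < Lb"
    by (rule less_le_trans[OF _ S_le[OF insertI1]]) (use L alpha in simp)
  have params: "two_direction_params \<alpha> \<beta> p \<tau> \<omega> L Lmax Lb (real n)"
  proof (rule two_direction_params.intro)
    show "1 \<le> real n" using n_pos by simp
    show "660508 * (L / \<alpha>) \<le> Lb" "660508 * (L * p / (\<alpha> * \<tau>)) \<le> Lb"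
      "660508 * (sqrt (L * Lmax) * p * sqrt (\<omega> * \<tau>) / (\<alpha> * \<beta> * sqrt (real n))) \<le> Lb"
      "660508 * (sqrt (L * Lmax) * sqrt p * sqrt (\<omega> * \<tau>) / (\<alpha> * sqrt \<beta> * sqrt (real n))) \<le> Lb"
      "660508 * (Lmax * \<omega> * p\<^sup>2 / (\<beta>\<^sup>2 * real n)) \<le> Lb" "660508 * (Lmax * \<omega> / real n) \<le> Lb"
      by (rule S_le, blast)+
  qed (fact alpha p tau omega \<beta> L P.Lmax_nonneg Lb)+

  have thm4: "4 * thmin = Min {1, \<alpha> / p, \<tau> / p, \<beta> / p}" by (simp add: thmin_def)
  then have thm_le: "4 * thmin \<le> 1" "4 * thmin \<le> \<alpha> / p" "4 * thmin \<le> \<tau> / p" "4 * thmin \<le> \<beta> / p"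
    by (simp_all only: Min_le finite_insert finite.emptyI insert_iff simp_thms)
  have thm_in: "4 * thmin \<in> {1, \<alpha> / p, \<tau> / p, \<beta> / p}"
    unfolding thm4 by (rule Min_in) (simp_all only: finite_insert finite.emptyI insert_not_empty not_False_eq_True)
  have "0 < e" if "e \<in> {1, \<alpha> / p, \<tau> / p, \<beta> / p}" for e
    using that alpha p tau \<beta> by auto
  from this[OF thm_in] have thm_pos: "0 < thmin" by simp
  have sources: "indep_sources M (rand_events M ry Ry rz Rz rp RP c) (rand_indices n)"
    by (intro indep_sources.intro indep_sources_axioms.intro M Int_stable_rand_events)
      (simp add: rand_events_def indep)
  have two_direction: "two_direction f g F gF n Li Lmax L \<mu> xstar \<alpha> \<beta> p \<tau> \<omega> Lb M ry Ry rz Rz rp RP c CDy CDz CP thmin \<Gamma>0"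
  proof (intro two_direction.intro two_direction_axioms.intro)
    show "\<beta> * (\<omega> + 1) = 1" by (rule \<beta>(4))
    show "0 < thmin" by (rule thm_pos)
    show "thmin \<le> 1 / 4" using thm_le(1) by simp
    show "p * thmin \<le> \<alpha> / 4" "p * thmin \<le> \<tau> / 4" "p * thmin \<le> \<beta> / 4"
      using thm_le p by (auto simp: field_simps)
  qed (fact P.finite_sum_problem_axioms params sources Gamma0 CDy CDz CP ry_meas rz_meas rp_meas c_meas
      ry_distr rz_distr rp_distr c_distr)+
  interpret A: two_direction f g F gF n Li Lmax L \<mu> xstar \<alpha> \<beta> p \<tau> \<omega> Lb M ry Ry rz Rz rp RP c CDy CDz CP thmin \<Gamma>0 x0
    by (rule two_direction)

  let ?S' = "{sqrt (L / (\<alpha> * p * \<mu>)), sqrt (L / (\<alpha> * \<tau> * \<mu>)),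
        sqrt (sqrt (L * Lmax) * (\<omega> + 1) * sqrt (\<omega> * \<tau>) / (\<alpha> * sqrt (real n) * \<mu>)),
        sqrt (sqrt (L * Lmax) * sqrt (\<omega> + 1) * sqrt (\<omega> * \<tau>) / (\<alpha> * sqrt p * sqrt (real n) * \<mu>)),
        sqrt (Lmax * \<omega> * (\<omega> + 1)\<^sup>2 * p / (real n * \<mu>)), sqrt (Lmax * \<omega> / (real n * p * \<mu>)),
        1 / \<alpha>, 1 / \<tau>, \<omega> + 1, 1 / p}"
  define m where "m = Max ?S'"
  have Q: "Q = 2 * sqrt 660508 * m" unfolding Q_def m_def ..
  have m_ge: "e \<le> m" if "e \<in> ?S'" for e
    unfolding m_def by (rule Max_ge[OF _ that]) (simp only: finite_insert finite.emptyI)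
  have m_inv: "\<omega> + 1 \<le> m" "1 / p \<le> m" "1 / \<alpha> \<le> m" "1 / \<tau> \<le> m"
    by (rule m_ge, blast)+
  have m1: "1 \<le> m" using m_inv(1) omega by simp
  have sqrt2: "2 \<le> sqrt 660508" by (rule real_le_rsqrt) simp
  \<comment> \<open>The 4 answers the factor 1/4 in \<open>thmin\<close>.\<close>
  have Q_ge: "4 * m \<le> Q" unfolding Q using m1 sqrt2 by (intro mult_right_mono) auto
  have Q_pos: "0 < Q" using Q_ge m1 by simp
  have Q_sq: "Q\<^sup>2 = 4 * (660508 * m\<^sup>2)" unfolding Q by (simp add: power_mult_distrib)

  \<comment> \<open>Each entry of the maximum in \<open>Lb\<close>, divided by p \<mu>, is the
    radicand of an entry of the maximum in \<open>Q\<close>; the two are matched through 1 / \<beta>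
    = \<omega> + 1.\<close>
  have S_m: "e / (p * \<mu>) \<le> m\<^sup>2" if "e \<in> ?S" for e
  proof -
    have sp: "inverse (sqrt p) = sqrt p * inverse p"
      using p by (simp add: field_simps)
    have s\<beta>: "inverse (sqrt \<beta>) = sqrt (\<omega> + 1)"
      unfolding real_sqrt_inverse[symmetric] by (rule arg_cong[where f = sqrt]) (simp add: beta_def)
    have "L / \<alpha> / (p * \<mu>) = L / (\<alpha> * p * \<mu>)" by simp
    moreover have "L * p / (\<alpha> * \<tau>) / (p * \<mu>) = L / (\<alpha> * \<tau> * \<mu>)" using p by simp
    moreover have "sqrt (L * Lmax) * p * sqrt (\<omega> * \<tau>) / (\<alpha> * \<beta> * sqrt (real n)) / (p * \<mu>)
        = sqrt (L * Lmax) * (\<omega> + 1) * sqrt (\<omega> * \<tau>) / (\<alpha> * sqrt (real n) * \<mu>)"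
      using p unfolding \<beta>(3)[symmetric] by simp
    moreover have "sqrt (L * Lmax) * sqrt p * sqrt (\<omega> * \<tau>) / (\<alpha> * sqrt \<beta> * sqrt (real n)) / (p * \<mu>)
        = sqrt (L * Lmax) * sqrt (\<omega> + 1) * sqrt (\<omega> * \<tau>) / (\<alpha> * sqrt p * sqrt (real n) * \<mu>)"
      unfolding s\<beta>[symmetric] divide_inverse inverse_mult_distrib sp by (simp only: mult_ac)
    moreover have "Lmax * \<omega> * p\<^sup>2 / (\<beta>\<^sup>2 * real n) / (p * \<mu>)
        = Lmax * \<omega> * (\<omega> + 1)\<^sup>2 * p / (real n * \<mu>)"
      using p unfolding \<beta>(3)[symmetric] by (simp add: power_divide power2_eq_square[of p])
    moreover have "Lmax * \<omega> / real n / (p * \<mu>) = Lmax * \<omega> / (real n * p * \<mu>)" by (simp add: mult.assoc)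
    ultimately have "sqrt (e / (p * \<mu>)) \<in> ?S'" using that by (elim insertE emptyE) (simp_all only: insert_iff simp_thms)
    from sqrt_le_D[OF m_ge[OF this]] show ?thesis .
  qed
  have "Max ?S \<in> ?S" by (rule Max_in) (simp_all only: finite_insert finite.emptyI insert_not_empty not_False_eq_True)
  from S_m[OF this] have "Lb / (p * \<mu>) \<le> 660508 * m\<^sup>2"
    unfolding Lb_def times_divide_eq_right[symmetric] by (rule mult_left_mono) (rule zero_le_numeral)
  then have "4 * Lb / (p * \<mu>) \<le> Q\<^sup>2" unfolding Q_sq by simp
  then have r2: "(1 / Q)\<^sup>2 \<le> p * \<mu> / (4 * Lb)"
    using Q_pos p mu_pos Lb by (simp add: field_simps)
  have r1: "1 / Q \<le> p * thmin"
  proof -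
    \<comment> \<open>\<open>4 * p * thmin\<close> is the least of p, \<alpha>, \<tau>, \<beta>, and
      the reciprocals of all four occur in the maximum of \<open>Q\<close>.\<close>
    have le: "1 / Q \<le> p * thmin" if "4 * thmin = e" "0 < p * e" "1 / (p * e) \<le> m" for e
    proof -
      have "4 / (p * e) \<le> Q" using Q_ge that(3) by simp
      then have "1 / Q \<le> p * e / 4" using that(2) Q_pos by (simp add: field_simps)
      then show ?thesis unfolding that(1)[symmetric] by simp
    qed
    have "1 / \<beta> \<le> m" unfolding \<beta>(3) by (rule m_inv)
    with thm_in m_inv p alpha tau \<beta> show ?thesis
      by (elim insertE emptyE) (erule le; simp)+
  qed
  have r: "1 / Q \<le> p * A.\<theta> t" for t
    by (rule A.le_p\<theta>[OF _ r1 r2]) (use Q_pos in simp)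
  let ?N = "(norm (x0 - xstar))\<^sup>2" and ?E = "exp (- real T / Q)"
  \<comment> \<open>The descent yields the bracket with half the distance term and without the
    factor 2, so the stated bound follows from nonnegativity of both summands.\<close>
  have "(F x0 - F xstar) + (Lb / \<Gamma>0 + \<mu>) / 2 * ?N \<le> 2 * ((F x0 - F xstar) + (Lb / \<Gamma>0 + \<mu>) * ?N)"
  proof -
    define K where "K = (Lb / \<Gamma>0 + \<mu>) * ?N"
    have "0 \<le> K" unfolding K_def using Lb Gamma0 mu_pos by simp
    moreover have "(Lb / \<Gamma>0 + \<mu>) / 2 * ?N = K / 2" by (simp add: K_def)
    ultimately show ?thesis unfolding K_def[symmetric] using xstar[of x0] by simp
  qed
  then have "?E * ((F x0 - F xstar) + (Lb / \<Gamma>0 + \<mu>) / 2 * ?N)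
      \<le> ?E * (2 * ((F x0 - F xstar) + (Lb / \<Gamma>0 + \<mu>) * ?N))"
    by (rule mult_left_mono) simp
  then have "ennreal (exp (- real T * (1 / Q)) * ((F x0 - F xstar) + (Lb / \<Gamma>0 + \<mu>) / 2 * ?N))
      \<le> ennreal (2 * ?E * ((F x0 - F xstar) + (Lb / \<Gamma>0 + \<mu>) * ?N))"
    by (intro ennreal_leI) (simp add: mult_ac)
  from order_trans[OF A.nn_integral_le[OF r] this] show ?thesis
    unfolding A.z_def A.u_def A.state_def s0_def .
qed

end
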